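(* Let $s_0=\sigma_0+it_0\in\mathbb{C}$ with $\frac12<\sigma_0<\frac32$, and let $\sigma$ be fixed with $\frac12<\sigma\le1$ and $\frac32<\sigma_0+\sigma\le2$; write $s=\sigma+it$ with $t\ge2$. Assume that as $t$ moves from $2$ to $T$, the point $(s_0,s)$ does not meet the hyperplane $s_0+s=2$. Then, as $T\to\infty$, $$\int_{2}^{T}|\zeta_2(s_0,\sigma+it)|^2\,dt=\zeta_2^{[2]}(s_0,2\sigma)\,T+\mathcal{R}(T),$$ where $$\mathcal{R}(T)=\begin{cases}O(T^{4-2\sigma_0-2\sigma}\log T)+O(T^{1/2}) & (\frac12<\sigma_0<1,\ \frac12<\sigma<1),\\ O(T^{2-2\sigma_0}(\log T)^2)+O(T^{1/2}) & (\frac12<\sigma_0<1,\ \sigma=1),\\ O(T^{2-2\sigma}(\log T)^3)+O(T^{1/2}) & (\sigma_0=1,\ \frac12<\sigma<1),\\ O(T^{1/2}) & (\sigma_0=1,\ \sigma=1),\\ O(T^{2-2\sigma}\log T)+O(T^{1/2}) & (1<\sigma_0<\frac32,\ \frac12<\sigma<1).\end{cases}$$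
   Context: The Euler double zeta-function is $$\zeta_2(s_1,s_2)=\sum_{m=1}^\infty\frac{1}{m^{s_1}}\sum_{n=1}^\infty\frac{1}{(m+n)^{s_2}}=\sum_{k=2}^\infty\Big(\sum_{m=1}^{k-1}\frac{1}{m^{s_1}}\Big)\frac{1}{k^{s_2}},$$ absolutely convergent for $\Re s_2>1$, $\Re(s_1+s_2)>2$, and continued meromorphically to $\mathbb{C}^2$ (singularities on $s_2=1$ and $s_1+s_2=2,1,0,-2,-4,\dots$). Also $$\zeta_2^{[2]}(s_1,s_2)=\sum_{k=2}^\infty\Big|\sum_{m=1}^{k-1}\frac{1}{m^{s_1}}\Big|^2\frac{1}{k^{s_2}},$$ convergent when $\Re s_1\ge1,\Re s_2>1$, or when $\Re s_1<1$ and $2\Re s_1+\Re s_2>3$. Implied constants may depend on $s_0$ and $\sigma$. *)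

theory Defs
  imports "HOL-Complex_Analysis.Complex_Analysis" "HOL-Library.Landau_Symbols"
    "HOL-Library.Set_Algebras" "HOL-Library.Function_Algebras"
begin

text \<open>Holomorphy in two variables: complex Frechet differentiability at every point, i.e. the
  derivative is a complex-linear form on the pairs.\<close>

definition holomorphic2_on :: "(complex \<times> complex \<Rightarrow> complex) \<Rightarrow> (complex \<times> complex) set \<Rightarrow> bool"
    (infixl \<open>holomorphic2'_on\<close> 50) where
  "f holomorphic2_on D \<longleftrightarrow>
     (\<forall>p\<in>D. \<exists>a b. (f has_derivative (\<lambda>h. a * fst h + b * snd h)) (at p within D))"

definition double_zeta_series :: "complex \<Rightarrow> complex \<Rightarrow> complex" where
  "double_zeta_series s1 s2 =
     (\<Sum>m. 1 / of_nat (Suc m) powr s1 * (\<Sum>n. 1 / of_nat (Suc m + Suc n) powr s2))"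

definition double_zeta_abs_conv :: "(complex \<times> complex) set" where
  "double_zeta_abs_conv = {(s1, s2). Re s2 > 1 \<and> Re (s1 + s2) > 2}"

definition double_zeta_sing :: "(complex \<times> complex) set" where
  "double_zeta_sing = {(s1, s2). s2 = 1 \<or> s1 + s2 = 2 \<or> s1 + s2 = 1 \<or>
     (\<exists>n::nat. s1 + s2 = - 2 * of_nat n)}"

text \<open>The complement of the singular hyperplanes is open and connected and contains the region of
  absolute convergence, so the continuation is unique there. The values on the hyperplanes
  themselves are unspecified.\<close>

definition is_double_zeta :: "(complex \<times> complex \<Rightarrow> complex) \<Rightarrow> bool" where
  "is_double_zeta Z \<longleftrightarrow> Z holomorphic2_on (- double_zeta_sing) \<and>
     (\<forall>(s1, s2) \<in> double_zeta_abs_conv. Z (s1, s2) = double_zeta_series s1 s2)"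

definition double_zeta :: "complex \<times> complex \<Rightarrow> complex" where
  "double_zeta = (SOME Z. is_double_zeta Z)"

definition double_zeta_sq :: "complex \<Rightarrow> complex \<Rightarrow> complex" where
  "double_zeta_sq s1 s2 =
     (\<Sum>j. let k = j + 2 in
        of_real ((cmod (\<Sum>m=1..k-1. 1 / of_nat m powr s1))\<^sup>2) / of_nat k powr s2)"

end

theory Submission imports Defs begin

text \<open>Euler-Maclaurin summation of the inner tail \<open>\<Sum>n>m. n powr -s\<close> gives
  \<open>m powr (1 - s) / (s - 1) - m powr -s / 2\<close>, terms \<open>m powr (1 - s - 2 k)\<close> and a remainder that is
  holomorphic in \<open>s\<close> and small in \<open>m\<close>; summing against \<open>m powr -s0\<close> expresses the double zeta
  function through the Riemann zeta function, which yields its continuation to the complement of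
  the singular hyperplanes.

  For the mean square over \<open>[A, 2 A]\<close> the double series is cut at \<open>N \<approx> 16 A\<close>. As \<open>\<bar>s\<bar> \<le> N / 4\<close>,
  iterating Euler-Maclaurin bounds the tail by \<open>O(A powr -1/2)\<close>. The remaining Dirichlet polynomial
  is squared and integrated termwise: the diagonal gives the main term and the off-diagonal terms,
  with \<open>1 / ln (k / j) \<le> k / (k - j)\<close>, the error. Summing over dyadic intervals finishes the proof.\<close>

subsection \<open>Bernoulli polynomials\<close>

text \<open>For \<open>\<sigma> \<le> 1\<close> the line of integration lies outside the region of
  absolute convergence, so cutting the series is only justified by a bound for the continued tail.
  The trivial estimate of its Euler-Maclaurin remainders loses a factor of size \<open>t\<close>;
  iteration repairs this once \<open>N / 4\<close> exceeds the heights that occur. On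
  \<open>[A, 2 A]\<close> these are the norms of \<open>s\<close> and \<open>s0 + s - 1\<close>,
  both at most \<open>4 A\<close>, whence the factor 16.

  The error \<open>T powr (1/2)\<close> is the cross term: over \<open>[A, 2 A]\<close> the
  polynomial has square integral \<open>O(A)\<close> and the tail has square integral
  \<open>O(1)\<close>. The diagonal series, the tail bound and the dominance of the main term all
  rest on a single inequality, \<open>\<kappa> + 1/2 < \<sigma>\<close>.

  The poles \<open>s = 1\<close> and \<open>s = 2 - s0\<close> lie at bounded height. The dyadic
  intervals therefore start at \<open>2 + 2 * cmod s0\<close>, beyond which the distance to both is
  comparable to \<open>A\<close>; below that, continuity gives a bounded contribution.\<close>

text \<open>On \<open>{0..1}\<close> this is the Bernoulli polynomial \<open>B\<^sub>k(x) / k!\<close>.\<close>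

primrec bernp :: "nat \<Rightarrow> real \<Rightarrow> real" where
  "bernp 0 = (\<lambda>x. 1)"
| "bernp (Suc k) = (\<lambda>x. integral {0..x} (bernp k) - integral {0..1} (\<lambda>y. integral {0..y} (bernp k)))"

lemma bernp_has_derivative_aux:
  assumes "continuous_on {0..1} (bernp k)" "x \<in> {0..1}"
  shows "(bernp (Suc k) has_real_derivative bernp k x) (at x within {0..1})"
proof -
  have "((\<lambda>u. integral {0..u} (bernp k)) has_vector_derivative bernp k x) (at x within {0..1})"
    using integral_has_vector_derivative[OF assms] .
  then have "((\<lambda>u. integral {0..u} (bernp k)) has_real_derivative bernp k x) (at x within {0..1})"
    by (simp add: has_real_derivative_iff_has_vector_derivative)
  then show ?thesis
    by (auto intro!: derivative_eq_intros)
qed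

lemma continuous_bernp: "continuous_on {0..1} (bernp k)"
proof (induction k)
  case 0
  then show ?case by simp
next
  case (Suc k)
  show ?case
    unfolding continuous_on_eq_continuous_within
    using bernp_has_derivative_aux[OF Suc] DERIV_continuous by blast
qed

lemma bernp_deriv:
  assumes "x \<in> {0..1}"
  shows "(bernp (Suc k) has_real_derivative bernp k x) (at x within {0..1})"
  using bernp_has_derivative_aux[OF continuous_bernp assms] .

lemma bernp_integrable: "bernp k integrable_on {0..1}"
  using continuous_bernp integrable_continuous_interval by blast

lemma integral_bernp_eq_0:
  assumes "k > 0"
  shows "integral {0..1} (bernp k) = 0"
proof -
  obtain j where k: "k = Suc j" using assms gr0_implies_Suc by blast
  define c where "c = integral {0..1} (\<lambda>y. integral {0..y} (bernp j))"
  have e: "(\<lambda>y. integral {0..y} (bernp j)) = (\<lambda>y. bernp k y + c)"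
    by (auto simp: k c_def)
  have "c = integral {0..1} (\<lambda>y. bernp k y + c)" using e c_def by metis
  also have "\<dots> = integral {0..1} (bernp k) + integral {0..1} (\<lambda>y::real. c)"
    by (rule Henstock_Kurzweil_Integration.integral_add) (use bernp_integrable in auto)
  finally show ?thesis by simp
qed

lemma bernp_ftc:
  assumes "0 \<le> a" "a \<le> b" "b \<le> 1"
  shows "(bernp k has_integral (bernp (Suc k) b - bernp (Suc k) a)) {a..b}"
  using assms
  by (intro fundamental_theorem_of_calculus)
     (auto simp flip: has_real_derivative_iff_has_vector_derivative simp del: bernp.simps
       intro!: DERIV_subset[OF bernp_deriv])

lemma bernp_1: "bernp 1 x = x - 1/2" if "x \<in> {0..1}" for x
proof -
  have "bernp (Suc 0) x = x - integral {0..1} (\<lambda>y::real. measure lborel {0..y})"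
    using that by (simp)
  moreover have "integral {0..1} (\<lambda>y::real. measure lborel {0..y}) = integral {0..1} (\<lambda>y::real. y)"
    by (intro Henstock_Kurzweil_Integration.integral_cong) auto
  moreover have "integral {0..1} (\<lambda>y::real. y) = 1/2"
    using ident_has_integral[of "0::real" 1] by (simp add: integral_unique)
  ultimately show ?thesis by simp
qed

lemma bernp_0_eq_1:
  assumes "k \<ge> 2"
  shows "bernp k 1 = bernp k 0"
proof -
  obtain j where j: "k = Suc j" "j > 0" using assms by (cases k) auto
  have "integral {0..1} (bernp j) = bernp k 1 - bernp k 0"
    unfolding j(1) by (rule integral_unique[OF bernp_ftc]) auto
  then show ?thesis using integral_bernp_eq_0[OF j(2)] by simp
qed

text \<open>A continuous function of mean zero cannot keep one strict sign, so some value at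
  \<open>y\<close> has a product at most 0 with the value at \<open>x\<close>. The derivative is at
  most 1 in absolute value by induction, so the two values differ by at most 1. Uniformity in
  \<open>k\<close> matters: the number of Euler-Maclaurin steps later grows with
  \<open>m\<close>.\<close>

lemma bernp_le_1:
  assumes "x \<in> {0..1}"
  shows "\<bar>bernp k x\<bar> \<le> 1"
  using assms
proof (induction k arbitrary: x)
  case 0
  then show ?case by simp
next
  case (Suc k)
  have lip: "\<bar>bernp (Suc k) b - bernp (Suc k) a\<bar> \<le> 1" if "0 \<le> a" "a \<le> b" "b \<le> 1" for a b
  proof -
    have "norm (bernp (Suc k) b - bernp (Suc k) a) \<le> 1 * measure lborel (cbox a b)"
      by (rule has_integral_bound[of 1 "bernp k"]) (use bernp_ftc[OF that] Suc.IH that in \<open>auto simp: cbox_interval simp del: bernp.simps\<close>)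
    then show ?thesis using that by (simp add: cbox_interval)
  qed
  have "\<exists>y\<in>{0..1}. bernp (Suc k) x * bernp (Suc k) y \<le> 0"
  proof (rule ccontr)
    assume neg: "\<not> ?thesis"
    then have pos: "bernp (Suc k) x * bernp (Suc k) y > 0" if "y \<in> {0..1}" for y
      using that by force
    have "integral {0..1} (\<lambda>y. bernp (Suc k) x * bernp (Suc k) y) = 0"
      using integral_bernp_eq_0[of "Suc k"] by (simp del: bernp.simps)
    moreover have "continuous_on {0..1} (\<lambda>y. bernp (Suc k) x * bernp (Suc k) y)"
      using continuous_bernp[of "Suc k"] by (intro continuous_intros) 
    ultimately have "bernp (Suc k) x * bernp (Suc k) y = 0" if "y \<in> {0..1}" for y
      using integral_eq_0_iff[of 0 1 "\<lambda>y. bernp (Suc k) x * bernp (Suc k) y"] pos that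
      by (auto simp del: bernp.simps simp: less_imp_le)
    from this[of 0] show False using pos[of 0] by (metis atLeastAtMost_iff less_irrefl order_refl zero_le_one)
  qed
  then obtain y where y: "y \<in> {0..1}" "bernp (Suc k) x * bernp (Suc k) y \<le> 0" by blast
  then have "\<bar>bernp (Suc k) x\<bar> \<le> \<bar>bernp (Suc k) x - bernp (Suc k) y\<bar>"
    by (auto simp: mult_le_0_iff simp del: bernp.simps)
  also have "\<dots> \<le> 1"
    using lip[of x y] lip[of y x] y Suc.prems by (cases "x \<le> y") (auto simp del: bernp.simps)
  finally show ?case .
qed

text \<open>By induction the difference of the two sides has derivative zero and is a constant; its
  integral over the unit interval vanishes, so the constant is 0.\<close>

lemma bernp_reflect:
  assumes "x \<in> {0..1}"
  shows "bernp k (1 - x) = (-1) ^ k * bernp k x"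
  using assms
proof (induction k arbitrary: x)
  case 0
  then show ?case by simp
next
  case (Suc k)
  define d where "d = (\<lambda>x. bernp (Suc k) (1 - x) - (-1) ^ Suc k * bernp (Suc k) x)"
  have der: "(d has_real_derivative 0) (at x within {0..1})" if "x \<in> {0..1}" for x
  proof -
    have "((\<lambda>x. bernp (Suc k) (1 - x)) has_real_derivative bernp k (1 - x) * (-1)) (at x within {0..1})"
    proof (rule DERIV_image_chain[unfolded o_def, where g = "\<lambda>x. 1 - x"])
      show "(bernp (Suc k) has_real_derivative bernp k (1 - x)) (at (1 - x) within (\<lambda>x. 1 - x) ` {0..1})"
        using that bernp_deriv[of "1 - x" k] by (intro DERIV_subset[OF bernp_deriv]) auto
      show "((\<lambda>x. 1 - x) has_real_derivative - 1) (at x within {0..1})"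
        by (auto intro!: derivative_eq_intros)
    qed
    then have "(d has_real_derivative bernp k (1 - x) * (-1) - (-1) ^ Suc k * bernp k x) (at x within {0..1})"
      unfolding d_def using bernp_deriv[OF that, of k]
      by (intro derivative_intros DERIV_cmult) 
    then show ?thesis using Suc.IH[OF that] by simp
  qed
  have const: "d y = d 0" if "y \<in> {0..1}" for y
    using has_field_derivative_zero_constant[of "{0..1}" d] der that
    by (metis atLeastAtMost_iff convex_real_interval(5) order_refl zero_le_one)
  have "(bernp (Suc k) has_integral 0) {0..1}"
    using integral_bernp_eq_0[of "Suc k"] bernp_integrable[of "Suc k"]
    by (metis has_integral_integral zero_less_Suc)
  moreover from this have "((\<lambda>x. bernp (Suc k) (1 - x)) has_integral 0) {0..1}"
    using has_integral_reflect_real[of "\<lambda>x. bernp (Suc k) (x + 1)" 0 0 "-1"]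
      has_integral_shift_real_ivl_iff[of "bernp (Suc k)" 0 0 1 1]
    by (simp add: add.commute del: bernp.simps)
  ultimately have "(d has_integral 0 - (-1) ^ Suc k * 0) {0..1}"
    unfolding d_def by (intro has_integral_diff has_integral_mult_right)
  then have "integral {0..1} d = 0" by (simp add: integral_unique)
  moreover have "integral {0..1} d = integral {0..1} (\<lambda>y::real. d 0)"
    using const by (intro Henstock_Kurzweil_Integration.integral_cong) blast
  ultimately have "d 0 = 0" by simp
  then show ?case using const[OF Suc.prems] by (simp add: d_def del: bernp.simps)
qed

text \<open>Reflection gives opposite values at the two ends, \<open>bernp_0_eq_1\<close> equal
  ones. This vanishing is why, at and below 0, only even integers occur as values of
  \<open>s1 + s2\<close> among the singularities.\<close>

lemma bernp_odd_0:
  assumes "odd k" "k \<noteq> 1"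
  shows "bernp k 0 = 0"
proof -
  have "k \<ge> 2" using assms by (cases k) auto
  then show ?thesis using bernp_reflect[of 0 k] bernp_0_eq_1[of k] assms by simp
qed

subsection \<open>Power sums\<close>

lemma powr_neg_le_diff:
  fixes x b :: real
  assumes "x > 0" "b \<ge> 0" "b \<noteq> 1"
  shows "b < 1 \<Longrightarrow> (1 - b) * (x + 1) powr (-b) \<le> (x + 1) powr (1 - b) - x powr (1 - b)"
    and "b > 1 \<Longrightarrow> (b - 1) * (x + 1) powr (-b) \<le> x powr (1 - b) - (x + 1) powr (1 - b)"
proof -
  have "\<exists>z>x. z < x + 1 \<and> (x + 1) powr (1 - b) - x powr (1 - b) = (x + 1 - x) * ((1 - b) * z powr (1 - b - 1))"
    by (rule MVT2) (use assms in \<open>auto intro!: derivative_eq_intros\<close>)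
  then obtain z where z: "x < z" "z < x + 1" "(x + 1) powr (1 - b) - x powr (1 - b) = (1 - b) * z powr (- b)"
    by auto
  have le: "(x + 1) powr (-b) \<le> z powr (-b)"
    using z assms by (intro powr_mono2') auto
  show "(1 - b) * (x + 1) powr (-b) \<le> (x + 1) powr (1 - b) - x powr (1 - b)" if "b < 1"
    unfolding z(3) using le that by (intro mult_left_mono) auto
  have "(b - 1) * (x + 1) powr (-b) \<le> (b - 1) * z powr (-b)" if "b > 1"
    using le that by (intro mult_left_mono) auto
  then show "(b - 1) * (x + 1) powr (-b) \<le> x powr (1 - b) - (x + 1) powr (1 - b)" if "b > 1"
    using z(3) that by (simp add: algebra_simps)
qed

lemma sum_powr_neg_le:
  fixes a :: real
  assumes "0 \<le> a" "a < 1"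
  shows "(\<Sum>k=1..N. real k powr (-a)) \<le> real N powr (1 - a) / (1 - a)"
proof (induction N)
  case 0
  then show ?case by simp
next
  case (Suc N)
  have "real (Suc N) powr (-a) \<le> (real (Suc N) powr (1 - a) - real N powr (1 - a)) / (1 - a)"
  proof (cases "N = 0")
    case True
    then show ?thesis using assms by (simp add: field_simps)
  next
    case False
    then show ?thesis using powr_neg_le_diff(1)[of "real N" a] assms
      by (simp add: field_simps)
  qed
  then show ?case using Suc by (simp add: diff_divide_distrib)
qed

lemma summable_shift_powr:
  fixes b :: real
  assumes "b > 1"
  shows "summable (\<lambda>n. real (m + n) powr (-b))"
  using summable_real_powr_iff[of "-b"] assms summable_iff_shift[of "\<lambda>n. real n powr (-b)" m]
  by (simp add: add.commute)

text \<open>The term at \<open>m\<close> is kept apart: it is at most \<open>m powr (1 - b)\<close>,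
  and the remaining ones telescope to at most \<open>m powr (1 - b) / (b - 1)\<close>.\<close>

lemma suminf_shift_powr_le:
  fixes b :: real
  assumes "b > 1" "m > 0"
  shows "(\<Sum>n. real (m + n) powr (-b)) \<le> b / (b - 1) * real m powr (1 - b)"
proof -
  have "(\<Sum>n<N. real (m + n) powr (-b)) \<le> b / (b - 1) * real m powr (1 - b)" for N
  proof -
    have 1: "(\<Sum>n<N. real (m + Suc n) powr (-b)) \<le> (real m powr (1 - b) - real (m + N) powr (1 - b)) / (b - 1)"
    proof (induction N)
      case 0
      then show ?case by simp
    next
      case (Suc N)
      have "real (m + Suc N) powr (-b) \<le> (real (m + N) powr (1 - b) - real (m + Suc N) powr (1 - b)) / (b - 1)"
        using powr_neg_le_diff(2)[of "real (m + N)" b] assms by (simp add: field_simps)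
      then show ?case using Suc by (simp add: diff_divide_distrib)
    qed
    have "(\<Sum>n<N. real (m + n) powr (-b)) \<le> (\<Sum>n<Suc N. real (m + n) powr (-b))"
      by simp
    also have "\<dots> = real m powr (-b) + (\<Sum>n<N. real (m + Suc n) powr (-b))"
      by (subst sum.lessThan_Suc_shift) simp
    also have "\<dots> \<le> real m powr (1 - b) + real m powr (1 - b) / (b - 1)"
    proof (rule add_mono)
      show "real m powr (-b) \<le> real m powr (1 - b)"
        using assms by (intro powr_mono) auto
      have "(real m powr (1 - b) - real (m + N) powr (1 - b)) / (b - 1) \<le> real m powr (1 - b) / (b - 1)"
        using assms by (intro divide_right_mono) auto
      then show "(\<Sum>n<N. real (m + Suc n) powr (-b)) \<le> real m powr (1 - b) / (b - 1)"
        using 1 by linarith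
    qed
    also have "\<dots> = b / (b - 1) * real m powr (1 - b)"
      using assms by (simp add: field_simps)
    finally show ?thesis .
  qed
  then show ?thesis
    using suminf_le_const[OF summable_shift_powr[OF assms(1)]] by blast
qed

lemma norm_of_nat_powr: "norm (of_nat n powr s :: complex) = real n powr Re s"
  using norm_powr_real_powr[of "of_nat n" s] by simp

subsection \<open>Euler-Maclaurin remainders\<close>

text \<open>Up to sign and the factor \<open>s (s + 1) ... (s + k - 1)\<close> this is the
  \<open>k\<close>-th Euler-Maclaurin remainder of \<open>x powr -s\<close> on
  \<open>[n, n + 1]\<close>. With the polynomial factor left outside, its bounds depend on
  \<open>Re s\<close> only.\<close>

definition em_int :: "nat \<Rightarrow> nat \<Rightarrow> complex \<Rightarrow> complex" where
  "em_int k n s = integral {0..1} (\<lambda>x. of_real (bernp k x) * (of_nat n + of_real x) powr (- s - of_nat k))"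

definition em_rem :: "nat \<Rightarrow> nat \<Rightarrow> complex \<Rightarrow> complex" where
  "em_rem k m s = (\<Sum>n. em_int k (m + n) s)"

lemma of_nat_plus_real_nonpos:
  assumes "n > 0" "x \<ge> 0"
  shows "of_nat n + complex_of_real x \<notin> \<real>\<^sub>\<le>\<^sub>0" "of_nat n + complex_of_real x \<noteq> 0"
proof -
  have "Re (of_nat n + complex_of_real x) > 0" using assms by simp
  then show "of_nat n + complex_of_real x \<notin> \<real>\<^sub>\<le>\<^sub>0" "of_nat n + complex_of_real x \<noteq> 0"
    by (auto simp: complex_nonpos_Reals_iff simp del: plus_complex.sel)
qed

lemma continuous_em_integrand:
  assumes "n > 0"
  shows "continuous_on {0..1} (\<lambda>x. of_real (bernp k x) * (of_nat n + of_real x) powr c :: complex)"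
  using assms of_nat_plus_real_nonpos
  by (intro continuous_intros continuous_on_of_real continuous_bernp) auto

lemma em_int_holomorphic:
  assumes "n > 0"
  shows "em_int k n holomorphic_on UNIV"
proof -
  have "(\<lambda>s. integral (cbox 0 1) (\<lambda>x. of_real (bernp k x) * (of_nat n + of_real x) powr (- s - of_nat k)))
          holomorphic_on UNIV"
  proof (rule leibniz_rule_holomorphic)
    show "((\<lambda>s. of_real (bernp k x) * (of_nat n + of_real x) powr (- s - of_nat k))
            has_field_derivative of_real (bernp k x) * (- Ln (of_nat n + of_real x) * (of_nat n + of_real x) powr (- s - of_nat k)))
            (at s within UNIV)" if "x \<in> cbox 0 1" for s x
      using of_nat_plus_real_nonpos[OF assms, of x] that
      by (auto intro!: derivative_eq_intros simp: powr_def)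
    show "(\<lambda>x. of_real (bernp k x) * (of_nat n + of_real x) powr (- s - of_nat k)) integrable_on cbox 0 (1::real)" for s :: complex
      using continuous_em_integrand[OF assms] by (auto intro: integrable_continuous_interval)
    have "continuous_on (UNIV \<times> cbox 0 1)
          (\<lambda>z. of_real (bernp k (snd z)) * (- Ln (of_nat n + of_real (snd z)) * (of_nat n + of_real (snd z)) powr (- (fst z::complex) - of_nat k)))"
      using of_nat_plus_real_nonpos[OF assms]
      by (intro continuous_intros continuous_on_compose2[OF continuous_bernp]) auto
    then show "continuous_on (UNIV \<times> cbox 0 1)
          (\<lambda>(s::complex, x). of_real (bernp k x) * (- Ln (of_nat n + of_real x) * (of_nat n + of_real x) powr (- s - of_nat k)))"
      by (simp add: case_prod_unfold)
  qed auto
  then show ?thesis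
    unfolding em_int_def[abs_def] by simp
qed

lemma em_int_bound:
  assumes "n > 0" "Re s + real k \<ge> 0"
  shows "norm (em_int k n s) \<le> real n powr (- Re s - real k)"
proof -
  have "norm (em_int k n s) \<le> real n powr (- Re s - real k) * (1 - 0)"
    unfolding em_int_def
  proof (rule integral_bound)
    show "continuous_on {0..1} (\<lambda>x. of_real (bernp k x) * (of_nat n + of_real x) powr (- s - of_nat k))"
      by (rule continuous_em_integrand[OF assms(1)])
    show "norm (of_real (bernp k x) * (of_nat n + of_real x) powr (- s - of_nat k)) \<le> real n powr (- Re s - real k)"
      if "x \<in> {0..1}" for x
    proof -
      have "norm ((of_nat n + of_real x) powr (- s - of_nat k)) = (real n + x) powr (- Re s - real k)"
        using norm_powr_real_powr[of "of_nat n + of_real x" "- s - of_nat k"] that by simp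
      also have "\<dots> \<le> real n powr (- Re s - real k)"
        using assms that by (intro powr_mono2') auto
      finally have 1: "norm ((of_nat n + of_real x) powr (- s - of_nat k)) \<le> real n powr (- Re s - real k)" .
      have "norm (of_real (bernp k x) * (of_nat n + of_real x) powr (- s - of_nat k)) \<le> 1 * real n powr (- Re s - real k)"
        unfolding norm_mult using bernp_le_1[OF that, of k] 1 by (intro mult_mono) auto
      then show ?thesis by simp
    qed
  qed auto
  then show ?thesis by simp
qed

lemma powr_shift_vector_derivative:
  assumes "n > 0" "x \<ge> 0"
  shows "((\<lambda>x. (of_nat n + of_real x) powr c) has_vector_derivative c * (of_nat n + of_real x) powr (c - 1 :: complex)) (at x within S)"
  by (rule has_vector_derivative_real_field)
     (use of_nat_plus_real_nonpos[OF assms] in \<open>auto intro!: derivative_eq_intros\<close>)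

lemma em_int_parts:
  assumes "n > 0"
  shows "em_int k n s = of_real (bernp (Suc k) 1) * of_nat (Suc n) powr (- s - of_nat k)
           - of_real (bernp (Suc k) 0) * of_nat n powr (- s - of_nat k) + (s + of_nat k) * em_int (Suc k) n s"
proof -
  define c where "c = - s - of_nat k"
  define F where "F = (\<lambda>x. of_real (bernp (Suc k) x) * (of_nat n + of_real x) powr c)"
  define f where "f = (\<lambda>x. of_real (bernp k x) * (of_nat n + of_real x) powr c)"
  define g where "g = (\<lambda>x. of_real (bernp (Suc k) x) * (of_nat n + of_real x) powr (- s - of_nat (Suc k)))"
  have c1: "c - 1 = - s - of_nat (Suc k)" by (simp add: c_def)
  have "((\<lambda>x. f x + c * g x) has_integral (F 1 - F 0)) {0..1}"
  proof (rule fundamental_theorem_of_calculus)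
    fix x :: real assume x: "x \<in> {0..1}"
    have 1: "((\<lambda>x. of_real (bernp (Suc k) x) :: complex) has_vector_derivative of_real (bernp k x)) (at x within {0..1})"
      using has_vector_derivative_of_real[of "bernp (Suc k)" "bernp k x" "at x within {0..1}"]
        bernp_deriv[OF x, of k] by (simp add: has_real_derivative_iff_has_vector_derivative del: bernp.simps)
    have "(F has_vector_derivative
       of_real (bernp (Suc k) x) * (c * (of_nat n + of_real x) powr (c - 1)) + of_real (bernp k x) * (of_nat n + of_real x) powr c) (at x within {0..1})"
      unfolding F_def
      by (rule has_vector_derivative_mult[OF 1 powr_shift_vector_derivative]) (use assms x in auto)
    then show "(F has_vector_derivative f x + c * g x) (at x within {0..1})"
      by (simp add: f_def g_def c1 algebra_simps)
  qed auto
  moreover have "f integrable_on {0..1}" "g integrable_on {0..1}"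
    unfolding f_def g_def using continuous_em_integrand[OF assms] integrable_continuous_interval by blast+
  then have "((\<lambda>x. f x + c * g x) has_integral (integral {0..1} f + c * integral {0..1} g)) {0..1}"
    by (intro has_integral_add has_integral_mult_right integrable_integral)
  ultimately have "integral {0..1} f + c * integral {0..1} g = F 1 - F 0"
    using has_integral_unique by blast
  moreover have "integral {0..1} f = em_int k n s" "integral {0..1} g = em_int (Suc k) n s"
    by (simp_all add: f_def g_def em_int_def c_def del: bernp.simps)
  ultimately have "em_int k n s = F 1 - F 0 - c * em_int (Suc k) n s"
    by (simp add: algebra_simps)
  then show ?thesis by (simp add: F_def c_def add.commute algebra_simps del: bernp.simps)
qed

lemma em_int_0:
  assumes "n > 0" "s \<noteq> 1"
  shows "em_int 0 n s = (of_nat (Suc n) powr (1 - s) - of_nat n powr (1 - s)) / (1 - s)"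
proof -
  define F where "F = (\<lambda>x. (of_nat n + of_real x) powr (1 - s) / (1 - s))"
  have "((\<lambda>x. (of_nat n + of_real x) powr (- s)) has_integral (F 1 - F 0)) {0..1}"
  proof (rule fundamental_theorem_of_calculus)
    fix x :: real assume x: "x \<in> {0..1}"
    have "((\<lambda>x. (of_nat n + of_real x) powr (1 - s)) has_vector_derivative
        (1 - s) * (of_nat n + of_real x) powr (1 - s - 1)) (at x within {0..1})"
      by (rule powr_shift_vector_derivative) (use assms x in auto)
    then have "(F has_vector_derivative (1 - s) * (of_nat n + of_real x) powr (1 - s - 1) / (1 - s)) (at x within {0..1})"
      unfolding F_def by (rule has_vector_derivative_divide)
    then show "(F has_vector_derivative (of_nat n + of_real x) powr (- s)) (at x within {0..1})"
      using assms by simp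
  qed auto
  then show ?thesis
    unfolding em_int_def F_def by (simp add: integral_unique diff_divide_distrib add.commute)
qed

lemma em_int_summable:
  assumes "m > 0" "Re s + real k > 1"
  shows "summable (\<lambda>n. norm (em_int k (m + n) s))"
proof (rule summable_comparison_test'[of "\<lambda>n. real (m + n) powr (- (Re s + real k))" 0])
  show "summable (\<lambda>n. real (m + n) powr (- (Re s + real k)))"
    using assms by (intro summable_shift_powr) auto
  show "norm (norm (em_int k (m + n) s)) \<le> real (m + n) powr (- (Re s + real k))" for n
    using em_int_bound[of "m + n" s k] assms by simp
qed

lemma em_rem_sums:
  assumes "m > 0" "Re s + real k > 1"
  shows "(\<lambda>n. em_int k (m + n) s) sums em_rem k m s"
  unfolding em_rem_def by (intro summable_sums summable_norm_cancel[OF em_int_summable] assms)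

lemma em_rem_bound:
  assumes "m > 0" "Re s + real k > 1"
  shows "norm (em_rem k m s) \<le> (Re s + real k) / (Re s + real k - 1) * real m powr (1 - Re s - real k)"
proof -
  have "norm (em_rem k m s) \<le> (\<Sum>n. norm (em_int k (m + n) s))"
    unfolding em_rem_def by (rule summable_norm[OF em_int_summable[OF assms]])
  also have "\<dots> \<le> (\<Sum>n. real (m + n) powr (- (Re s + real k)))"
  proof (intro suminf_le em_int_summable[OF assms] summable_shift_powr)
    show "norm (em_int k (m + n) s) \<le> real (m + n) powr (- (Re s + real k))" for n
      using em_int_bound[of "m + n" s k] assms by simp
  qed (use assms in auto)
  also have "\<dots> \<le> (Re s + real k) / (Re s + real k - 1) * real m powr (1 - (Re s + real k))"
    by (rule suminf_shift_powr_le) (use assms in auto)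
  finally show ?thesis by (simp add: algebra_simps)
qed

lemma powr_of_nat_tendsto_0:
  assumes "Re c < 0"
  shows "(\<lambda>n. of_nat (m + n) powr c :: complex) \<longlonglongrightarrow> 0"
proof -
  have "(\<lambda>n. real n powr Re c) \<longlonglongrightarrow> 0"
    using assms by (intro tendsto_neg_powr filterlim_real_sequentially)
  then have "(\<lambda>n. real (n + m) powr Re c) \<longlonglongrightarrow> 0" by (rule LIMSEQ_ignore_initial_segment)
  then have "(\<lambda>n. norm (of_nat (m + n) powr c :: complex)) \<longlonglongrightarrow> 0"
    by (simp add: norm_of_nat_powr add.commute del: of_nat_add)
  then show ?thesis by (rule tendsto_norm_zero_cancel)
qed

text \<open>For \<open>k \<ge> 1\<close> the values of \<open>bernp (Suc k)\<close> at 0 and 1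
  agree, so the boundary terms of the integration by parts telescope and only the one at
  \<open>m\<close> survives. A step lowers the power of \<open>m\<close> by one at the price of a
  linear factor in \<open>s\<close>.\<close>

lemma em_rem_rec:
  assumes "m > 0" "k > 0" "Re s + real k > 1"
  shows "em_rem k m s = - of_real (bernp (Suc k) 0) * of_nat m powr (- s - of_nat k) + (s + of_nat k) * em_rem (Suc k) m s"
proof -
  define b where "b = complex_of_real (bernp (Suc k) 0)"
  have "(\<lambda>n. of_nat (m + Suc n) powr (- s - of_nat k) - of_nat (m + n) powr (- s - of_nat k)) sums (0 - of_nat (m + 0) powr (- s - of_nat k))"
    by (rule telescope_sums) (use assms in \<open>intro powr_of_nat_tendsto_0; simp\<close>)
  then have "(\<lambda>n. b * (of_nat (m + Suc n) powr (- s - of_nat k) - of_nat (m + n) powr (- s - of_nat k)) + (s + of_nat k) * em_int (Suc k) (m + n) s)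
     sums (b * (0 - of_nat (m + 0) powr (- s - of_nat k)) + (s + of_nat k) * em_rem (Suc k) m s)"
    using em_rem_sums[of m s "Suc k"] assms by (intro sums_add sums_mult) auto
  moreover have "em_int k (m + n) s = b * (of_nat (m + Suc n) powr (- s - of_nat k) - of_nat (m + n) powr (- s - of_nat k)) + (s + of_nat k) * em_int (Suc k) (m + n) s" for n
    using em_int_parts[of "m + n" k s] assms bernp_0_eq_1[of "Suc k"]
    by (simp add: b_def algebra_simps del: bernp.simps)
  ultimately have "(\<lambda>n. em_int k (m + n) s) sums (b * (0 - of_nat (m + 0) powr (- s - of_nat k)) + (s + of_nat k) * em_rem (Suc k) m s)"
    by simp
  then show ?thesis
    using sums_unique2[OF em_rem_sums[OF assms(1,3)]] by (simp add: b_def del: bernp.simps)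
qed

lemma em_rem_expand:
  assumes "m > 0" "Re s > 0"
  shows "em_rem 1 m s = - (\<Sum>i<K. of_real (bernp (i + 2) 0) * pochhammer (s + 1) i * of_nat m powr (- s - of_nat (Suc i)))
            + pochhammer (s + 1) K * em_rem (Suc K) m s"
proof (induction K)
  case 0
  then show ?case by simp
next
  case (Suc K)
  have "em_rem (Suc K) m s = - of_real (bernp (K + 2) 0) * of_nat m powr (- s - of_nat (Suc K)) + (s + of_nat (Suc K)) * em_rem (Suc (Suc K)) m s"
    using em_rem_rec[of m "Suc K" s] assms by (simp del: bernp.simps of_nat_Suc)
  from arg_cong[OF this, of "\<lambda>z. pochhammer (s + 1) K * z"]
  have "pochhammer (s + 1) K * em_rem (Suc K) m s =
    - of_real (bernp (K + 2) 0) * pochhammer (s + 1) K * of_nat m powr (- s - of_nat (Suc K))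
     + pochhammer (s + 1) (Suc K) * em_rem (Suc (Suc K)) m s"
    by (simp add: pochhammer_Suc ring_distribs mult_ac add_ac del: bernp.simps)
  then show ?case unfolding Suc by (simp add: algebra_simps del: bernp.simps)
qed

text \<open>The analytic continuation to \<open>Re s > 0\<close> of the tail of the Dirichlet series of zeta
  from \<open>m + 1\<close> on.\<close>

definition zeta_tail :: "nat \<Rightarrow> complex \<Rightarrow> complex" where
  "zeta_tail m s = of_nat m powr (1 - s) / (s - 1) - of_nat m powr (- s) / 2 - s * em_rem 1 m s"

lemma zeta_tail_sums:
  assumes "m > 0" "Re s > 1"
  shows "(\<lambda>n. of_nat (m + Suc n) powr (- s)) sums zeta_tail m s"
proof -
  have s1: "s \<noteq> 1" using assms by auto
  have A: "(\<lambda>n. of_nat (m + Suc n) powr (1 - s) - of_nat (m + n) powr (1 - s)) sums (0 - of_nat (m + 0) powr (1 - s))"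
    by (rule telescope_sums) (use assms in \<open>intro powr_of_nat_tendsto_0; simp\<close>)
  have B: "(\<lambda>n. of_nat (m + Suc n) powr (- s) - of_nat (m + n) powr (- s)) sums (0 - of_nat (m + 0) powr (- s))"
    by (rule telescope_sums) (use assms in \<open>intro powr_of_nat_tendsto_0; simp\<close>)
  have C: "(\<lambda>n. em_int 1 (m + n) s) sums em_rem 1 m s"
    by (rule em_rem_sums) (use assms in auto)
  \<comment> \<open>The integral of \<open>x powr -s\<close> over a unit interval has a closed form,
    and by parts with \<open>bernp 1 x = x - 1/2\<close> it is a trapezoidal mean plus
    \<open>s * em_int 1\<close>. Writing the mean \<open>(a' + a) / 2\<close> as
    \<open>a' - (a' - a) / 2\<close> isolates one term of the series and leaves telescoping
    differences.\<close>
  have eq: "of_nat (m + Suc n) powr (- s) =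
      (of_nat (m + Suc n) powr (1 - s) - of_nat (m + n) powr (1 - s)) / (1 - s)
      + (of_nat (m + Suc n) powr (- s) - of_nat (m + n) powr (- s)) / 2 - s * em_int 1 (m + n) s" for n
  proof -
    have "complex_of_real (bernp 1 1) = 1 / 2" "complex_of_real (bernp 1 0) = - 1 / 2"
      by (subst bernp_1; simp)+
    then have "em_int 0 (m + n) s = of_nat (Suc (m + n)) powr (- s) / 2 + of_nat (m + n) powr (- s) / 2 + s * em_int 1 (m + n) s"
      using em_int_parts[of "m + n" 0 s] assms
      by (simp del: bernp.simps)
    then show ?thesis using em_int_0[of "m + n" s] assms s1 by (simp add: field_simps)
  qed
  have "(\<lambda>n. (of_nat (m + Suc n) powr (1 - s) - of_nat (m + n) powr (1 - s)) / (1 - s)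
      + (of_nat (m + Suc n) powr (- s) - of_nat (m + n) powr (- s)) / 2 - s * em_int 1 (m + n) s)
     sums ((0 - of_nat (m + 0) powr (1 - s)) / (1 - s) + (0 - of_nat (m + 0) powr (- s)) / 2 - s * em_rem 1 m s)"
    by (intro sums_add sums_diff sums_divide sums_mult A B C)
  also have "(0 - of_nat (m + 0) powr (1 - s)) / (1 - s) + (0 - of_nat (m + 0) powr (- s)) / 2 - s * em_rem 1 m s = zeta_tail m s"
    using s1 by (simp add: zeta_tail_def field_simps)
  finally show ?thesis by (simp only: eq[symmetric])
qed

lemma holomorphic_suminf:
  fixes f :: "nat \<Rightarrow> complex \<Rightarrow> complex"
  assumes "open S" "\<And>n. f n holomorphic_on S"
    and "\<And>z. z \<in> S \<Longrightarrow> \<exists>d M. d > 0 \<and> cball z d \<subseteq> S \<and> summable M \<and> (\<forall>n. \<forall>w\<in>cball z d. norm (f n w) \<le> M n)"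
  shows "(\<lambda>z. \<Sum>n. f n z) holomorphic_on S"
proof (rule holomorphic_uniform_sequence[where f = "\<lambda>n z. \<Sum>i<n. f i z"])
  show "(\<lambda>z. \<Sum>i<n. f i z) holomorphic_on S" for n
    by (intro holomorphic_intros assms)
  fix z assume "z \<in> S"
  then obtain d M where dM: "d > 0" "cball z d \<subseteq> S" "summable M" "\<And>n w. w \<in> cball z d \<Longrightarrow> norm (f n w) \<le> M n"
    using assms(3) by meson
  have "uniform_limit (cball z d) (\<lambda>n x. \<Sum>i<n. f i x) (\<lambda>x. \<Sum>i. f i x) sequentially"
    by (rule Weierstrass_m_test[of _ _ M]) (use dM in auto)
  then show "\<exists>d>0. cball z d \<subseteq> S \<and> uniform_limit (cball z d) (\<lambda>n x. \<Sum>i<n. f i x) (\<lambda>x. \<Sum>i. f i x) sequentially"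
    using dM by blast
qed (rule assms)

lemma Re_ge_cball: "w \<in> cball z d \<Longrightarrow> Re w \<ge> Re z - d"
  using complex_Re_le_cmod[of "z - w"] by (auto simp: dist_norm)

lemma em_rem_holomorphic:
  assumes "m > 0"
  shows "em_rem k m holomorphic_on {s. Re s + real k > 1}"
  unfolding em_rem_def[abs_def]
proof (rule holomorphic_suminf)
  show "open {s. Re s + real k > 1}"
    by (intro open_Collect_less continuous_intros)
  show "em_int k (m + n) holomorphic_on {s. Re s + real k > 1}" for n
    using em_int_holomorphic[of "m + n" k] assms holomorphic_on_subset by blast
  fix z assume z: "z \<in> {s. Re s + real k > 1}"
  define d where "d = (Re z + real k - 1) / 2"
  have d: "d > 0" using z by (simp add: d_def)
  have R: "Re w + real k \<ge> 1 + d" if "w \<in> cball z d" for w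
    using Re_ge_cball[OF that] by (simp add: d_def field_simps)
  show "\<exists>d M. d > 0 \<and> cball z d \<subseteq> {s. Re s + real k > 1} \<and> summable M \<and> (\<forall>n. \<forall>w\<in>cball z d. norm (em_int k (m + n) w) \<le> M n)"
  proof (intro exI[of _ d] exI[of _ "\<lambda>n. real (m + n) powr (- (1 + d))"] conjI allI ballI)
    show "cball z d \<subseteq> {s. Re s + real k > 1}" using R d by force
    show "summable (\<lambda>n. real (m + n) powr - (1 + d))" using d by (intro summable_shift_powr) auto
    fix n w assume w: "w \<in> cball z d"
    have "norm (em_int k (m + n) w) \<le> real (m + n) powr (- Re w - real k)"
      using R[OF w] d assms by (intro em_int_bound) auto
    also have "\<dots> \<le> real (m + n) powr (- (1 + d))"
      using R[OF w] assms by (intro powr_mono) auto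
    finally show "norm (em_int k (m + n) w) \<le> real (m + n) powr - (1 + d)" .
  qed (use d in auto)
qed

subsection \<open>The Riemann zeta function\<close>

text \<open>This is \<open>1 + zeta_tail 1 s\<close> after \<open>K\<close> Euler-Maclaurin steps at
  \<open>m = 1\<close>; the leading 1/2 is the first term of the zeta series less the trapezoidal
  correction.\<close>

definition zeta_em :: "nat \<Rightarrow> complex \<Rightarrow> complex" where
  "zeta_em K s = 1 / 2 + 1 / (s - 1) + s * (\<Sum>i<K. of_real (bernp (i + 2) 0) * pochhammer (s + 1) i)
     - s * pochhammer (s + 1) K * em_rem (Suc K) 1 s"

text \<open>The index is picked from the point so that \<open>Re s + K > 0\<close> always holds. By
  \<open>zeta_cont_eq\<close> every admissible \<open>K\<close> gives the same value, so the jumps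
  of the ceiling are harmless.\<close>

definition zeta_cont :: "complex \<Rightarrow> complex" where
  "zeta_cont s = zeta_em (nat \<lceil>\<bar>Re s\<bar>\<rceil> + 1) s"

lemma zeta_em_Suc:
  assumes "Re s + real K > 0"
  shows "zeta_em (Suc K) s = zeta_em K s"
proof -
  have "em_rem (Suc K) 1 s = - of_real (bernp (K + 2) 0) + (s + of_nat (Suc K)) * em_rem (Suc (Suc K)) 1 s"
    using em_rem_rec[of 1 "Suc K" s] assms by (simp del: bernp.simps)
  from arg_cong[OF this, of "\<lambda>z. s * pochhammer (s + 1) K * z"]
  have "s * pochhammer (s + 1) K * em_rem (Suc K) 1 s = - s * of_real (bernp (K + 2) 0) * pochhammer (s + 1) K
     + s * pochhammer (s + 1) (Suc K) * em_rem (Suc (Suc K)) 1 s"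
    by (simp add: pochhammer_Suc ring_distribs mult_ac add_ac del: bernp.simps)
  then show ?thesis
    unfolding zeta_em_def by (simp add: ring_distribs mult_ac del: bernp.simps)
qed

lemma zeta_em_stable:
  assumes "K \<le> L" "Re s + real K > 0"
  shows "zeta_em L s = zeta_em K s"
  using assms
proof (induction L rule: dec_induct)
  case (step n)
  then show ?case using zeta_em_Suc[of s n] by simp
qed simp

lemma zeta_cont_eq:
  assumes "Re s + real K > 0"
  shows "zeta_cont s = zeta_em K s"
proof -
  define L where "L = nat \<lceil>\<bar>Re s\<bar>\<rceil> + 1"
  have "Re s + real L > 0" unfolding L_def by linarith
  then show ?thesis
    using zeta_em_stable[of L K s] zeta_em_stable[of K L s] assms
    unfolding zeta_cont_def L_def[symmetric] by (cases "K \<le> L") auto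
qed

lemma pochhammer_holomorphic: "(\<lambda>s. pochhammer (s + 1) i :: complex) holomorphic_on A"
  unfolding pochhammer_prod by (intro holomorphic_intros)

lemma zeta_em_holomorphic: "zeta_em K holomorphic_on ({s. Re s + real K > 0} - {1})"
proof -
  have "em_rem (Suc K) 1 holomorphic_on ({s. Re s + real K > 0} - {1})"
    by (rule holomorphic_on_subset[OF em_rem_holomorphic]) auto
  then show ?thesis
    unfolding zeta_em_def[abs_def] by (intro holomorphic_intros pochhammer_holomorphic) auto
qed

lemma zeta_cont_holomorphic: "zeta_cont holomorphic_on (- {1})"
  unfolding holomorphic_on_open[OF open_Compl[OF closed_singleton]]
proof
  fix z :: complex assume z: "z \<in> - {1}"
  define K where "K = nat \<lceil>\<bar>Re z\<bar>\<rceil> + 1"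
  have zK: "z \<in> {s. Re s + real K > 0} - {1}" using z unfolding K_def by simp linarith
  have op: "open ({s. Re s + real K > 0} - {1})"
    by (intro open_Diff open_Collect_less continuous_intros closed_singleton)
  have "(zeta_em K has_field_derivative deriv (zeta_em K) z) (at z)"
    using holomorphic_derivI[OF zeta_em_holomorphic op zK] .
  then have "(zeta_cont has_field_derivative deriv (zeta_em K) z) (at z)"
    using op zK by (rule has_field_derivative_transform_within_open) (simp add: zeta_cont_eq[of _ K])
  then show "\<exists>f'. (zeta_cont has_field_derivative f') (at z)" by blast
qed

lemma zeta_cont_sums:
  assumes "Re s > 1"
  shows "(\<lambda>n. of_nat (Suc n) powr (- s)) sums zeta_cont s"
proof -
  have "(\<lambda>n. of_nat (Suc (Suc n)) powr (- s)) sums zeta_tail 1 s"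
    using zeta_tail_sums[of 1 s] assms by simp
  then have "(\<lambda>n. of_nat (Suc n) powr (- s)) sums (zeta_tail 1 s + of_nat (Suc 0) powr (- s))"
    by (subst (asm) sums_Suc_iff) simp
  also have "zeta_tail 1 s + of_nat (Suc 0) powr (- s) = zeta_cont s"
    using zeta_cont_eq[of s 0] assms by (simp add: zeta_em_def zeta_tail_def)
  finally show ?thesis .
qed

subsection \<open>Complex differentiability in two variables\<close>

text \<open>The condition inside \<open>holomorphic2_on\<close> with the unrestricted filter
  \<open>at p\<close>: closure under arithmetic then needs no reference to a domain, which returns
  only when the continuation is assembled.\<close>

definition cdiff2 :: "(complex \<times> complex \<Rightarrow> complex) \<Rightarrow> complex \<times> complex \<Rightarrow> bool" where
  "cdiff2 F p \<longleftrightarrow> (\<exists>a b. (F has_derivative (\<lambda>h. a * fst h + b * snd h)) (at p))"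

lemma cdiff2_const: "cdiff2 (\<lambda>_. c) p"
  unfolding cdiff2_def by (rule exI[of _ 0], rule exI[of _ 0]) simp

lemma cdiff2_fst: "cdiff2 fst p"
  unfolding cdiff2_def by (rule exI[of _ 1], rule exI[of _ 0]) (simp add: has_derivative_fst[OF has_derivative_ident, simplified])

lemma cdiff2_snd: "cdiff2 snd p"
  unfolding cdiff2_def by (rule exI[of _ 0], rule exI[of _ 1]) (simp add: has_derivative_snd[OF has_derivative_ident, simplified])

lemma cdiff2_add:
  assumes "cdiff2 F p" "cdiff2 G p"
  shows "cdiff2 (\<lambda>q. F q + G q) p"
proof -
  obtain a b c d where "(F has_derivative (\<lambda>h. a * fst h + b * snd h)) (at p)"
    "(G has_derivative (\<lambda>h. c * fst h + d * snd h)) (at p)"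
    using assms unfolding cdiff2_def by blast
  from has_derivative_add[OF this] show ?thesis
    unfolding cdiff2_def by (intro exI[of _ "a + c"] exI[of _ "b + d"]) (simp add: algebra_simps)
qed

lemma cdiff2_mult:
  assumes "cdiff2 F p" "cdiff2 G p"
  shows "cdiff2 (\<lambda>q. F q * G q) p"
proof -
  obtain a b c d where "(F has_derivative (\<lambda>h. a * fst h + b * snd h)) (at p)"
    "(G has_derivative (\<lambda>h. c * fst h + d * snd h)) (at p)"
    using assms unfolding cdiff2_def by blast
  from has_derivative_mult[OF this] show ?thesis
    unfolding cdiff2_def
    by (intro exI[of _ "F p * c + a * G p"] exI[of _ "F p * d + b * G p"]) (simp add: algebra_simps)
qed

lemma cdiff2_comp:
  assumes "cdiff2 F p" "g field_differentiable (at (F p))"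
  shows "cdiff2 (\<lambda>q. g (F q)) p"
proof -
  obtain a b where F: "(F has_derivative (\<lambda>h. a * fst h + b * snd h)) (at p)"
    using assms unfolding cdiff2_def by blast
  obtain c where "(g has_derivative (\<lambda>h. c * h)) (at (F p))"
    using assms(2) unfolding field_differentiable_def has_field_derivative_def by blast
  from has_derivative_compose[OF F this] show ?thesis
    unfolding cdiff2_def by (intro exI[of _ "c * a"] exI[of _ "c * b"]) (simp add: algebra_simps)
qed

lemma cdiff2_uminus: "cdiff2 F p \<Longrightarrow> cdiff2 (\<lambda>q. - F q) p"
  using cdiff2_mult[OF cdiff2_const[of "-1"], of F p] by simp

lemma cdiff2_diff: "cdiff2 F p \<Longrightarrow> cdiff2 G p \<Longrightarrow> cdiff2 (\<lambda>q. F q - G q) p"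
  using cdiff2_add[OF _ cdiff2_uminus, of F p G] by simp

lemma cdiff2_divide:
  assumes "cdiff2 F p" "cdiff2 G p" "G p \<noteq> 0"
  shows "cdiff2 (\<lambda>q. F q / G q) p"
  unfolding divide_inverse
  by (intro cdiff2_mult cdiff2_comp[where g = inverse] assms field_differentiable_inverse field_differentiable_ident)

lemma cdiff2_sum:
  assumes "\<And>i. i \<in> I \<Longrightarrow> cdiff2 (F i) p"
  shows "cdiff2 (\<lambda>q. \<Sum>i\<in>I. F i q) p"
  using assms by (induction I rule: infinite_finite_induct) (auto intro: cdiff2_const cdiff2_add)

lemma cdiff2_transform:
  assumes "cdiff2 F p" "open S" "p \<in> S" "\<And>q. q \<in> S \<Longrightarrow> F q = G q"
  shows "cdiff2 G p"
  using assms has_derivative_transform_within_open unfolding cdiff2_def by blast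

text \<open>Cauchy's inequality on the circle of radius \<open>r\<close> about \<open>z\<close>,
  which stays inside the ball of radius \<open>2 * r\<close>.\<close>

lemma deriv_bound:
  assumes "f holomorphic_on ball a (2 * r)" "\<And>z. z \<in> ball a (2 * r) \<Longrightarrow> norm (f z) \<le> U" "z \<in> ball a r" "r > 0"
  shows "norm (deriv f z) \<le> U / r"
proof -
  have sub: "cball z r \<subseteq> ball a (2 * r)"
    using assms(3) by (auto simp: subset_iff) (metis (no_types, opaque_lifting) add.commute add_less_le_mono dist_commute dist_triangle_lt mult_2)
  have "norm ((deriv ^^ 1) f z) \<le> fact 1 * U / r ^ 1"
  proof (rule Cauchy_inequality)
    show "f holomorphic_on ball z r" "continuous_on (cball z r) f"
      using holomorphic_on_subset[OF assms(1)] holomorphic_on_imp_continuous_on[OF holomorphic_on_subset[OF assms(1) sub]] sub ball_subset_cball by blast+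
    show "norm (f x) \<le> U" if "norm (z - x) = r" for x
      using sub that by (intro assms(2)) (auto simp: dist_norm subset_iff)
  qed (rule assms)
  then show ?thesis by simp
qed

text \<open>Each term is a product of functions of one variable, so Cauchy's estimate in each
  variable separately bounds both partial derivatives on the balls of half the radius. The
  differentiated series converge uniformly there, which permits differentiation term by
  term.\<close>

lemma cdiff2_product_series:
  fixes u v :: "nat \<Rightarrow> complex \<Rightarrow> complex"
  assumes r: "r > 0"
    and u: "\<And>n. u n holomorphic_on ball a (2 * r)" "\<And>n z. z \<in> ball a (2 * r) \<Longrightarrow> norm (u n z) \<le> U n"
    and v: "\<And>n. v n holomorphic_on ball b (2 * r)" "\<And>n z. z \<in> ball b (2 * r) \<Longrightarrow> norm (v n z) \<le> V n"
    and UV: "summable (\<lambda>n. U n * V n)"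
  shows "cdiff2 (\<lambda>p. \<Sum>n. u n (fst p) * v n (snd p)) (a, b)"
proof -
  define S where "S = ball a r \<times> ball b r"
  have S: "open S" "convex S" "(a, b) \<in> S"
    using r unfolding S_def by (auto intro: open_Times convex_Times)
  have S2: "fst p \<in> ball a r" "snd p \<in> ball b r" "fst p \<in> ball a (2 * r)" "snd p \<in> ball b (2 * r)" if "p \<in> S" for p
    using that r unfolding S_def by auto
  define \<alpha> where "\<alpha> = (\<lambda>n p. deriv (u n) (fst p) * v n (snd p))"
  define \<beta> where "\<beta> = (\<lambda>n p. u n (fst p) * deriv (v n) (snd p))"
  have U0: "U n \<ge> 0" for n using order_trans[OF norm_ge_zero u(2)[of a n]] r by simp
  have V0: "V n \<ge> 0" for n using order_trans[OF norm_ge_zero v(2)[of b n]] r by simp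
  have sm: "summable (\<lambda>n. U n * V n / r)" using UV by (rule summable_divide)
  have "uniform_limit S (\<lambda>n p. \<Sum>i<n. \<alpha> i p) (\<lambda>p. \<Sum>i. \<alpha> i p) sequentially"
  proof (rule Weierstrass_m_test[OF _ sm])
    fix n p assume p: "p \<in> S"
    have "norm (\<alpha> n p) \<le> (U n / r) * V n"
      unfolding \<alpha>_def norm_mult
      by (intro mult_mono deriv_bound[OF u(1) u(2)] v(2) S2[OF p] r norm_ge_zero divide_nonneg_pos U0)
    then show "norm (\<alpha> n p) \<le> U n * V n / r" by simp
  qed
  then have A: "\<forall>\<^sub>F n in sequentially. \<forall>p\<in>S. dist (\<Sum>i<n. \<alpha> i p) (\<Sum>i. \<alpha> i p) < e" if "e > 0" for e
    using that by (rule uniform_limitD)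
  have "uniform_limit S (\<lambda>n p. \<Sum>i<n. \<beta> i p) (\<lambda>p. \<Sum>i. \<beta> i p) sequentially"
  proof (rule Weierstrass_m_test[OF _ sm])
    fix n p assume p: "p \<in> S"
    have "norm (\<beta> n p) \<le> U n * (V n / r)"
      unfolding \<beta>_def norm_mult
      by (intro mult_mono deriv_bound[OF v(1) v(2)] u(2) S2[OF p] r norm_ge_zero U0)
    then show "norm (\<beta> n p) \<le> U n * V n / r" by simp
  qed
  then have B: "\<forall>\<^sub>F n in sequentially. \<forall>p\<in>S. dist (\<Sum>i<n. \<beta> i p) (\<Sum>i. \<beta> i p) < e" if "e > 0" for e
    using that by (rule uniform_limitD)
  have "\<exists>g. \<forall>p\<in>S. (\<lambda>n. u n (fst p) * v n (snd p)) sums (g p) \<and>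
     (g has_derivative (\<lambda>h. (\<Sum>i. \<alpha> i p) * fst h + (\<Sum>i. \<beta> i p) * snd h)) (at p within S)"
  proof (rule has_derivative_series[where f' = "\<lambda>n p h. \<alpha> n p * fst h + \<beta> n p * snd h" and x = "(a, b)"])
    show "((\<lambda>p. u n (fst p) * v n (snd p)) has_derivative (\<lambda>h. \<alpha> n p * fst h + \<beta> n p * snd h)) (at p within S)"
      if "p \<in> S" for n p
    proof -
      have "(u n has_derivative (*) (deriv (u n) (fst p))) (at (fst p))"
        using holomorphic_derivI[OF u(1) open_ball S2(3)[OF that]] by (simp add: has_field_derivative_def)
      from has_derivative_compose[OF has_derivative_fst[OF has_derivative_ident] this]
      have 1: "((\<lambda>p. u n (fst p)) has_derivative (\<lambda>h. deriv (u n) (fst p) * fst h)) (at p within S)" by simp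
      have "(v n has_derivative (*) (deriv (v n) (snd p))) (at (snd p))"
        using holomorphic_derivI[OF v(1) open_ball S2(4)[OF that]] by (simp add: has_field_derivative_def)
      from has_derivative_compose[OF has_derivative_snd[OF has_derivative_ident] this]
      have 2: "((\<lambda>p. v n (snd p)) has_derivative (\<lambda>h. deriv (v n) (snd p) * snd h)) (at p within S)" by simp
      from has_derivative_mult[OF 1 2] show ?thesis
        by (simp add: \<alpha>_def \<beta>_def algebra_simps)
    qed
    show "\<forall>\<^sub>F n in sequentially. \<forall>p\<in>S. \<forall>h.
        norm ((\<Sum>i<n. \<alpha> i p * fst h + \<beta> i p * snd h) - ((\<Sum>i. \<alpha> i p) * fst h + (\<Sum>i. \<beta> i p) * snd h)) \<le> e * norm h"
      if "e > 0" for e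
    proof -
      have e2: "e / 2 > 0" using that by simp
      show ?thesis
        using A[OF e2] B[OF e2]
      proof (eventually_elim, intro ballI allI)
        fix n p and h :: "complex \<times> complex"
        assume *: "\<forall>p\<in>S. dist (\<Sum>i<n. \<alpha> i p) (\<Sum>i. \<alpha> i p) < e / 2" "\<forall>p\<in>S. dist (\<Sum>i<n. \<beta> i p) (\<Sum>i. \<beta> i p) < e / 2"
          and p: "p \<in> S"
        define A' where "A' = (\<Sum>i<n. \<alpha> i p) - (\<Sum>i. \<alpha> i p)"
        define B' where "B' = (\<Sum>i<n. \<beta> i p) - (\<Sum>i. \<beta> i p)"
        have AB: "norm A' \<le> e / 2" "norm B' \<le> e / 2"
          using * p unfolding A'_def B'_def dist_norm[symmetric] by force+
        have "(\<Sum>i<n. \<alpha> i p * fst h + \<beta> i p * snd h) - ((\<Sum>i. \<alpha> i p) * fst h + (\<Sum>i. \<beta> i p) * snd h) = A' * fst h + B' * snd h"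
          by (simp add: A'_def B'_def sum.distrib sum_distrib_left algebra_simps)
        also have "norm \<dots> \<le> norm A' * norm (fst h) + norm B' * norm (snd h)"
          by (metis norm_mult norm_triangle_ineq)
        also have "\<dots> \<le> e / 2 * norm h + e / 2 * norm h"
          using AB that norm_fst_le[of "fst h" "snd h"] norm_snd_le[of "snd h" "fst h"] by (intro add_mono mult_mono) auto
        finally show "norm ((\<Sum>i<n. \<alpha> i p * fst h + \<beta> i p * snd h) - ((\<Sum>i. \<alpha> i p) * fst h + (\<Sum>i. \<beta> i p) * snd h)) \<le> e * norm h"
          by simp
      qed
    qed
    show "(\<lambda>n. u n (fst (a, b)) * v n (snd (a, b))) sums (\<Sum>n. u n a * v n b)"
    proof -
      have "norm (u n a * v n b) \<le> U n * V n" for n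
        unfolding norm_mult using u(2)[of a n] v(2)[of b n] r U0 by (intro mult_mono) auto
      then have "summable (\<lambda>n. u n a * v n b)"
        by (intro summable_comparison_test[OF _ UV]) auto
      then show ?thesis by (simp add: summable_sums)
    qed
  qed (use S in auto)
  then obtain g where g: "\<And>p. p \<in> S \<Longrightarrow> (\<lambda>n. u n (fst p) * v n (snd p)) sums (g p)"
     "\<And>p. p \<in> S \<Longrightarrow> (g has_derivative (\<lambda>h. (\<Sum>i. \<alpha> i p) * fst h + (\<Sum>i. \<beta> i p) * snd h)) (at p within S)"
    by blast
  have "cdiff2 g (a, b)"
    using g(2)[OF S(3)] unfolding cdiff2_def at_within_open[OF S(3) S(1)] by blast
  then show ?thesis
    by (rule cdiff2_transform[OF _ S(1) S(3)]) (use g(1) sums_unique in blast)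
qed

subsection \<open>Existence of the continuation of the double zeta function\<close>

lemma em_rem_bound2:
  assumes "m > 0" "Re s + real K \<ge> 1"
  shows "norm (em_rem (Suc K) m s) \<le> 2 * real m powr (- Re s - real K)"
proof -
  have "norm (em_rem (Suc K) m s) \<le> (Re s + real (Suc K)) / (Re s + real (Suc K) - 1) * real m powr (1 - Re s - real (Suc K))"
    by (rule em_rem_bound) (use assms in auto)
  also have "\<dots> \<le> 2 * real m powr (1 - Re s - real (Suc K))"
    using assms by (intro mult_right_mono) (auto simp: field_simps)
  finally show ?thesis by simp
qed

text \<open>The first condition makes \<open>em_rem_bound2\<close> applicable to every
  \<open>m\<close>, the second makes the remainder summable against \<open>m powr -s1\<close>. The
  regions increase with \<open>K\<close> and exhaust all pairs.\<close>

definition dz_dom :: "nat \<Rightarrow> (complex \<times> complex) set" where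
  "dz_dom K = {p. Re (snd p) + real K > 1 \<and> Re (fst p + snd p) + real K > 1}"

definition dz_rem :: "nat \<Rightarrow> complex \<times> complex \<Rightarrow> complex" where
  "dz_rem K p = (\<Sum>m. of_nat (Suc m) powr (- fst p) * em_rem (Suc K) (Suc m) (snd p))"

text \<open>The singular hyperplanes can be read off: \<open>s2 = 1\<close> is the denominator,
  \<open>s1 + s2 = 2\<close> and \<open>s1 + s2 = 1\<close> are the poles of the first two zeta
  values, and term \<open>i\<close> of the sum has its pole at \<open>s1 + s2 = -i\<close>.\<close>

definition dz_em :: "nat \<Rightarrow> complex \<times> complex \<Rightarrow> complex" where
  "dz_em K p = zeta_cont (fst p + snd p - 1) / (snd p - 1) - zeta_cont (fst p + snd p) / 2
     + snd p * (\<Sum>i<K. of_real (bernp (i + 2) 0) * pochhammer (snd p + 1) i * zeta_cont (fst p + snd p + of_nat (Suc i)))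
     - snd p * pochhammer (snd p + 1) K * dz_rem K p"

lemma dz_dom_open: "open (dz_dom K)"
  unfolding dz_dom_def by (intro open_Collect_conj open_Collect_less continuous_intros)

lemma dz_dom_mono: "K \<le> L \<Longrightarrow> dz_dom K \<subseteq> dz_dom L"
  by (auto simp: dz_dom_def) 

lemma dz_rem_sums:
  assumes "p \<in> dz_dom K"
  shows "(\<lambda>m. of_nat (Suc m) powr (- fst p) * em_rem (Suc K) (Suc m) (snd p)) sums dz_rem K p"
proof -
  have "summable (\<lambda>m. of_nat (Suc m) powr (- fst p) * em_rem (Suc K) (Suc m) (snd p))"
  proof (rule summable_comparison_test')
    show "summable (\<lambda>m. 2 * real (1 + m) powr (- (Re (fst p + snd p) + real K)))"
      using assms by (intro summable_mult summable_shift_powr) (auto simp: dz_dom_def)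
    fix m :: nat
    have "norm (of_nat (Suc m) powr (- fst p) * em_rem (Suc K) (Suc m) (snd p))
       \<le> real (Suc m) powr (- Re (fst p)) * (2 * real (Suc m) powr (- Re (snd p) - real K))"
      unfolding norm_mult norm_of_nat_powr using assms
      by (intro mult_mono em_rem_bound2) (auto simp: dz_dom_def)
    also have "\<dots> = 2 * real (1 + m) powr (- Re (fst p) + (- Re (snd p) - real K))"
      unfolding powr_add by simp
    also have "- Re (fst p) + (- Re (snd p) - real K) = - (Re (fst p + snd p) + real K)" by simp
    finally show "norm (of_nat (Suc m) powr (- fst p) * em_rem (Suc K) (Suc m) (snd p))
      \<le> 2 * real (1 + m) powr (- (Re (fst p + snd p) + real K))" .
  qed
  then show ?thesis unfolding dz_rem_def by (rule summable_sums)
qed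

text \<open>This is \<open>em_rem_rec\<close> summed against \<open>m powr -s1\<close>; on
  \<open>dz_dom K\<close> the separated power of \<open>m\<close> sums to an absolutely convergent
  zeta series. It makes \<open>dz_em K\<close> independent of \<open>K\<close> on common
  domains.\<close>

lemma dz_rem_rec:
  assumes "p \<in> dz_dom K"
  shows "dz_rem K p = - of_real (bernp (K + 2) 0) * zeta_cont (fst p + snd p + of_nat (Suc K))
           + (snd p + of_nat (Suc K)) * dz_rem (Suc K) p"
proof -
  define b where "b = complex_of_real (bernp (K + 2) 0)"
  have 1: "(\<lambda>m. of_nat (Suc m) powr (- (fst p + snd p + of_nat (Suc K)))) sums zeta_cont (fst p + snd p + of_nat (Suc K))"
    using assms by (intro zeta_cont_sums) (auto simp: dz_dom_def)
  have 2: "(\<lambda>m. of_nat (Suc m) powr (- fst p) * em_rem (Suc (Suc K)) (Suc m) (snd p)) sums dz_rem (Suc K) p"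
    using assms dz_dom_mono[of K "Suc K"] by (intro dz_rem_sums) auto
  have eq: "of_nat (Suc m) powr (- fst p) * em_rem (Suc K) (Suc m) (snd p) =
     - b * of_nat (Suc m) powr (- (fst p + snd p + of_nat (Suc K)))
     + (snd p + of_nat (Suc K)) * (of_nat (Suc m) powr (- fst p) * em_rem (Suc (Suc K)) (Suc m) (snd p))" for m
  proof -
    have "em_rem (Suc K) (Suc m) (snd p) = - b * of_nat (Suc m) powr (- snd p - of_nat (Suc K))
       + (snd p + of_nat (Suc K)) * em_rem (Suc (Suc K)) (Suc m) (snd p)"
      using em_rem_rec[of "Suc m" "Suc K" "snd p"] assms
      by (simp add: b_def dz_dom_def del: bernp.simps of_nat_Suc)
    moreover have "complex_of_nat (Suc m) powr (- (fst p + snd p + of_nat (Suc K)))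
       = of_nat (Suc m) powr (- fst p) * of_nat (Suc m) powr (- snd p - of_nat (Suc K))"
      unfolding powr_add[symmetric] by (rule arg_cong) (simp add: algebra_simps)
    ultimately show ?thesis by (simp add: ring_distribs mult_ac del: of_nat_Suc)
  qed
  have "(\<lambda>m. of_nat (Suc m) powr (- fst p) * em_rem (Suc K) (Suc m) (snd p)) sums
    (- b * zeta_cont (fst p + snd p + of_nat (Suc K)) + (snd p + of_nat (Suc K)) * dz_rem (Suc K) p)"
    unfolding eq by (intro sums_add sums_mult 1 2)
  then show ?thesis
    using sums_unique2[OF dz_rem_sums[OF assms]] by (simp add: b_def)
qed

lemma dz_em_Suc:
  assumes "p \<in> dz_dom K"
  shows "dz_em (Suc K) p = dz_em K p"
proof -
  from arg_cong[OF dz_rem_rec[OF assms], of "\<lambda>z. snd p * pochhammer (snd p + 1) K * z"]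
  have "snd p * pochhammer (snd p + 1) K * dz_rem K p =
      - snd p * of_real (bernp (K + 2) 0) * pochhammer (snd p + 1) K * zeta_cont (fst p + snd p + of_nat (Suc K))
     + snd p * pochhammer (snd p + 1) (Suc K) * dz_rem (Suc K) p"
    by (simp add: pochhammer_Suc ring_distribs mult_ac add_ac del: bernp.simps)
  then show ?thesis
    unfolding dz_em_def by (simp add: ring_distribs mult_ac del: bernp.simps)
qed

lemma dz_em_stable:
  assumes "K \<le> L" "p \<in> dz_dom K"
  shows "dz_em L p = dz_em K p"
  using assms
proof (induction L rule: dec_induct)
  case (step n)
  then show ?case using dz_em_Suc[of p n] dz_dom_mono[of K n] by auto
qed simp

lemma dz_em_unique:
  assumes "p \<in> dz_dom K" "p \<in> dz_dom L"
  shows "dz_em K p = dz_em L p"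
  using assms dz_em_stable[of K L p] dz_em_stable[of L K p] by (cases "K \<le> L") auto

lemma dz_rem_cdiff2:
  assumes "p \<in> dz_dom K"
  shows "cdiff2 (dz_rem K) p"
proof -
  obtain a b where p: "p = (a, b)" by (cases p)
  \<comment> \<open>The fractions 1/4 and 1/8 of the slack are chosen for balls of radius
    \<open>2 * r\<close>: the remainder loses \<open>2 * r\<close> and the exponent of the product
    loses \<open>4 * r\<close>, and half of each slack is still left.\<close>
  define r where "r = min ((Re b + real K - 1) / 4) ((Re (a + b) + real K - 1) / 8)"
  have r: "r > 0" "Re b + real K \<ge> 1 + 4 * r" "Re (a + b) + real K \<ge> 1 + 8 * r"
    using assms unfolding r_def by (auto simp: dz_dom_def p min_def field_simps)
  have Re_ball: "Re z > Re c - 2 * r" if "z \<in> ball c (2 * r)" for z c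
    using complex_Re_le_cmod[of "c - z"] that by (auto simp: dist_norm)
  have "cdiff2 (\<lambda>q. \<Sum>m. of_nat (Suc m) powr (- fst q) * em_rem (Suc K) (Suc m) (snd q)) (a, b)"
  proof (rule cdiff2_product_series[where r = r and U = "\<lambda>m. real (Suc m) powr (- Re a + 2 * r)"
        and V = "\<lambda>m. 2 * real (Suc m) powr (- Re b - real K + 2 * r)"])
    show "(\<lambda>z. of_nat (Suc m) powr (- z)) holomorphic_on ball a (2 * r)" for m
      by (intro holomorphic_intros)
    show "norm (of_nat (Suc m) powr (- z) :: complex) \<le> real (Suc m) powr (- Re a + 2 * r)" if "z \<in> ball a (2 * r)" for m z
      unfolding norm_of_nat_powr using Re_ball[OF that] by (intro powr_mono) auto
    show "em_rem (Suc K) (Suc m) holomorphic_on ball b (2 * r)" for m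
      using Re_ball[of _ b] r by (intro holomorphic_on_subset[OF em_rem_holomorphic]) force+
    show "norm (em_rem (Suc K) (Suc m) z) \<le> 2 * real (Suc m) powr (- Re b - real K + 2 * r)" if "z \<in> ball b (2 * r)" for m z
    proof -
      have "norm (em_rem (Suc K) (Suc m) z) \<le> 2 * real (Suc m) powr (- Re z - real K)"
        using Re_ball[OF that] r by (intro em_rem_bound2) auto
      also have "\<dots> \<le> 2 * real (Suc m) powr (- Re b - real K + 2 * r)"
        using Re_ball[OF that] by (intro mult_left_mono powr_mono) auto
      finally show ?thesis .
    qed
    have "(\<lambda>m. real (Suc m) powr (- Re a + 2 * r) * (2 * real (Suc m) powr (- Re b - real K + 2 * r)))
       = (\<lambda>m. 2 * real (1 + m) powr (- (Re (a + b) + real K - 4 * r)))"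
      by (rule ext) (auto simp flip: powr_add intro!: arg_cong2[where f = "(powr)"])
    moreover have "summable (\<lambda>m. 2 * real (1 + m) powr (- (Re (a + b) + real K - 4 * r)))"
      using r by (intro summable_mult summable_shift_powr) auto
    ultimately show "summable (\<lambda>m. real (Suc m) powr (- Re a + 2 * r) * (2 * real (Suc m) powr (- Re b - real K + 2 * r)))"
      by simp
  qed (rule r)
  then show ?thesis unfolding dz_rem_def[abs_def] p .
qed

lemma zeta_cont_field_differentiable: "s \<noteq> 1 \<Longrightarrow> zeta_cont field_differentiable (at s)"
  using zeta_cont_holomorphic by (auto simp: holomorphic_on_open open_Compl field_differentiable_def)

lemma dz_em_cdiff2:
  assumes "p \<in> dz_dom K" "p \<notin> double_zeta_sing"
  shows "cdiff2 (dz_em K) p"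
proof -
  have ns: "snd p \<noteq> 1" "fst p + snd p \<noteq> 2" "fst p + snd p \<noteq> 1" "\<And>n. fst p + snd p \<noteq> - 2 * of_nat n"
    using assms(2) by (auto simp: double_zeta_sing_def case_prod_beta)
  have zc: "cdiff2 (\<lambda>q. zeta_cont (fst q + snd q + c)) p" if "fst p + snd p + c \<noteq> 1" for c
    by (intro cdiff2_comp[where g = zeta_cont] cdiff2_add cdiff2_fst cdiff2_snd cdiff2_const
        zeta_cont_field_differentiable that)
  have "(\<lambda>s. pochhammer (s + 1) i :: complex) field_differentiable (at s)" for i s
    using pochhammer_holomorphic[of i UNIV] by (auto simp: holomorphic_on_open field_differentiable_def)
  then have ph: "cdiff2 (\<lambda>q. pochhammer (snd q + 1) i) p" for i
    by (rule cdiff2_comp[OF cdiff2_snd])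
  \<comment> \<open>The zeta factor of term \<open>i\<close> has its pole at
    \<open>s1 + s2 = -i\<close>. For odd \<open>i\<close> this is no excluded hyperplane, but there
    the Bernoulli coefficient vanishes; for even \<open>i\<close> it is excluded.\<close>
  have tm: "cdiff2 (\<lambda>q. of_real (bernp (i + 2) 0) * pochhammer (snd q + 1) i * zeta_cont (fst q + snd q + of_nat (Suc i))) p" for i
  proof (cases "odd i")
    case True
    then have "bernp (i + 2) 0 = 0" by (intro bernp_odd_0) auto
    then show ?thesis by (simp add: cdiff2_const del: bernp.simps)
  next
    case False
    then obtain n where "i = 2 * n" by auto
    then have "fst p + snd p + of_nat (Suc i) \<noteq> 1"
      using ns(4)[of n] by (simp add: eq_neg_iff_add_eq_0 algebra_simps)
    then show ?thesis by (intro cdiff2_mult ph zc cdiff2_const)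
  qed
  have z1: "cdiff2 (\<lambda>q. zeta_cont (fst q + snd q - 1)) p"
    using zc[of "-1"] ns(2) by (simp add: algebra_simps)
  have z0: "cdiff2 (\<lambda>q. zeta_cont (fst q + snd q)) p"
    using zc[of 0] ns(3) by simp
  show ?thesis
    unfolding dz_em_def[abs_def]
    by (intro cdiff2_add cdiff2_diff cdiff2_mult cdiff2_divide cdiff2_sum tm ph z1 z0 cdiff2_snd cdiff2_const
        dz_rem_cdiff2 assms) (use ns in auto)
qed

lemma dz_em_0_eq_series:
  assumes "Re s2 > 1" "Re (s1 + s2) > 2"
  shows "dz_em 0 (s1, s2) = double_zeta_series s1 s2"
proof -
  have s2: "s2 \<noteq> 1" using assms by auto
  have 1: "(\<lambda>m. of_nat (Suc m) powr (- (s1 + s2 - 1))) sums zeta_cont (s1 + s2 - 1)"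
    using assms by (intro zeta_cont_sums) auto
  have 2: "(\<lambda>m. of_nat (Suc m) powr (- (s1 + s2))) sums zeta_cont (s1 + s2)"
    using assms by (intro zeta_cont_sums) auto
  have 3: "(\<lambda>m. of_nat (Suc m) powr (- s1) * em_rem 1 (Suc m) s2) sums dz_rem 0 (s1, s2)"
    using dz_rem_sums[of "(s1, s2)" 0] assms by (simp add: dz_dom_def)
  have eq: "1 / of_nat (Suc m) powr s1 * (\<Sum>n. 1 / of_nat (Suc m + Suc n) powr s2) =
     of_nat (Suc m) powr (- (s1 + s2 - 1)) / (s2 - 1) - of_nat (Suc m) powr (- (s1 + s2)) / 2
     - s2 * (of_nat (Suc m) powr (- s1) * em_rem 1 (Suc m) s2)" for m
  proof -
    have "(\<Sum>n. 1 / of_nat (Suc m + Suc n) powr s2) = zeta_tail (Suc m) s2"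
      using zeta_tail_sums[of "Suc m" s2] assms
      by (simp add: sums_iff powr_minus_divide del: of_nat_Suc of_nat_add)
    moreover have "complex_of_nat (Suc m) powr (- (s1 + s2 - 1)) = of_nat (Suc m) powr (- s1) * of_nat (Suc m) powr (1 - s2)"
      unfolding powr_add[symmetric] by (rule arg_cong) (simp add: algebra_simps)
    moreover have "complex_of_nat (Suc m) powr (- (s1 + s2)) = of_nat (Suc m) powr (- s1) * of_nat (Suc m) powr (- s2)"
      unfolding powr_add[symmetric] by (rule arg_cong) (simp add: algebra_simps)
    moreover have "1 / complex_of_nat (Suc m) powr s1 = of_nat (Suc m) powr (- s1)"
      by (simp add: powr_minus_divide)
    ultimately show ?thesis
      by (simp only: zeta_tail_def) (simp add: ring_distribs mult_ac del: of_nat_Suc)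
  qed
  have "(\<lambda>m. 1 / of_nat (Suc m) powr s1 * (\<Sum>n. 1 / of_nat (Suc m + Suc n) powr s2)) sums
     (zeta_cont (s1 + s2 - 1) / (s2 - 1) - zeta_cont (s1 + s2) / 2 - s2 * dz_rem 0 (s1, s2))"
    unfolding eq by (intro sums_diff sums_divide sums_mult 1 2 3)
  then show ?thesis
    unfolding double_zeta_series_def sums_iff by (simp add: dz_em_def)
qed

text \<open>The \<open>SOME\<close> in \<open>double_zeta\<close> says nothing before a witness
  exists. The witness takes \<open>dz_em\<close> with an index depending on the point; near each
  point it agrees with a fixed \<open>dz_em K\<close>, so it inherits differentiability.\<close>

lemma is_double_zeta_double_zeta: "is_double_zeta double_zeta"
proof -
  define L where "L = (\<lambda>p::complex \<times> complex. nat \<lceil>\<bar>Re (snd p)\<bar> + \<bar>Re (fst p + snd p)\<bar>\<rceil> + 2)"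
  define Z where "Z = (\<lambda>p. dz_em (L p) p)"
  have L: "p \<in> dz_dom (L p)" for p
    unfolding dz_dom_def L_def mem_Collect_eq by linarith
  have Z: "dz_em K p = Z p" if "p \<in> dz_dom K" for p K
    unfolding Z_def using dz_em_unique[OF that L] .
  have "cdiff2 Z p" if "p \<in> - double_zeta_sing" for p
    by (rule cdiff2_transform[OF dz_em_cdiff2[OF L[of p]] dz_dom_open L[of p] Z]) (use that in auto)
  then have "Z holomorphic2_on (- double_zeta_sing)"
    unfolding holomorphic2_on_def cdiff2_def using has_derivative_at_withinI by blast
  moreover have "Z (s1, s2) = double_zeta_series s1 s2" if "(s1, s2) \<in> double_zeta_abs_conv" for s1 s2
    using that dz_em_0_eq_series[of s2 s1] Z[of "(s1, s2)" 0]
    by (auto simp: double_zeta_abs_conv_def dz_dom_def)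
  ultimately have "is_double_zeta Z"
    unfolding is_double_zeta_def by auto
  then show ?thesis unfolding double_zeta_def by (rule someI[of is_double_zeta])
qed

subsection \<open>Truncating the double series\<close>

definition psum :: "complex \<Rightarrow> nat \<Rightarrow> complex" where
  "psum s k = (\<Sum>m=1..<k. of_nat m powr (- s))"

definition dz_main :: "complex \<Rightarrow> nat \<Rightarrow> complex \<Rightarrow> complex" where
  "dz_main s0 N s = (\<Sum>k=1..N. psum s0 k * of_nat k powr (- s))"

text \<open>The pairs \<open>(m, k)\<close> with \<open>m < k\<close> and \<open>k > N\<close>, in
  continued form. Those with \<open>m \<le> N\<close> give the product of \<open>psum\<close> and
  \<open>zeta_tail N s\<close>; those with \<open>m > N\<close> give the sum of
  \<open>m powr -s0 * zeta_tail m s\<close>, split along the three terms of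
  \<open>zeta_tail\<close>.\<close>

definition dz_tail :: "complex \<Rightarrow> nat \<Rightarrow> complex \<Rightarrow> complex" where
  "dz_tail s0 N s = psum s0 (Suc N) * zeta_tail N s + zeta_tail N (s0 + s - 1) / (s - 1)
     - zeta_tail N (s0 + s) / 2 - s * (\<Sum>m. of_nat (N + Suc m) powr (- s0) * em_rem 1 (N + Suc m) s)"

lemma em_rem_1_bound:
  assumes "m > 0" "Re s > 1/2"
  shows "norm (em_rem 1 m s) \<le> 3 * real m powr (- Re s)"
proof -
  have "norm (em_rem 1 m s) \<le> (Re s + 1) / Re s * real m powr (- Re s)"
    using em_rem_bound[of m s 1] assms by simp
  also have "\<dots> \<le> 3 * real m powr (- Re s)"
    using assms by (intro mult_right_mono) (auto simp: field_simps)
  finally show ?thesis .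
qed

lemma em_rem_1_product_bound:
  assumes "m > 0" "Re s > 1/2" "Re (s0 + s) > 3/2"
  shows "norm (of_nat m powr (- s0) * em_rem 1 m s) \<le> 3 * real m powr (- (3/2))"
proof -
  have "norm (of_nat m powr (- s0) * em_rem 1 m s) \<le> real m powr (- Re s0) * (3 * real m powr (- Re s))"
    unfolding norm_mult norm_of_nat_powr using em_rem_1_bound[OF assms(1,2)] by (intro mult_mono) auto
  also have "\<dots> = 3 * real m powr (- Re s0 + - Re s)"
    unfolding powr_add by simp
  also have "\<dots> \<le> 3 * real m powr (- (3/2))"
    using assms by (intro mult_left_mono powr_mono) auto
  finally show ?thesis .
qed

lemma em_rem_1_product_summable:
  assumes "Re s > 1/2" "Re (s0 + s) > 3/2"
  shows "summable (\<lambda>m. of_nat (N + Suc m) powr (- s0) * em_rem 1 (N + Suc m) s)"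
proof (rule summable_comparison_test')
  show "summable (\<lambda>m. 3 * real (Suc N + m) powr (- (3/2)))"
    by (intro summable_mult summable_shift_powr) auto
  show "norm (of_nat (N + Suc m) powr (- s0) * em_rem 1 (N + Suc m) s) \<le> 3 * real (Suc N + m) powr (- (3/2))" for m
    using em_rem_1_product_bound[of "N + Suc m" s s0] assms by simp
qed

lemma double_zeta_series_eq:
  assumes "N > 0" "Re s > 1" "Re (s0 + s) > 2"
  shows "double_zeta_series s0 s = dz_main s0 N s + dz_tail s0 N s"
proof -
  have s1: "s \<noteq> 1" using assms by auto
  define g where "g = (\<lambda>m. of_nat (Suc m) powr (- s0) * zeta_tail (Suc m) s)"
  have eq: "g m = of_nat (Suc m) powr (- (s0 + s - 1)) / (s - 1) - of_nat (Suc m) powr (- (s0 + s)) / 2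
     - s * (of_nat (Suc m) powr (- s0) * em_rem 1 (Suc m) s)" for m
  proof -
    have "complex_of_nat (Suc m) powr (- (s0 + s - 1)) = of_nat (Suc m) powr (- s0) * of_nat (Suc m) powr (1 - s)"
      unfolding powr_add[symmetric] by (rule arg_cong) (simp add: algebra_simps)
    moreover have "complex_of_nat (Suc m) powr (- (s0 + s)) = of_nat (Suc m) powr (- s0) * of_nat (Suc m) powr (- s)"
      unfolding powr_add[symmetric] by (rule arg_cong) (simp add: algebra_simps)
    ultimately show ?thesis
      by (simp only: zeta_tail_def g_def) (simp add: ring_distribs mult_ac del: of_nat_Suc)
  qed
  have tail: "(\<lambda>m. g (N + m)) sums (zeta_tail N (s0 + s - 1) / (s - 1) - zeta_tail N (s0 + s) / 2
     - s * (\<Sum>m. of_nat (N + Suc m) powr (- s0) * em_rem 1 (N + Suc m) s))" if "N > 0" for N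
  proof -
    have "(\<lambda>m. of_nat (N + Suc m) powr (- (s0 + s - 1)) / (s - 1) - of_nat (N + Suc m) powr (- (s0 + s)) / 2
     - s * (of_nat (N + Suc m) powr (- s0) * em_rem 1 (N + Suc m) s)) sums (zeta_tail N (s0 + s - 1) / (s - 1) - zeta_tail N (s0 + s) / 2
     - s * (\<Sum>m. of_nat (N + Suc m) powr (- s0) * em_rem 1 (N + Suc m) s))"
      using assms that
      by (intro sums_diff sums_divide sums_mult zeta_tail_sums summable_sums em_rem_1_product_summable) auto
    then show ?thesis unfolding eq by simp
  qed
  have "summable (\<lambda>m. g (m + 1))" using tail[of 1] sums_summable by (simp add: add.commute)
  then have sg: "summable g" using summable_iff_shift[of g 1] by simp
  have "double_zeta_series s0 s = suminf g"
  proof -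
    have "1 / of_nat (Suc m) powr s0 * (\<Sum>n. 1 / of_nat (Suc m + Suc n) powr s) = g m" for m
      using zeta_tail_sums[of "Suc m" s] assms
      by (simp add: sums_iff powr_minus_divide g_def del: of_nat_Suc of_nat_add)
    then show ?thesis unfolding double_zeta_series_def by simp
  qed
  \<comment> \<open>Passing from \<open>N\<close> to \<open>N + 1\<close> moves the pairs with
    \<open>k = N + 1\<close> from the middle term into \<open>dz_main\<close>, while row
    \<open>m = N + 1\<close> leaves the last sum and joins \<open>psum\<close>. At
    \<open>N = 0\<close> the expression \<open>zeta_tail 0 s\<close> has no meaning as a tail, but
    its factor \<open>psum\<close> is an empty sum.\<close>
  also have "suminf g = dz_main s0 N s + psum s0 (Suc N) * zeta_tail N s + (\<Sum>m. g (N + m))"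
  proof (induction N)
    case 0
    then show ?case by (simp add: dz_main_def psum_def)
  next
    case (Suc N)
    have g1: "(\<Sum>m. g (N + m)) = g N + (\<Sum>m. g (Suc N + m))"
      using suminf_split_head[of "\<lambda>m. g (N + m)"] summable_iff_shift[of g N] sg by (simp add: add.commute)
    have z: "psum s0 (Suc N) * zeta_tail N s = psum s0 (Suc N) * (of_nat (Suc N) powr (- s) + zeta_tail (Suc N) s)"
    proof (cases "N = 0")
      case True
      then show ?thesis by (simp add: psum_def)
    next
      case False
      have "(\<lambda>n. of_nat (N + Suc n) powr (- s)) sums zeta_tail N s"
        using False assms by (intro zeta_tail_sums) auto
      then have "(\<lambda>n. of_nat (Suc N + Suc n) powr (- s)) sums (zeta_tail N s - of_nat (Suc N) powr (- s))"
        using sums_Suc_iff[of "\<lambda>n. of_nat (N + Suc n) powr (- s)" "zeta_tail N s - of_nat (Suc N) powr (- s)"] by simp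
      moreover have "(\<lambda>n. of_nat (Suc N + Suc n) powr (- s)) sums zeta_tail (Suc N) s"
        using assms by (intro zeta_tail_sums) auto
      ultimately have "zeta_tail (Suc N) s = zeta_tail N s - of_nat (Suc N) powr (- s)"
        using sums_unique2 by blast
      then show ?thesis by simp
    qed
    have p: "psum s0 (Suc (Suc N)) = psum s0 (Suc N) + of_nat (Suc N) powr (- s0)"
      by (simp add: psum_def)
    show ?case
      unfolding Suc g1 z p by (simp add: dz_main_def g_def algebra_simps del: of_nat_Suc)
  qed
  also have "\<dots> = dz_main s0 N s + dz_tail s0 N s"
    using tail[OF assms(1)] by (simp add: sums_iff dz_tail_def)
  finally show ?thesis .
qed

section \<open>Extending the truncated formula beyond absolute convergence\<close>

lemma em_rem_1_product_holomorphic: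
  "(\<lambda>s. \<Sum>m. of_nat (N + Suc m) powr (- s0) * em_rem 1 (N + Suc m) s)
     holomorphic_on {s. Re s > 1/2 \<and> Re (s0 + s) > 3/2}"
proof (rule holomorphic_suminf)
  show op: "open {s. Re s > 1/2 \<and> Re (s0 + s) > 3/2}"
    by (intro open_Collect_conj open_Collect_less continuous_intros)
  show "(\<lambda>s. of_nat (N + Suc m) powr (- s0) * em_rem 1 (N + Suc m) s) holomorphic_on {s. Re s > 1/2 \<and> Re (s0 + s) > 3/2}" for m
    by (intro holomorphic_intros holomorphic_on_subset[OF em_rem_holomorphic]) auto
  fix z assume "z \<in> {s. Re s > 1/2 \<and> Re (s0 + s) > 3/2}"
  then obtain d where d: "d > 0" "cball z d \<subseteq> {s. Re s > 1/2 \<and> Re (s0 + s) > 3/2}"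
    using op open_contains_cball by blast
  have "norm (of_nat (N + Suc m) powr (- s0) * em_rem 1 (N + Suc m) w) \<le> 3 * real (Suc N + m) powr (- (3/2))"
    if "w \<in> cball z d" for m w
    using em_rem_1_product_bound[of "N + Suc m" w s0] d(2) that by auto
  moreover have "summable (\<lambda>m. 3 * real (Suc N + m) powr (- (3/2)))"
    by (intro summable_mult summable_shift_powr) auto
  ultimately show "\<exists>d M. d > 0 \<and> cball z d \<subseteq> {s. Re s > 1/2 \<and> Re (s0 + s) > 3/2} \<and> summable M \<and>
      (\<forall>n. \<forall>w\<in>cball z d. norm (of_nat (N + Suc n) powr (- s0) * em_rem 1 (N + Suc n) w) \<le> M n)"
    using d by blast
qed

lemma zeta_tail_holomorphic:
  assumes "N > 0"
  shows "zeta_tail N holomorphic_on ({s. Re s > 0} - {1})"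
  unfolding zeta_tail_def[abs_def] using assms
  by (intro holomorphic_intros holomorphic_on_subset[OF em_rem_holomorphic]) auto

lemma dz_tail_holomorphic:
  assumes "N > 0"
  shows "dz_tail s0 N holomorphic_on ({s. Re s > 1/2 \<and> Re (s0 + s) > 3/2} - {1, 2 - s0})"
proof -
  let ?A = "{s. Re s > 1/2 \<and> Re (s0 + s) > 3/2} - {1, 2 - s0}"
  have 0: "zeta_tail N holomorphic_on ?A"
    by (rule holomorphic_on_subset[OF zeta_tail_holomorphic[OF assms]]) auto
  have 1: "(\<lambda>s. zeta_tail N (s0 + s - 1)) holomorphic_on ?A"
    by (rule holomorphic_on_compose_gen[unfolded o_def, OF _ zeta_tail_holomorphic[OF assms]])
       (auto intro!: holomorphic_intros simp: algebra_simps)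
  have 2: "(\<lambda>s. zeta_tail N (s0 + s)) holomorphic_on ?A"
    by (rule holomorphic_on_compose_gen[unfolded o_def, OF _ zeta_tail_holomorphic[OF assms]])
       (auto intro!: holomorphic_intros simp: complex_eq_iff)
  have 3: "(\<lambda>s. \<Sum>m. of_nat (N + Suc m) powr (- s0) * em_rem 1 (N + Suc m) s) holomorphic_on ?A"
    by (rule holomorphic_on_subset[OF em_rem_1_product_holomorphic]) auto
  show ?thesis
    unfolding dz_tail_def[abs_def] by (intro holomorphic_intros 0 1 2 3) auto
qed

text \<open>With \<open>Re (s0 + s) > 3/2\<close> the hyperplanes
  \<open>s0 + s = 1, 0, -2, ...\<close> are out of reach, so only \<open>s = 1\<close> and
  \<open>s = 2 - s0\<close> have to be removed from the slice.\<close>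

lemma double_zeta_slice_holomorphic:
  "(\<lambda>s. double_zeta (s0, s)) holomorphic_on ({s. Re s > 1/2 \<and> Re (s0 + s) > 3/2} - {1, 2 - s0})"
proof -
  let ?A = "{s. Re s > 1/2 \<and> Re (s0 + s) > 3/2} - {1, 2 - s0}"
  have sub: "(\<lambda>s. (s0, s)) ` ?A \<subseteq> - double_zeta_sing"
  proof safe
    fix s assume s: "Re s > 1/2" "Re (s0 + s) > 3/2" "s \<noteq> 1" "s \<noteq> 2 - s0" "(s0, s) \<in> double_zeta_sing"
    have "s0 + s \<noteq> 2" using s(4) by (auto simp: algebra_simps)
    then consider "s0 + s = 1" | n where "s0 + s = - 2 * of_nat n"
      using s(3,5) by (auto simp: double_zeta_sing_def)
    then have "Re (s0 + s) \<le> 1" by cases simp_all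
    then show False using s(2) by simp
  qed
  have "(\<lambda>s. double_zeta (s0, s)) field_differentiable (at s within ?A)" if s: "s \<in> ?A" for s
  proof -
    have "(s0, s) \<in> - double_zeta_sing" using sub s by blast
    then obtain a b where "(double_zeta has_derivative (\<lambda>h. a * fst h + b * snd h)) (at (s0, s) within - double_zeta_sing)"
      using is_double_zeta_double_zeta unfolding is_double_zeta_def holomorphic2_on_def by blast
    then have "(double_zeta has_derivative (\<lambda>h. a * fst h + b * snd h)) (at (s0, s) within (\<lambda>s. (s0, s)) ` ?A)"
      using sub by (rule has_derivative_subset)
    moreover have "((\<lambda>s. (s0, s)) has_derivative (\<lambda>h. (0, h))) (at s within ?A)"
      by (auto intro!: derivative_eq_intros)
    ultimately have "((\<lambda>s. double_zeta (s0, s)) has_derivative (\<lambda>h. a * fst (0::complex, h) + b * snd (0::complex, h))) (at s within ?A)"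
      by (rule has_derivative_in_compose[rotated])
    then show ?thesis
      unfolding field_differentiable_def has_field_derivative_def by (intro exI[of _ b]) simp
  qed
  then show ?thesis unfolding holomorphic_on_def by blast
qed

text \<open>An intersection of half planes stays connected without two points, both sides are
  holomorphic on it, and they agree on the nonempty open part of absolute convergence; the identity
  theorem does the rest.\<close>

lemma double_zeta_truncation:
  assumes "N > 0" "Re s > 1/2" "Re (s0 + s) > 3/2" "s \<noteq> 1" "s0 + s \<noteq> 2"
  shows "double_zeta (s0, s) = dz_main s0 N s + dz_tail s0 N s"
proof -
  let ?B = "{s. Re s > 1/2 \<and> Re (s0 + s) > 3/2}"
  let ?A = "?B - {1, 2 - s0}"
  let ?S = "{s. Re s > 1 \<and> Re (s0 + s) > 2}"
  have op: "open ?B" by (intro open_Collect_conj open_Collect_less continuous_intros)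
  have eqA: "?B = {s. Re s > 1/2} \<inter> {s. Re s > 3/2 - Re s0}" by auto
  have "connected ?B"
    unfolding eqA by (intro convex_connected convex_Int convex_halfspace_Re_gt)
  then have con: "connected ?A"
    by (intro connected_open_delete_finite op) auto
  show ?thesis
  proof (rule analytic_continuation_open[of ?S ?A "\<lambda>s. double_zeta (s0, s)" "\<lambda>s. dz_main s0 N s + dz_tail s0 N s"])
    show "open ?S" by (intro open_Collect_conj open_Collect_less continuous_intros)
    show "open ?A" using op by (intro open_Diff) auto
    have "of_real (2 + \<bar>Re s0\<bar> + 1) \<in> ?S" by simp linarith
    then show "?S \<noteq> {}" by blast
    show "?S \<subseteq> ?A" by (auto simp: algebra_simps)
    show "(\<lambda>s. double_zeta (s0, s)) holomorphic_on ?A" by (rule double_zeta_slice_holomorphic)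
    show "(\<lambda>s. dz_main s0 N s + dz_tail s0 N s) holomorphic_on ?A"
      unfolding dz_main_def[abs_def]
      by (intro holomorphic_intros dz_tail_holomorphic assms) auto
    show "double_zeta (s0, z) = dz_main s0 N z + dz_tail s0 N z" if "z \<in> ?S" for z
      using that is_double_zeta_double_zeta double_zeta_series_eq[of N z s0] assms(1)
      unfolding is_double_zeta_def double_zeta_abs_conv_def by auto
    show "s \<in> ?A" using assms by (auto simp: algebra_simps)
  qed (rule con)
qed

subsection \<open>Bounding the truncation error\<close>

text \<open>After \<open>m div 4\<close> halvings the trivial remainder bound is still too large by
  a factor \<open>m\<close>, which these halvings must pay for. The inequality
  \<open>4 * q + 3 \<le> 2 ^ q\<close> starts at \<open>q = 5\<close>, hence the threshold
  20.\<close>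

lemma le_two_power_div_4: "20 \<le> m \<Longrightarrow> real m \<le> 2 ^ (m div 4)"
proof -
  assume m: "20 \<le> m"
  define q where "q = m div 4"
  have "q \<ge> 5" "m \<le> 4 * q + 3" using m unfolding q_def by auto
  have "4 * q + 3 \<le> 2 ^ q" using \<open>q \<ge> 5\<close>
    by (induction q rule: dec_induct) auto
  then have "m \<le> 2 ^ q" using \<open>m \<le> 4 * q + 3\<close> by linarith
  then show ?thesis unfolding q_def by (metis of_nat_le_iff of_nat_numeral of_nat_power)
qed

text \<open>Each Euler-Maclaurin step gains a factor \<open>\<bar>s + k\<bar> / m \<le> 1/2\<close>; after \<open>m div 4\<close> steps the
  trivial bound for the remainder suffices.\<close>

lemma em_rem_1_oscillation_bound:
  assumes m: "20 \<le> m" and s: "Re s > 0" "norm s \<le> real m / 4"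
  shows "norm (em_rem 1 m s) \<le> 4 * real m powr (- Re s - 1)"
proof -
  define K where "K = m div 4"
  have K: "real K \<le> real m / 4" "K \<ge> 5" using m unfolding K_def by auto
  have poch: "norm (pochhammer (s + 1) i) \<le> (real m / 2) ^ i" if "i \<le> K" for i
  proof -
    have "norm (pochhammer (s + 1) i) = (\<Prod>j<i. norm (s + 1 + of_nat j))"
      by (simp add: pochhammer_prod prod_norm atLeast0LessThan)
    also have "\<dots> \<le> (\<Prod>j<i. real m / 2)"
    proof (rule prod_mono, safe)
      fix j assume j: "j < i"
      have "norm (s + 1 + of_nat j) \<le> norm s + norm (of_nat (Suc j) :: complex)"
        using norm_triangle_ineq[of s "of_nat (Suc j)"] by (simp add: add.assoc)
      also have "\<dots> = norm s + real (Suc j)" by (simp only: norm_of_nat)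
      also have "\<dots> \<le> real m / 2" using s(2) K(1) j that by linarith
      finally show "norm (s + 1 + of_nat j) \<le> real m / 2" .
    qed auto
    finally show ?thesis by simp
  qed
  have pw: "(real m / 2) ^ i * real m powr (- Re s - real (Suc i)) = real m powr (- Re s - 1) * (1/2) ^ i" for i
  proof -
    have "real m powr (- Re s - real (Suc i)) = real m powr (- Re s - 1) / real m ^ i"
      using m by (simp add: powr_realpow[symmetric] powr_diff[symmetric] algebra_simps)
    then show ?thesis using m by (simp add: power_divide)
  qed
  have "norm (\<Sum>i<K. of_real (bernp (i + 2) 0) * pochhammer (s + 1) i * of_nat m powr (- s - of_nat (Suc i)))
      \<le> (\<Sum>i<K. real m powr (- Re s - 1) * (1/2) ^ i)"
  proof (rule sum_norm_le)
    fix i assume "i \<in> {..<K}"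
    then have "norm (of_real (bernp (i + 2) 0) * pochhammer (s + 1) i * of_nat m powr (- s - of_nat (Suc i)))
       \<le> 1 * (real m / 2) ^ i * real m powr (- Re s - real (Suc i))"
      unfolding norm_mult norm_of_nat_powr using poch[of i] bernp_le_1[of 0 "i + 2"]
      by (intro mult_mono) (auto simp del: bernp.simps)
    then show "norm (of_real (bernp (i + 2) 0) * pochhammer (s + 1) i * of_nat m powr (- s - of_nat (Suc i)))
       \<le> real m powr (- Re s - 1) * (1/2) ^ i" unfolding mult_1_left pw .
  qed
  also have "\<dots> = real m powr (- Re s - 1) * (\<Sum>i<K. (1/2) ^ i)" by (simp add: sum_distrib_left)
  also have "\<dots> \<le> real m powr (- Re s - 1) * 2"
    by (intro mult_left_mono powr_ge_zero) (subst geometric_sum; auto simp: field_simps)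
  finally have 1: "norm (\<Sum>i<K. of_real (bernp (i + 2) 0) * pochhammer (s + 1) i * of_nat m powr (- s - of_nat (Suc i)))
      \<le> real m powr (- Re s - 1) * 2" .
  have "norm (pochhammer (s + 1) K * em_rem (Suc K) m s) \<le> (real m / 2) ^ K * (2 * real m powr (- Re s - real K))"
    unfolding norm_mult using poch[of K] em_rem_bound2[of m s K] m s K by (intro mult_mono) auto
  also have "\<dots> = 2 * real m * ((real m / 2) ^ K * real m powr (- Re s - real (Suc K)))"
    using m by (simp add: powr_diff powr_add field_simps)
  also have "\<dots> = 2 * real m powr (- Re s - 1) * (real m * (1/2) ^ K)" unfolding pw by simp
  also have "\<dots> \<le> 2 * real m powr (- Re s - 1) * 1"
    using le_two_power_div_4[OF m] unfolding K_def[symmetric]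
    by (intro mult_left_mono) (auto simp: power_one_over field_simps)
  finally have 2: "norm (pochhammer (s + 1) K * em_rem (Suc K) m s) \<le> 2 * real m powr (- Re s - 1)" by simp
  have "norm (em_rem 1 m s) \<le> norm (\<Sum>i<K. of_real (bernp (i + 2) 0) * pochhammer (s + 1) i * of_nat m powr (- s - of_nat (Suc i)))
     + norm (pochhammer (s + 1) K * em_rem (Suc K) m s)"
    using em_rem_expand[of m s K] m s norm_triangle_ineq4[of "pochhammer (s + 1) K * em_rem (Suc K) m s"
        "\<Sum>i<K. of_real (bernp (i + 2) 0) * pochhammer (s + 1) i * of_nat m powr (- s - of_nat (Suc i))"]
    by (simp del: bernp.simps of_nat_Suc)
  then show ?thesis using 1 2 by linarith
qed

text \<open>At distance at least \<open>N / c\<close> from the pole the term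
  \<open>N powr (1 - s) / (s - 1)\<close> has the size of a single term of the series, and by the
  oscillation bound so has \<open>s * em_rem 1 N s\<close>.\<close>

lemma zeta_tail_bound:
  assumes "20 \<le> N" "Re s > 0" "norm s \<le> real N / 4" "norm (s - 1) \<ge> real N / c" "c > 0"
  shows "norm (zeta_tail N s) \<le> (c + 2) * real N powr (- Re s)"
proof -
  have N: "real N powr (1 - Re s) = real N * real N powr (- Re s)"
    "real N powr (- Re s - 1) = real N powr (- Re s) / real N"
    using assms by (auto simp: powr_diff powr_minus field_simps)
  have sm: "norm (s - 1) > 0" using assms by (smt (verit) divide_pos_pos of_nat_0_less_iff not_numeral_le_zero gr0I)
  have a: "norm (of_nat N powr (1 - s) / (s - 1)) \<le> c * real N powr (- Re s)"
  proof -
    have "norm (of_nat N powr (1 - s) / (s - 1)) = real N * real N powr (- Re s) / norm (s - 1)"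
      by (simp add: norm_divide norm_of_nat_powr N)
    also have "\<dots> \<le> c * real N powr (- Re s)"
    proof -
      have "real N \<le> c * norm (s - 1)" using assms(4,5) by (simp add: field_simps)
      then have "real N * real N powr (- Re s) \<le> c * norm (s - 1) * real N powr (- Re s)" by (intro mult_right_mono) auto
      then show ?thesis using sm by (simp add: field_simps)
    qed
    finally show ?thesis .
  qed
  have b: "norm (of_nat N powr (- s) / 2 :: complex) = real N powr (- Re s) / 2"
    by (simp add: norm_divide norm_of_nat_powr)
  have "norm (s * em_rem 1 N s) \<le> real N / 4 * (4 * real N powr (- Re s - 1))"
    unfolding norm_mult using em_rem_1_oscillation_bound[of N s] assms by (intro mult_mono) auto
  also have "\<dots> = real N powr (- Re s)" unfolding N using assms by simp
  finally have cc: "norm (s * em_rem 1 N s) \<le> real N powr (- Re s)" .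
  have "norm (zeta_tail N s) \<le> norm (of_nat N powr (1 - s) / (s - 1)) + norm (of_nat N powr (- s) / 2 :: complex) + norm (s * em_rem 1 N s)"
    unfolding zeta_tail_def by (meson add_right_mono norm_triangle_ineq4 order_trans)
  also have "\<dots> \<le> c * real N powr (- Re s) + real N powr (- Re s) + real N powr (- Re s)"
    using a b cc by (intro add_mono) auto
  finally show ?thesis by (simp add: algebra_simps)
qed

text \<open>Everything is measured by \<open>X\<close>, the product of the partial sum
  \<open>h\<close> and \<open>N powr - Re s\<close>. All \<open>N\<close> terms of \<open>h\<close>
  are at least \<open>N powr - Re s0\<close>, so \<open>N powr (1 - \<rho>) \<le> X\<close>, and the
  three terms without \<open>psum\<close> are at most of that order. The first two terms contribute
  \<open>c + 2\<close> and \<open>c * (c + 2)\<close>, together \<open>(c + 1) * (c + 2)\<close>;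
  the others contribute 3/2 and 2, rounded up to 4.\<close>

lemma dz_tail_bound:
  assumes N: "20 \<le> N" and s: "Re s > 1/2" "Re (s0 + s) > 3/2" "Re s0 > 0"
    and "norm s \<le> real N / 4" "norm (s0 + s - 1) \<le> real N / 4"
    and "norm (s - 1) \<ge> real N / c" "norm (s0 + s - 2) \<ge> real N / c" and c: "c > 0"
  shows "norm (dz_tail s0 N s) \<le> ((c + 1) * (c + 2) + 4) * ((\<Sum>m=1..N. real m powr (- Re s0)) * real N powr (- Re s))"
proof -
  define h where "h = (\<Sum>m=1..N. real m powr (- Re s0))"
  define \<rho> where "\<rho> = Re (s0 + s)"
  define X where "X = h * real N powr (- Re s)"
  have N0: "real N > 0" using N by simp
  have "real N powr (1 - Re s0) = (\<Sum>m=1..N. real N powr (- Re s0))"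
    using N0 by (simp add: powr_diff powr_minus field_simps)
  also have "\<dots> \<le> h" unfolding h_def using s by (intro sum_mono powr_mono2') auto
  finally have "real N powr (1 - Re s0) * real N powr (- Re s) \<le> X"
    unfolding X_def by (intro mult_right_mono) auto
  then have X: "real N powr (1 - \<rho>) \<le> X"
    unfolding powr_add[symmetric] \<rho>_def by (simp add: algebra_simps)
  have X0: "X \<ge> 0" using X order_trans powr_ge_zero by blast
  have ps: "norm (psum s0 (Suc N)) \<le> h"
    unfolding psum_def h_def atLeastLessThanSuc_atLeastAtMost
    by (rule sum_norm_le) (simp add: norm_of_nat_powr)
  have "norm (psum s0 (Suc N) * zeta_tail N s) \<le> h * ((c + 2) * real N powr (- Re s))"
    unfolding norm_mult using ps zeta_tail_bound[of N s c] assms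
    by (intro mult_mono) (auto intro: order_trans[OF norm_ge_zero])
  then have 1: "norm (psum s0 (Suc N) * zeta_tail N s) \<le> (c + 2) * X" unfolding X_def by (simp add: mult_ac)
  have z1: "norm (zeta_tail N (s0 + s - 1)) \<le> (c + 2) * real N powr (- Re (s0 + s - 1))"
    by (rule zeta_tail_bound) (use assms in auto)
  have "norm (s - 1) \<ge> 1 / c"
    using assms(7) N c by (smt (verit) divide_right_mono numeral_le_iff of_nat_1 of_nat_le_iff of_nat_numeral one_le_numeral order_trans)
  then have i: "1 / norm (s - 1) \<le> c"
    using c by (smt (verit, best) divide_pos_pos le_divide_eq mult.commute zero_less_one divide_le_eq)
  have "norm (zeta_tail N (s0 + s - 1) / (s - 1)) = norm (zeta_tail N (s0 + s - 1)) * (1 / norm (s - 1))"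
    by (simp add: norm_divide)
  also have "\<dots> \<le> ((c + 2) * real N powr (1 - \<rho>)) * c"
    using z1 i c by (intro mult_mono) (auto simp: \<rho>_def)
  also have "\<dots> \<le> ((c + 2) * X) * c"
    using X c by (intro mult_right_mono mult_left_mono) auto
  finally have 2: "norm (zeta_tail N (s0 + s - 1) / (s - 1)) \<le> c * (c + 2) * X" by (simp add: mult_ac)
  have mono: "real (Suc N) powr (1 - \<rho>) \<le> X" "real (Suc N) powr (- \<rho>) \<le> real N powr (- \<rho>)"
    using s N0 by (auto simp: \<rho>_def intro!: powr_mono2' order_trans[OF _ X])
  have "norm (zeta_tail N (s0 + s)) \<le> 3 * X"
  proof -
    have sums: "(\<lambda>n. of_nat (N + Suc n) powr (- (s0 + s))) sums zeta_tail N (s0 + s)"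
      using s N by (intro zeta_tail_sums) auto
    have nm: "norm (of_nat (N + Suc n) powr (- (s0 + s)) :: complex) = real (Suc N + n) powr (- \<rho>)" for n
      unfolding norm_of_nat_powr \<rho>_def by simp
    have sm: "summable (\<lambda>n. real (Suc N + n) powr (- \<rho>))"
      using s by (intro summable_shift_powr) (auto simp: \<rho>_def)
    have "norm (zeta_tail N (s0 + s)) \<le> (\<Sum>n. real (Suc N + n) powr (- \<rho>))"
      using summable_norm[of "\<lambda>n. of_nat (N + Suc n) powr (- (s0 + s)) :: complex"] sm sums_unique[OF sums] unfolding nm by simp
    also have "\<dots> \<le> \<rho> / (\<rho> - 1) * real (Suc N) powr (1 - \<rho>)"
      using s by (intro suminf_shift_powr_le) (auto simp: \<rho>_def)
    also have "\<dots> \<le> 3 * X"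
      using s mono by (intro mult_mono) (auto simp: \<rho>_def field_simps)
    finally show ?thesis .
  qed
  then have 3: "norm (zeta_tail N (s0 + s) / 2) \<le> 3 / 2 * X" by (simp add: norm_divide)
  have "norm (\<Sum>m. of_nat (N + Suc m) powr (- s0) * em_rem 1 (N + Suc m) s) \<le> (\<Sum>m. 4 * real (Suc N + m) powr (- (\<rho> + 1)))"
  proof (rule norm_suminf_le)
    show "summable (\<lambda>m. 4 * real (Suc N + m) powr (- (\<rho> + 1)))"
      using s by (intro summable_mult summable_shift_powr) (auto simp: \<rho>_def)
    fix m
    have "norm (of_nat (N + Suc m) powr (- s0) * em_rem 1 (N + Suc m) s)
       \<le> real (N + Suc m) powr (- Re s0) * (4 * real (N + Suc m) powr (- Re s - 1))"
      unfolding norm_mult norm_of_nat_powr using assms em_rem_1_oscillation_bound[of "N + Suc m" s]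
      by (intro mult_mono) auto
    also have "\<dots> = 4 * real (Suc N + m) powr (- Re s0 + (- Re s - 1))"
      unfolding powr_add by simp
    also have "- Re s0 + (- Re s - 1) = - (\<rho> + 1)" by (simp add: \<rho>_def)
    finally show "norm (of_nat (N + Suc m) powr (- s0) * em_rem 1 (N + Suc m) s) \<le> 4 * real (Suc N + m) powr (- (\<rho> + 1))" .
  qed
  also have "\<dots> = 4 * (\<Sum>m. real (Suc N + m) powr (- (\<rho> + 1)))"
    using s by (intro suminf_mult summable_shift_powr) (auto simp: \<rho>_def)
  also have "(\<Sum>m. real (Suc N + m) powr (- (\<rho> + 1))) \<le> (\<rho> + 1) / (\<rho> + 1 - 1) * real (Suc N) powr (1 - (\<rho> + 1))"
    using s by (intro suminf_shift_powr_le) (auto simp: \<rho>_def)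
  also have "\<dots> \<le> 2 * real N powr (- \<rho>)"
    using s mono by (intro mult_mono) (auto simp: \<rho>_def field_simps)
  finally have "norm (\<Sum>m. of_nat (N + Suc m) powr (- s0) * em_rem 1 (N + Suc m) s) \<le> 8 * real N powr (- \<rho>)" by simp
  then have "norm (s * (\<Sum>m. of_nat (N + Suc m) powr (- s0) * em_rem 1 (N + Suc m) s)) \<le> real N / 4 * (8 * real N powr (- \<rho>))"
    unfolding norm_mult using assms by (intro mult_mono) auto
  also have "\<dots> = 2 * real N powr (1 - \<rho>)" using N0 by (simp add: powr_diff powr_minus field_simps)
  finally have 4: "norm (s * (\<Sum>m. of_nat (N + Suc m) powr (- s0) * em_rem 1 (N + Suc m) s)) \<le> 2 * X" using X by linarith
  have "norm (dz_tail s0 N s) \<le> norm (psum s0 (Suc N) * zeta_tail N s) + norm (zeta_tail N (s0 + s - 1) / (s - 1))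
     + norm (zeta_tail N (s0 + s) / 2) + norm (s * (\<Sum>m. of_nat (N + Suc m) powr (- s0) * em_rem 1 (N + Suc m) s))"
    unfolding dz_tail_def by (meson add_right_mono norm_triangle_ineq norm_triangle_ineq4 order_trans)
  also have "\<dots> \<le> (c + 2) * X + c * (c + 2) * X + 3 / 2 * X + 2 * X"
    using 1 2 3 4 by linarith
  also have "\<dots> \<le> ((c + 1) * (c + 2) + 4) * X" using X0 by (simp add: algebra_simps)
  finally show ?thesis unfolding X_def h_def .
qed

subsection \<open>Elementary sums\<close>

lemma sum_powr_minus_1_le:
  assumes "N \<ge> 1"
  shows "(\<Sum>k=1..N. real k powr (-1)) \<le> 1 + ln (real N)"
  using assms
proof (induction N rule: dec_induct)
  case base
  then show ?case by simp
next
  case (step n)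
  have "ln (real n / real (Suc n)) \<le> real n / real (Suc n) - 1"
    using step by (intro ln_le_minus_one) auto
  then have "real (Suc n) powr (-1) \<le> ln (real (Suc n)) - ln (real n)"
    using step by (simp add: ln_div powr_minus field_simps)
  then show ?case using step by simp
qed

lemma one_plus_ln_power_le:
  fixes \<epsilon> :: real
  assumes "\<epsilon> > 0"
  shows "\<exists>C>0. \<forall>x\<ge>1. (1 + ln x) ^ l \<le> C * x powr \<epsilon>"
proof -
  define d where "d = \<epsilon> / real (l + 1)"
  have d: "d > 0" "d * real l \<le> \<epsilon>" using assms by (auto simp: d_def field_simps)
  have "(1 + ln x) ^ l \<le> (1 + 1 / d) ^ l * x powr \<epsilon>" if "x \<ge> 1" for x :: real
  proof -
    have "ln x \<le> x powr d / d" using ln_powr_bound[OF that d(1)] .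
    moreover have "1 \<le> x powr d" using that d by (simp add: ge_one_powr_ge_zero)
    ultimately have "1 + ln x \<le> (1 + 1 / d) * x powr d" by (simp add: algebra_simps)
    then have "(1 + ln x) ^ l \<le> ((1 + 1 / d) * x powr d) ^ l"
      using that by (intro power_mono) (auto simp: ln_ge_zero)
    also have "\<dots> = (1 + 1 / d) ^ l * x powr (d * real l)"
      using that by (simp add: power_mult_distrib powr_powr[symmetric] powr_realpow)
    also have "\<dots> \<le> (1 + 1 / d) ^ l * x powr \<epsilon>"
      using that d by (intro mult_left_mono powr_mono) auto
    finally show ?thesis .
  qed
  moreover have "(1 + 1 / d) ^ l > 0" using d by (intro zero_less_power) (auto intro: add_pos_pos)
  ultimately show ?thesis by blast
qed

lemma sum_powr_bound:
  fixes a :: real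
  assumes "a > 0"
  shows "\<exists>C>0. \<forall>N\<ge>1. (\<Sum>m=1..N. real m powr (- a))
           \<le> C * (real N powr (max 0 (1 - a)) * (1 + ln (real N)) ^ (if a = 1 then 1 else 0))"
proof -
  consider "a < 1" | "a = 1" | "a > 1" by linarith
  then show ?thesis
  proof cases
    case 1
    then show ?thesis using sum_powr_neg_le[of a] assms
      by (intro exI[of _ "1 / (1 - a)"]) auto
  next
    case 2
    then show ?thesis using sum_powr_minus_1_le by (intro exI[of _ 1]) auto
  next
    case 3
    have "(\<Sum>m=1..N. real m powr (- a)) \<le> a / (a - 1)" for N
    proof -
      have "(\<Sum>m=1..N. real m powr (- a)) = (\<Sum>n<N. real (1 + n) powr (- a))"
        by (rule sum.reindex_bij_witness[of _ Suc "\<lambda>m. m - 1"]) auto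
      also have "\<dots> \<le> (\<Sum>n. real (1 + n) powr (- a))"
        using 3 by (intro sum_le_suminf summable_shift_powr) auto
      also have "\<dots> \<le> a / (a - 1)" using suminf_shift_powr_le[of a 1] 3 by simp
      finally show ?thesis .
    qed
    then show ?thesis using 3 by (intro exI[of _ "a / (a - 1)"]) auto
  qed
qed

lemma sum_inverse_dist_le:
  assumes "k \<in> {1..N}"
  shows "(\<Sum>j\<in>{1..N} - {k}. 1 / \<bar>real k - real j\<bar>) \<le> 2 * (\<Sum>r=1..N. real r powr (-1))"
proof -
  have inv: "real r powr (-1) = 1 / real r" for r :: nat by (simp add: powr_minus divide_inverse)
  have "{1..N} - {k} = {1..<k} \<union> {k<..N}" using assms by auto
  then have "(\<Sum>j\<in>{1..N} - {k}. 1 / \<bar>real k - real j\<bar>) =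
    (\<Sum>j\<in>{1..<k}. 1 / \<bar>real k - real j\<bar>) + (\<Sum>j\<in>{k<..N}. 1 / \<bar>real k - real j\<bar>)"
    by (simp add: sum.union_disjoint Int_def)
  also have "(\<Sum>j\<in>{1..<k}. 1 / \<bar>real k - real j\<bar>) = (\<Sum>r\<in>{1..<k}. real r powr (-1))"
    by (rule sum.reindex_bij_witness[of _ "\<lambda>r. k - r" "\<lambda>r. k - r"]) (auto simp: inv of_nat_diff)
  also have "\<dots> \<le> (\<Sum>r=1..N. real r powr (-1))"
    using assms by (intro sum_mono2) auto
  also have "(\<Sum>j\<in>{k<..N}. 1 / \<bar>real k - real j\<bar>) = (\<Sum>r\<in>{1..N - k}. real r powr (-1))"
    by (rule sum.reindex_bij_witness[of _ "\<lambda>r. k + r" "\<lambda>r. r - k"]) (auto simp: inv of_nat_diff)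
  also have "\<dots> \<le> (\<Sum>r=1..N. real r powr (-1))"
    using assms by (intro sum_mono2) auto
  finally show ?thesis by simp
qed

text \<open>The bound \<open>k / (k - j)\<close> is split because its parts are summed differently:
  the 1 leads to the square of a power sum, the fraction to a harmonic sum over the distance
  \<open>k - j\<close>.\<close>

lemma inverse_ln_diff_le:
  assumes "0 < j" "j < (k::nat)"
  shows "1 / (ln (real k) - ln (real j)) \<le> 1 + real j / (real k - real j)"
proof -
  have "ln (real j / real k) \<le> real j / real k - 1"
    using assms by (intro ln_le_minus_one) auto
  then have "(real k - real j) / real k \<le> ln (real k) - ln (real j)"
    using assms by (simp add: ln_div field_simps)
  then have "1 / (ln (real k) - ln (real j)) \<le> 1 / ((real k - real j) / real k)"
    using assms by (intro divide_left_mono mult_pos_pos) auto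
  also have "\<dots> = 1 + real j / (real k - real j)" using assms by (simp add: field_simps)
  finally show ?thesis .
qed

text \<open>For \<open>j < k\<close> the hypothesis \<open>\<sigma> \<le> 1\<close> gives
  \<open>j powr (1 - \<sigma>) \<le> k powr (1 - \<sigma>)\<close>, so the weight becomes a power of
  the larger index alone. Adding the same power of the smaller index makes the bound symmetric, and
  the double sum needs no ordering.\<close>

lemma off_diagonal_term_le:
  fixes \<sigma> :: real
  assumes "0 < j" "0 < k" "j \<noteq> (k::nat)" "\<sigma> \<le> 1"
  shows "real j powr (-\<sigma>) * real k powr (-\<sigma>) / \<bar>ln (real k) - ln (real j)\<bar>
     \<le> real j powr (-\<sigma>) * real k powr (-\<sigma>) + (real j powr (1 - 2 * \<sigma>) + real k powr (1 - 2 * \<sigma>)) / \<bar>real k - real j\<bar>"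
proof -
  have *: "real j powr (-\<sigma>) * real k powr (-\<sigma>) / \<bar>ln (real k) - ln (real j)\<bar>
     \<le> real j powr (-\<sigma>) * real k powr (-\<sigma>) + real k powr (1 - 2 * \<sigma>) / \<bar>real k - real j\<bar>"
    if jk: "0 < j" "j < k" for j k :: nat
  proof -
    let ?x = "real j powr (-\<sigma>) * real k powr (-\<sigma>)"
    have "?x * (1 / (ln (real k) - ln (real j))) \<le> ?x * (1 + real j / (real k - real j))"
      using inverse_ln_diff_le[OF jk] by (intro mult_left_mono) auto
    also have "\<dots> = ?x + (real j powr (1 - \<sigma>) * real k powr (-\<sigma>)) / (real k - real j)"
      using jk by (simp add: powr_diff powr_minus field_simps)
    also have "\<dots> \<le> ?x + (real k powr (1 - \<sigma>) * real k powr (-\<sigma>)) / (real k - real j)"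
      using jk assms by (intro add_left_mono divide_right_mono mult_right_mono powr_mono2) auto
    also have "real k powr (1 - \<sigma>) * real k powr (-\<sigma>) = real k powr (1 - 2 * \<sigma>)"
      by (simp flip: powr_add)
    finally show ?thesis using jk by simp
  qed
  show ?thesis
  proof (cases "j < k")
    case True
    have "real k powr (1 - 2 * \<sigma>) / \<bar>real k - real j\<bar> \<le> (real j powr (1 - 2 * \<sigma>) + real k powr (1 - 2 * \<sigma>)) / \<bar>real k - real j\<bar>"
      by (intro divide_right_mono) auto
    then show ?thesis using *[OF assms(1) True] by linarith
  next
    case False
    then have "k < j" using assms by simp
    from *[OF assms(2) this] have "real j powr (-\<sigma>) * real k powr (-\<sigma>) / \<bar>ln (real k) - ln (real j)\<bar>
      \<le> real j powr (-\<sigma>) * real k powr (-\<sigma>) + real j powr (1 - 2 * \<sigma>) / \<bar>real k - real j\<bar>"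
      by (simp add: abs_minus_commute mult.commute)
    moreover have "real j powr (1 - 2 * \<sigma>) / \<bar>real k - real j\<bar> \<le> (real j powr (1 - 2 * \<sigma>) + real k powr (1 - 2 * \<sigma>)) / \<bar>real k - real j\<bar>"
      by (intro divide_right_mono) auto
    ultimately show ?thesis by linarith
  qed
qed

text \<open>With the weighted index fixed, the other one runs over distances on both sides and
  contributes at most twice a harmonic sum. The two symmetric weights give another factor 2, hence
  the 4.\<close>

lemma off_diagonal_sum_le:
  fixes \<sigma> :: real
  assumes "\<sigma> \<le> 1"
  shows "(\<Sum>j=1..N. \<Sum>k\<in>{1..N} - {j}. real j powr (-\<sigma>) * real k powr (-\<sigma>) / \<bar>ln (real k) - ln (real j)\<bar>)
    \<le> (\<Sum>k=1..N. real k powr (-\<sigma>))\<^sup>2 + 4 * (\<Sum>k=1..N. real k powr (1 - 2 * \<sigma>)) * (\<Sum>k=1..N. real k powr (-1))"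
proof -
  define P where "P = (\<Sum>k=1..N. real k powr (-\<sigma>))"
  define Q where "Q = (\<Sum>k=1..N. real k powr (1 - 2 * \<sigma>))"
  define L where "L = (\<Sum>k=1..N. real k powr (-1))"
  have "(\<Sum>j=1..N. \<Sum>k\<in>{1..N} - {j}. real j powr (-\<sigma>) * real k powr (-\<sigma>) / \<bar>ln (real k) - ln (real j)\<bar>)
    \<le> (\<Sum>j=1..N. \<Sum>k\<in>{1..N} - {j}. real j powr (-\<sigma>) * real k powr (-\<sigma>)
        + (real j powr (1 - 2 * \<sigma>) + real k powr (1 - 2 * \<sigma>)) / \<bar>real k - real j\<bar>)"
    using assms by (intro sum_mono off_diagonal_term_le) auto
  also have "\<dots> = (\<Sum>j=1..N. \<Sum>k\<in>{1..N} - {j}. real j powr (-\<sigma>) * real k powr (-\<sigma>))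
     + ((\<Sum>j=1..N. \<Sum>k\<in>{1..N} - {j}. real j powr (1 - 2 * \<sigma>) / \<bar>real k - real j\<bar>)
     + (\<Sum>j=1..N. \<Sum>k\<in>{1..N} - {j}. real k powr (1 - 2 * \<sigma>) / \<bar>real k - real j\<bar>))"
    by (simp add: sum.distrib add_divide_distrib)
  also have "(\<Sum>j=1..N. \<Sum>k\<in>{1..N} - {j}. real k powr (1 - 2 * \<sigma>) / \<bar>real k - real j\<bar>)
     = (\<Sum>k=1..N. \<Sum>j\<in>{1..N} - {k}. real k powr (1 - 2 * \<sigma>) / \<bar>real k - real j\<bar>)"
  proof -
    have "(\<Sum>j=1..N. \<Sum>k | k \<in> {1..N} \<and> j \<noteq> k. real k powr (1 - 2 * \<sigma>) / \<bar>real k - real j\<bar>)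
      = (\<Sum>k=1..N. \<Sum>j | j \<in> {1..N} \<and> j \<noteq> k. real k powr (1 - 2 * \<sigma>) / \<bar>real k - real j\<bar>)"
      by (rule sum.swap_restrict) auto
    moreover have "{k \<in> {1..N}. j \<noteq> k} = {1..N} - {j}" "{k \<in> {1..N}. k \<noteq> j} = {1..N} - {j}" for j by auto
    ultimately show ?thesis by simp
  qed
  also have "(\<Sum>j=1..N. \<Sum>k\<in>{1..N} - {j}. real j powr (1 - 2 * \<sigma>) / \<bar>real k - real j\<bar>) \<le> 2 * Q * L"
  proof -
    have "(\<Sum>k\<in>{1..N} - {j}. real j powr (1 - 2 * \<sigma>) / \<bar>real k - real j\<bar>) \<le> real j powr (1 - 2 * \<sigma>) * (2 * L)" if "j \<in> {1..N}" for j
    proof -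
      have "(\<Sum>k\<in>{1..N} - {j}. real j powr (1 - 2 * \<sigma>) / \<bar>real k - real j\<bar>) = real j powr (1 - 2 * \<sigma>) * (\<Sum>k\<in>{1..N} - {j}. 1 / \<bar>real j - real k\<bar>)"
        by (simp add: sum_distrib_left abs_minus_commute)
      also have "\<dots> \<le> real j powr (1 - 2 * \<sigma>) * (2 * L)"
        unfolding L_def by (intro mult_left_mono sum_inverse_dist_le that) auto
      finally show ?thesis .
    qed
    then have "(\<Sum>j=1..N. \<Sum>k\<in>{1..N} - {j}. real j powr (1 - 2 * \<sigma>) / \<bar>real k - real j\<bar>) \<le> (\<Sum>j=1..N. real j powr (1 - 2 * \<sigma>) * (2 * L))"
      by (rule sum_mono)
    then show ?thesis by (simp add: Q_def sum_distrib_right sum_distrib_left mult_ac)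
  qed
  also have "(\<Sum>k=1..N. \<Sum>j\<in>{1..N} - {k}. real k powr (1 - 2 * \<sigma>) / \<bar>real k - real j\<bar>) \<le> 2 * Q * L"
  proof -
    have "(\<Sum>j\<in>{1..N} - {k}. real k powr (1 - 2 * \<sigma>) / \<bar>real k - real j\<bar>) \<le> real k powr (1 - 2 * \<sigma>) * (2 * L)" if "k \<in> {1..N}" for k
    proof -
      have "(\<Sum>j\<in>{1..N} - {k}. real k powr (1 - 2 * \<sigma>) / \<bar>real k - real j\<bar>) = real k powr (1 - 2 * \<sigma>) * (\<Sum>j\<in>{1..N} - {k}. 1 / \<bar>real k - real j\<bar>)"
        by (simp add: sum_distrib_left)
      also have "\<dots> \<le> real k powr (1 - 2 * \<sigma>) * (2 * L)"
        unfolding L_def by (intro mult_left_mono sum_inverse_dist_le that) auto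
      finally show ?thesis .
    qed
    then have "(\<Sum>k=1..N. \<Sum>j\<in>{1..N} - {k}. real k powr (1 - 2 * \<sigma>) / \<bar>real k - real j\<bar>) \<le> (\<Sum>k=1..N. real k powr (1 - 2 * \<sigma>) * (2 * L))"
      by (rule sum_mono)
    then show ?thesis by (simp add: Q_def sum_distrib_right sum_distrib_left mult_ac)
  qed
  also have "(\<Sum>j=1..N. \<Sum>k\<in>{1..N} - {j}. real j powr (-\<sigma>) * real k powr (-\<sigma>)) \<le> (\<Sum>j=1..N. \<Sum>k=1..N. real j powr (-\<sigma>) * real k powr (-\<sigma>))"
    by (intro sum_mono sum_mono2) auto
  also have "\<dots> = P\<^sup>2" by (simp add: P_def power2_eq_square sum_product)
  finally have "(\<Sum>j=1..N. \<Sum>k\<in>{1..N} - {j}. real j powr (-\<sigma>) * real k powr (-\<sigma>) / \<bar>ln (real k) - ln (real j)\<bar>)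
      \<le> P\<^sup>2 + (2 * Q * L + 2 * Q * L)" by simp
  also have "\<dots> = P\<^sup>2 + 4 * Q * L" by simp
  finally show ?thesis unfolding P_def Q_def L_def .
qed

text \<open>For \<open>\<sigma> < 1\<close> only the harmonic factor is logarithmic; at
  \<open>\<sigma> = 1\<close> all three sums are harmonic, which produces the second
  logarithm.\<close>

lemma off_diagonal_size:
  fixes \<sigma> :: real
  assumes "1/2 < \<sigma>" "\<sigma> \<le> 1"
  shows "\<exists>C>0. \<forall>N\<ge>1. (\<Sum>k=1..N. real k powr (-\<sigma>))\<^sup>2 + 4 * (\<Sum>k=1..N. real k powr (1 - 2 * \<sigma>)) * (\<Sum>k=1..N. real k powr (-1))
     \<le> C * (real N powr (2 - 2 * \<sigma>) * (1 + ln (real N)) ^ (if \<sigma> < 1 then 1 else 2))"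
proof (cases "\<sigma> < 1")
  case True
  have "(\<Sum>k=1..N. real k powr (-\<sigma>))\<^sup>2 + 4 * (\<Sum>k=1..N. real k powr (1 - 2 * \<sigma>)) * (\<Sum>k=1..N. real k powr (-1))
     \<le> (1 / (1 - \<sigma>)\<^sup>2 + 4 / (2 - 2 * \<sigma>)) * (real N powr (2 - 2 * \<sigma>) * (1 + ln (real N)))" if "N \<ge> 1" for N
  proof -
    have ln0: "ln (real N) \<ge> 0" using that by (intro ln_ge_zero) auto
    have "(\<Sum>k=1..N. real k powr (-\<sigma>))\<^sup>2 \<le> (real N powr (1 - \<sigma>) / (1 - \<sigma>))\<^sup>2"
      using sum_powr_neg_le[of \<sigma> N] assms True by (intro power_mono sum_nonneg) auto
    also have "\<dots> = 1 / (1 - \<sigma>)\<^sup>2 * real N powr (2 - 2 * \<sigma>)"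
      using that by (simp add: power_divide power2_eq_square flip: powr_add)
    also have "\<dots> * 1 \<le> 1 / (1 - \<sigma>)\<^sup>2 * real N powr (2 - 2 * \<sigma>) * (1 + ln (real N))"
      using ln0 by (intro mult_left_mono) auto
    finally have 1: "(\<Sum>k=1..N. real k powr (-\<sigma>))\<^sup>2 \<le> 1 / (1 - \<sigma>)\<^sup>2 * real N powr (2 - 2 * \<sigma>) * (1 + ln (real N))" by simp
    have "(\<Sum>k=1..N. real k powr (1 - 2 * \<sigma>)) \<le> real N powr (2 - 2 * \<sigma>) / (2 - 2 * \<sigma>)"
      using sum_powr_neg_le[of "2 * \<sigma> - 1" N] assms True by simp
    then have "4 * (\<Sum>k=1..N. real k powr (1 - 2 * \<sigma>)) * (\<Sum>k=1..N. real k powr (-1))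
        \<le> 4 * (real N powr (2 - 2 * \<sigma>) / (2 - 2 * \<sigma>)) * (1 + ln (real N))"
      using sum_powr_minus_1_le[OF that] True by (intro mult_mono sum_nonneg mult_left_mono) auto
    from add_mono[OF 1 this] show ?thesis by (simp only: ring_distribs) simp
  qed
  moreover have "1 / (1 - \<sigma>)\<^sup>2 + 4 / (2 - 2 * \<sigma>) > 0" using True by (intro add_pos_pos) auto
  ultimately show ?thesis using True by auto
next
  case False
  then have s: "\<sigma> = 1" using assms by simp
  have "(\<Sum>k=1..N. real k powr (-\<sigma>))\<^sup>2 + 4 * (\<Sum>k=1..N. real k powr (1 - 2 * \<sigma>)) * (\<Sum>k=1..N. real k powr (-1))
     \<le> 5 * (real N powr (2 - 2 * \<sigma>) * (1 + ln (real N)) ^ 2)" if "N \<ge> 1" for N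
  proof -
    define L where "L = (\<Sum>k=1..N. real k powr (-1))"
    have "L\<^sup>2 \<le> (1 + ln (real N))\<^sup>2"
      using sum_powr_minus_1_le[OF that] unfolding L_def by (intro power_mono sum_nonneg) auto
    then have "L\<^sup>2 + 4 * L * L \<le> 5 * (real N powr 0 * (1 + ln (real N))\<^sup>2)"
      using that by (simp add: power2_eq_square)
    moreover have "1 - 2 * 1 = (-1::real)" "2 - 2 * 1 = (0::real)" by simp_all
    ultimately show ?thesis unfolding s L_def by (simp only:)
  qed
  then show ?thesis using False by (intro exI[of _ 5]) auto
qed

subsection \<open>Mean values of Dirichlet polynomials\<close>

lemma integral_cis:
  assumes "c \<noteq> 0" "A \<le> B"
  shows "((\<lambda>t. cis (c * t)) has_integral (cis (c * B) - cis (c * A)) / (\<i> * of_real c)) {A..B}"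
proof -
  have "((\<lambda>t. cis (c * t)) has_integral (cis (c * B) / (\<i> * of_real c) - cis (c * A) / (\<i> * of_real c))) {A..B}"
  proof (rule fundamental_theorem_of_calculus)
    fix t assume "t \<in> {A..B}"
    have "((\<lambda>z. exp (\<i> * of_real c * z) / (\<i> * of_real c)) has_field_derivative exp (\<i> * of_real c * of_real t)) (at (of_real t))"
      using assms by (auto intro!: derivative_eq_intros)
    from has_vector_derivative_real_field[OF this]
    show "((\<lambda>t. cis (c * t) / (\<i> * of_real c)) has_vector_derivative cis (c * t)) (at t within {A..B})"
      by (simp add: cis_conv_exp mult_ac)
  qed (rule assms)
  then show ?thesis by (simp add: diff_divide_distrib)
qed

text \<open>Each off-diagonal pair is an oscillating exponential with frequency
  \<open>ln k - ln j\<close>, whose integral is at most 2 over the absolute frequency on any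
  interval. Cancellation between different pairs is not exploited.\<close>

lemma dirichlet_polynomial_mean_value:
  fixes a :: "nat \<Rightarrow> complex"
  assumes "A \<le> B"
  shows "\<bar>integral {A..B} (\<lambda>t. (cmod (\<Sum>k=1..N. a k * cis (- (t * ln (real k)))))\<^sup>2) - (B - A) * (\<Sum>k=1..N. (cmod (a k))\<^sup>2)\<bar>
     \<le> 2 * (\<Sum>j=1..N. \<Sum>k\<in>{1..N} - {j}. cmod (a j) * cmod (a k) / \<bar>ln (real k) - ln (real j)\<bar>)"
proof -
  define D where "D = (\<lambda>t. \<Sum>k=1..N. a k * cis (- (t * ln (real k))))"
  define c where "c = (\<lambda>j k. ln (real k) - ln (real j))"
  define I where "I = (\<lambda>j k. a j * cnj (a k) * (if j = k then of_real (B - A) else (cis (c j k * B) - cis (c j k * A)) / (\<i> * of_real (c j k))))"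
  have int: "((\<lambda>t. a j * cnj (a k) * cis (c j k * t)) has_integral I j k) {A..B}" if "j \<in> {1..N}" "k \<in> {1..N}" for j k
  proof (cases "j = k")
    case True
    have "((\<lambda>t. 1 :: complex) has_integral of_real (B - A)) {A..B}"
      using has_integral_const_real[of "1::complex" A B] assms by (simp add: scaleR_conv_of_real)
    then have "((\<lambda>t. a j * cnj (a k) * 1) has_integral I j k) {A..B}"
      unfolding I_def using True by (simp add: has_integral_mult_right del: mult_1_right)
    then show ?thesis using True by (simp add: c_def)
  next
    case False
    then have "c j k \<noteq> 0" using that by (auto simp: c_def)
    from has_integral_mult_right[OF integral_cis[OF this assms], of "a j * cnj (a k)"] show ?thesis
      unfolding I_def using False by simp
  qed
  have D2: "of_real ((cmod (D t))\<^sup>2) = (\<Sum>j=1..N. \<Sum>k=1..N. a j * cnj (a k) * cis (c j k * t))" for t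
  proof -
    have "of_real ((cmod (D t))\<^sup>2) = D t * cnj (D t)" by (simp add: complex_norm_square[symmetric])
    also have "\<dots> = (\<Sum>j=1..N. \<Sum>k=1..N. (a j * cis (- (t * ln (real j)))) * cnj (a k * cis (- (t * ln (real k)))))"
      unfolding D_def cnj_sum sum_product ..
    also have "\<dots> = (\<Sum>j=1..N. \<Sum>k=1..N. a j * cnj (a k) * cis (c j k * t))"
    proof (intro sum.cong refl)
      fix j k
      have "cis (- (t * ln (real j))) * cis (t * ln (real k)) = cis (c j k * t)"
        unfolding cis_mult c_def by (simp add: algebra_simps)
      then show "(a j * cis (- (t * ln (real j)))) * cnj (a k * cis (- (t * ln (real k)))) = a j * cnj (a k) * cis (c j k * t)"
        by (simp add: cis_cnj mult_ac)
    qed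
    finally show ?thesis .
  qed
  have "continuous_on {A..B} (\<lambda>t. (cmod (D t))\<^sup>2)"
    unfolding D_def by (intro continuous_intros)
  then have "((\<lambda>t. (cmod (D t))\<^sup>2) has_integral integral {A..B} (\<lambda>t. (cmod (D t))\<^sup>2)) {A..B}"
    by (intro integrable_integral integrable_continuous_interval)
  then have "((\<lambda>t. complex_of_real ((cmod (D t))\<^sup>2)) has_integral of_real (integral {A..B} (\<lambda>t. (cmod (D t))\<^sup>2))) {A..B}"
    by (rule has_integral_of_real)
  moreover have "((\<lambda>t. complex_of_real ((cmod (D t))\<^sup>2)) has_integral (\<Sum>j=1..N. \<Sum>k=1..N. I j k)) {A..B}"
    unfolding D2 by (intro has_integral_sum int) auto
  ultimately have "complex_of_real (integral {A..B} (\<lambda>t. (cmod (D t))\<^sup>2)) = (\<Sum>j=1..N. \<Sum>k=1..N. I j k)"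
    using has_integral_unique by blast
  also have "\<dots> = (\<Sum>j=1..N. I j j + (\<Sum>k\<in>{1..N} - {j}. I j k))"
    by (intro sum.cong refl sum.remove) auto
  also have "\<dots> = of_real ((B - A) * (\<Sum>k=1..N. (cmod (a k))\<^sup>2)) + (\<Sum>j=1..N. \<Sum>k\<in>{1..N} - {j}. I j k)"
    by (simp add: sum.distrib I_def sum_distrib_left mult.commute complex_norm_square[symmetric])
  finally have "complex_of_real (integral {A..B} (\<lambda>t. (cmod (D t))\<^sup>2) - (B - A) * (\<Sum>k=1..N. (cmod (a k))\<^sup>2)) = (\<Sum>j=1..N. \<Sum>k\<in>{1..N} - {j}. I j k)"
    by simp
  from arg_cong[OF this, of norm]
  have "\<bar>integral {A..B} (\<lambda>t. (cmod (D t))\<^sup>2) - (B - A) * (\<Sum>k=1..N. (cmod (a k))\<^sup>2)\<bar> = norm (\<Sum>j=1..N. \<Sum>k\<in>{1..N} - {j}. I j k)"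
    by (simp only: norm_of_real)
  also have "\<dots> \<le> (\<Sum>j=1..N. \<Sum>k\<in>{1..N} - {j}. 2 * (cmod (a j) * cmod (a k) / \<bar>ln (real k) - ln (real j)\<bar>))"
  proof (intro sum_norm_le)
    fix j k assume "j \<in> {1..N}" "k \<in> {1..N} - {j}"
    then have "norm (I j k) = cmod (a j) * cmod (a k) * (norm (cis (c j k * B) - cis (c j k * A)) / \<bar>c j k\<bar>)"
      by (auto simp: I_def norm_mult norm_divide)
    also have "\<dots> \<le> cmod (a j) * cmod (a k) * (2 / \<bar>c j k\<bar>)"
      using norm_triangle_ineq4[of "cis (c j k * B)" "cis (c j k * A)"]
      by (intro mult_left_mono divide_right_mono) auto
    finally show "norm (I j k) \<le> 2 * (cmod (a j) * cmod (a k) / \<bar>ln (real k) - ln (real j)\<bar>)"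
      by (simp add: c_def mult_ac)
  qed
  finally show ?thesis unfolding D_def by (simp add: sum_distrib_left)
qed

subsection \<open>The mean square\<close>

text \<open>The cross term obeys \<open>2 * X * Y \<le> u * X\<^sup>2 + Y\<^sup>2 / u\<close>. The
  free weight \<open>u\<close> makes this pointwise bound do the work of the Cauchy-Schwarz
  inequality for the integrals.\<close>

lemma cmod_add_square_perturb:
  fixes x y :: complex
  assumes "u > 0"
  shows "\<bar>(cmod (x + y))\<^sup>2 - (cmod x)\<^sup>2\<bar> \<le> u * (cmod x)\<^sup>2 + (1 / u + 1) * (cmod y)\<^sup>2"
proof -
  define X where "X = cmod x"
  define Y where "Y = cmod y"
  have "2 * X * Y \<le> u * X\<^sup>2 + Y\<^sup>2 / u"
  proof -
    have "0 \<le> (u * X - Y)\<^sup>2 / u" using assms by simp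
    also have "\<dots> = u * X\<^sup>2 + Y\<^sup>2 / u - 2 * X * Y" using assms by (simp add: power2_eq_square field_simps)
    finally show ?thesis by simp
  qed
  moreover have "(cmod (x + y))\<^sup>2 \<le> (X + Y)\<^sup>2"
    unfolding X_def Y_def by (intro power_mono norm_triangle_ineq) auto
  moreover have "(cmod (x + y))\<^sup>2 \<ge> X\<^sup>2 - 2 * X * Y"
  proof (cases "X \<ge> Y")
    case True
    have "X - Y \<le> cmod (x + y)" unfolding X_def Y_def using norm_diff_ineq[of x y] by simp
    then have "(X - Y)\<^sup>2 \<le> (cmod (x + y))\<^sup>2" using True by (intro power_mono) auto
    moreover have "X\<^sup>2 - 2 * X * Y \<le> (X - Y)\<^sup>2" by (simp add: power2_eq_square algebra_simps)
    ultimately show ?thesis by linarith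
  next
    case False
    then have "X * X \<le> X * Y" "0 \<le> X * Y" unfolding X_def Y_def by (auto intro: mult_left_mono)
    then have "X\<^sup>2 - 2 * X * Y \<le> 0" by (simp add: power2_eq_square)
    then show ?thesis by (smt (verit) zero_le_power2)
  qed
  moreover have "(X + Y)\<^sup>2 = X\<^sup>2 + 2 * X * Y + Y\<^sup>2" by (simp add: power2_sum)
  moreover have "(1 / u + 1) * Y\<^sup>2 = Y\<^sup>2 / u + Y\<^sup>2" by (simp add: algebra_simps)
  moreover have "Y\<^sup>2 \<ge> 0" by simp
  ultimately show ?thesis
    unfolding X_def[symmetric] Y_def[symmetric] by linarith
qed

locale mean_square =
  fixes s0 :: complex and \<sigma> :: real
  assumes s0: "1/2 < Re s0" and \<sigma>: "1/2 < \<sigma>" "\<sigma> \<le> 1" and s0_\<sigma>: "3/2 < Re s0 + \<sigma>"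
    and regular: "\<And>t. t \<ge> 2 \<Longrightarrow> s0 + Complex \<sigma> t \<noteq> 2"
begin

text \<open>The error terms of all five cases are \<open>T powr \<alpha> * (ln T) ^ b\<close>: the partial sums
  \<open>\<Sum>m<k. m powr -s0\<close> have size \<open>k powr \<kappa> * (ln k) ^ l\<close>, and the off-diagonal terms contribute
  \<open>T powr (2 - 2 * \<sigma>) * (ln T) ^ p\<close>.\<close>

definition \<kappa> :: real where "\<kappa> = max 0 (1 - Re s0)"
definition l :: nat where "l = (if Re s0 = 1 then 1 else 0)"
definition p :: nat where "p = (if \<sigma> < 1 then 1 else 2)"
definition \<alpha> :: real where "\<alpha> = 2 * \<kappa> + 2 - 2 * \<sigma>"
definition b :: nat where "b = 2 * l + p"
definition h :: "nat \<Rightarrow> real" where "h N = (\<Sum>m=1..N. real m powr (- Re s0))"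
definition coef :: "nat \<Rightarrow> complex" where "coef k = psum s0 k * of_real (real k powr (- \<sigma>))"
definition q :: "nat \<Rightarrow> real" where "q k = (cmod (coef k))\<^sup>2"
definition S :: real where "S = (\<Sum>k. q k)"
text \<open>With \<open>1 + ln x\<close> in place of \<open>ln x\<close> the function is nonnegative
  and monotone from 1 on, and \<open>1 + ln (c * x) \<le> (1 + ln c) * (1 + ln x)\<close> makes
  rescaling cost only a constant.\<close>

definition G :: "real \<Rightarrow> real" where "G x = x powr \<alpha> * (1 + ln x) ^ b"
definition D :: "nat \<Rightarrow> real \<Rightarrow> complex" where "D N t = (\<Sum>k=1..N. coef k * cis (- (t * ln (real k))))"
definition F :: "real \<Rightarrow> real" where "F t = (cmod (double_zeta (s0, Complex \<sigma> t)))\<^sup>2"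

text \<open>The second inequality combines \<open>1/2 < \<sigma>\<close> and
  \<open>3/2 < Re s0 + \<sigma>\<close>, according to which argument attains the maximum in
  \<open>\<kappa>\<close>; it is equivalent to \<open>\<alpha> < 1\<close>. It also gives
  convergence of the diagonal series and the tail bound.\<close>

lemma exponents: "\<kappa> \<ge> 0" "\<kappa> + 1/2 < \<sigma>" "0 \<le> \<alpha>" "\<alpha> < 1"
  using s0 \<sigma> s0_\<sigma> unfolding \<kappa>_def \<alpha>_def by (auto simp: max_def)

section \<open>Size of the coefficients and convergence of the diagonal series\<close>

lemma h_bound: "\<exists>C>0. \<forall>N\<ge>1. h N \<le> C * (real N powr \<kappa> * (1 + ln (real N)) ^ l)"
  unfolding h_def \<kappa>_def l_def using s0 by (intro sum_powr_bound) auto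

lemma h_nonneg: "h N \<ge> 0"
  unfolding h_def by (intro sum_nonneg) auto

lemma h_mono: "k \<le> N \<Longrightarrow> h k \<le> h N"
  unfolding h_def by (intro sum_mono2) auto

lemma coef_bound: "cmod (coef k) \<le> h k * real k powr (- \<sigma>)"
proof -
  have "cmod (psum s0 k) \<le> (\<Sum>m=1..<k. real m powr (- Re s0))"
    unfolding psum_def by (rule sum_norm_le) (simp add: norm_of_nat_powr)
  also have "\<dots> \<le> h k" unfolding h_def by (intro sum_mono2) auto
  finally show ?thesis unfolding coef_def norm_mult by (simp add: mult_right_mono)
qed

lemma q_bound: "\<exists>C>0. \<forall>k\<ge>1. q k \<le> C * (real k powr (2 * \<kappa> - 2 * \<sigma>) * (1 + ln (real k)) ^ (2 * l))"
proof -
  obtain C where C: "C > 0" "\<And>N. N \<ge> 1 \<Longrightarrow> h N \<le> C * (real N powr \<kappa> * (1 + ln (real N)) ^ l)"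
    using h_bound by blast
  have "q k \<le> C\<^sup>2 * (real k powr (2 * \<kappa> - 2 * \<sigma>) * (1 + ln (real k)) ^ (2 * l))" if "k \<ge> 1" for k
  proof -
    have "cmod (coef k) \<le> C * (real k powr \<kappa> * (1 + ln (real k)) ^ l) * real k powr (- \<sigma>)"
      using coef_bound[of k] C(2)[OF that] by (meson mult_right_mono order_trans powr_ge_zero)
    then have "q k \<le> (C * (real k powr \<kappa> * (1 + ln (real k)) ^ l) * real k powr (- \<sigma>))\<^sup>2"
      unfolding q_def by (intro power_mono) auto
    also have "\<dots> = C\<^sup>2 * ((real k powr (\<kappa> + - \<sigma>))\<^sup>2 * ((1 + ln (real k)) ^ l)\<^sup>2)"
      unfolding powr_add by (simp add: power2_eq_square mult_ac)
    also have "(real k powr (\<kappa> + - \<sigma>))\<^sup>2 = real k powr (2 * \<kappa> - 2 * \<sigma>)"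
      by (simp add: power2_eq_square flip: powr_add)
    finally show ?thesis by (simp add: power_mult[symmetric] mult.commute)
  qed
  then show ?thesis using C(1) by (intro exI[of _ "C\<^sup>2"]) auto
qed

lemma q_nonneg: "q k \<ge> 0"
  unfolding q_def by simp

text \<open>To keep the exact power of the logarithm at \<open>N\<close>, one uses
  \<open>1 + ln k \<le> (1 + ln N) * (1 + ln (k / N))\<close> and absorbs only the second factor
  into \<open>(k / N) powr \<epsilon>\<close>.\<close>

lemma q_tail: "\<exists>C>0. \<forall>N\<ge>1. summable (\<lambda>n. q (N + n)) \<and>
    (\<Sum>n. q (N + n)) \<le> C * (real N powr (2 * \<kappa> + 1 - 2 * \<sigma>) * (1 + ln (real N)) ^ (2 * l))"
proof -
  obtain C where C: "C > 0" "\<And>k. k \<ge> 1 \<Longrightarrow> q k \<le> C * (real k powr (2 * \<kappa> - 2 * \<sigma>) * (1 + ln (real k)) ^ (2 * l))"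
    using q_bound by blast
  \<comment> \<open>Half of the excess of the exponent \<open>2 * \<sigma> - 2 * \<kappa>\<close>
    over 1, so that \<open>d = 1 + \<epsilon>\<close> still exceeds 1.\<close>
  define \<epsilon> where "\<epsilon> = (2 * \<sigma> - 2 * \<kappa> - 1) / 2"
  define d where "d = 2 * \<sigma> - 2 * \<kappa> - \<epsilon>"
  have e: "\<epsilon> > 0" "d > 1" using exponents by (auto simp: \<epsilon>_def d_def field_simps)
  obtain C' where C': "C' > 0" "\<And>x. x \<ge> 1 \<Longrightarrow> (1 + ln x) ^ (2 * l) \<le> C' * x powr \<epsilon>"
    using one_plus_ln_power_le[OF e(1), of "2 * l"] by blast
  have main: "summable (\<lambda>n. q (N + n)) \<and>
    (\<Sum>n. q (N + n)) \<le> C * C' * (d / (d - 1)) * (real N powr (2 * \<kappa> + 1 - 2 * \<sigma>) * (1 + ln (real N)) ^ (2 * l))" if N: "N \<ge> 1" for N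
  proof -
    define Y where "Y = C * C' * (1 + ln (real N)) ^ (2 * l) * real N powr (- \<epsilon>)"
    have lnN: "ln (real N) \<ge> 0" using N by (intro ln_ge_zero) auto
    have Y: "Y \<ge> 0" unfolding Y_def using C C' lnN by auto
    have qb: "q (N + n) \<le> Y * real (N + n) powr (- d)" for n
    proof -
      define k where "k = N + n"
      have k: "k \<ge> 1" "real k / real N \<ge> 1" "real k > 0" "real N > 0" using N by (auto simp: k_def)
      have "ln (real k) = ln (real N) + ln (real k / real N)" using k by (simp add: ln_div)
      moreover have "ln (real k / real N) \<ge> 0" using k(2) by (intro ln_ge_zero)
      ultimately have "1 + ln (real k) \<le> (1 + ln (real N)) * (1 + ln (real k / real N))"
        using lnN by (simp add: algebra_simps)
      moreover have "0 \<le> 1 + ln (real k)" using k by (intro add_nonneg_nonneg ln_ge_zero) auto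
      ultimately have "(1 + ln (real k)) ^ (2 * l) \<le> ((1 + ln (real N)) * (1 + ln (real k / real N))) ^ (2 * l)"
        by (intro power_mono)
      also have "\<dots> = (1 + ln (real N)) ^ (2 * l) * (1 + ln (real k / real N)) ^ (2 * l)"
        by (rule power_mult_distrib)
      also have "\<dots> \<le> (1 + ln (real N)) ^ (2 * l) * (C' * (real k / real N) powr \<epsilon>)"
        using lnN by (intro mult_left_mono C'(2) k(2)) auto
      finally have "q k \<le> C * (real k powr (2 * \<kappa> - 2 * \<sigma>) * ((1 + ln (real N)) ^ (2 * l) * (C' * (real k / real N) powr \<epsilon>)))"
        using C(2)[OF k(1)] C(1) by (meson mult_left_mono order_trans powr_ge_zero less_imp_le)
      also have "(real k / real N) powr \<epsilon> = real k powr \<epsilon> * real N powr (- \<epsilon>)"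
        by (simp add: powr_divide powr_minus_divide)
      also have "C * (real k powr (2 * \<kappa> - 2 * \<sigma>) * ((1 + ln (real N)) ^ (2 * l) * (C' * (real k powr \<epsilon> * real N powr (- \<epsilon>)))))
        = Y * real k powr (2 * \<kappa> - 2 * \<sigma> + \<epsilon>)"
        unfolding Y_def powr_add by (simp add: mult_ac)
      also have "2 * \<kappa> - 2 * \<sigma> + \<epsilon> = - d" by (simp add: d_def)
      finally show ?thesis by (simp add: k_def)
    qed
    have sm: "summable (\<lambda>n. Y * real (N + n) powr (- d))"
      using e by (intro summable_mult summable_shift_powr)
    have sq: "summable (\<lambda>n. q (N + n))"
      by (rule summable_comparison_test'[OF sm, of 0]) (use qb q_nonneg in auto)
    have "(\<Sum>n. q (N + n)) \<le> (\<Sum>n. Y * real (N + n) powr (- d))"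
      by (intro suminf_le qb sq sm)
    also have "\<dots> = Y * (\<Sum>n. real (N + n) powr (- d))"
      using e by (intro suminf_mult summable_shift_powr)
    also have "\<dots> \<le> Y * (d / (d - 1) * real N powr (1 - d))"
      using e N Y by (intro mult_left_mono suminf_shift_powr_le) auto
    also have "\<dots> = C * C' * (d / (d - 1)) * (real N powr (- \<epsilon> + (1 - d)) * (1 + ln (real N)) ^ (2 * l))"
      unfolding Y_def powr_add by (simp add: mult_ac)
    also have "- \<epsilon> + (1 - d) = 2 * \<kappa> + 1 - 2 * \<sigma>" by (simp add: d_def)
    finally show ?thesis using sq by blast
  qed
  have "C * C' * (d / (d - 1)) > 0" using C C' e by auto
  then show ?thesis using main by blast
qed

lemma q_summable: "summable q"
  using q_tail summable_iff_shift[of q 1] by (auto simp: add.commute)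

section \<open>The error function \<open>G\<close>\<close>

lemma G_mono: "1 \<le> x \<Longrightarrow> x \<le> y \<Longrightarrow> G x \<le> G y"
  unfolding G_def using exponents by (intro mult_mono powr_mono2 power_mono) (auto simp: ln_ge_zero)

lemma G_nonneg: "1 \<le> x \<Longrightarrow> G x \<ge> 0"
  unfolding G_def by (auto simp: ln_ge_zero)

lemma G_scale:
  assumes "1 \<le> c" "1 \<le> x"
  shows "G (c * x) \<le> (c powr \<alpha> * (1 + ln c) ^ b) * G x"
proof -
  have "1 + ln (c * x) \<le> (1 + ln c) * (1 + ln x)"
    using assms by (simp add: ln_mult algebra_simps ln_ge_zero)
  moreover have "0 \<le> 1 + ln (c * x)" using assms mult_mono[of 1 c 1 x] by (intro add_nonneg_nonneg ln_ge_zero) auto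
  ultimately have "(1 + ln (c * x)) ^ b \<le> ((1 + ln c) * (1 + ln x)) ^ b" by (intro power_mono)
  then have "(c * x) powr \<alpha> * (1 + ln (c * x)) ^ b \<le> (c powr \<alpha> * x powr \<alpha>) * ((1 + ln c) ^ b * (1 + ln x) ^ b)"
    using assms by (simp add: powr_mult power_mult_distrib mult_left_mono)
  then show ?thesis unfolding G_def by (simp add: mult_ac)
qed

text \<open>This rests on \<open>\<alpha> < 1\<close> and serves to bound the full mean square of
  the polynomial by a multiple of the interval's scale.\<close>

lemma G_le_linear: "\<exists>C>0. \<forall>x\<ge>1. G x \<le> C * x"
proof -
  obtain C where C: "C > 0" "\<And>x. x \<ge> 1 \<Longrightarrow> (1 + ln x) ^ b \<le> C * x powr (1 - \<alpha>)"
    using one_plus_ln_power_le[of "1 - \<alpha>" b] exponents by auto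
  have "G x \<le> C * x" if "x \<ge> 1" for x
  proof -
    have "G x \<le> x powr \<alpha> * (C * x powr (1 - \<alpha>))"
      unfolding G_def by (intro mult_left_mono C(2) that) auto
    also have "\<dots> = C * x powr (\<alpha> + (1 - \<alpha>))" unfolding powr_add by simp
    also have "\<dots> = C * x" using that by simp
    finally show ?thesis .
  qed
  then show ?thesis using C by blast
qed

text \<open>All partial sums are replaced by the common majorant \<open>h N\<close>, which leaves
  pure powers of \<open>j\<close> and \<open>k\<close> in the off-diagonal sum. The square of
  \<open>h N\<close> is the origin of \<open>2 * \<kappa>\<close> in \<open>\<alpha>\<close> and of
  \<open>2 * l\<close> in \<open>b\<close>.\<close>

lemma D_mean_value_finite:
  "\<exists>C>0. \<forall>N\<ge>1. \<forall>A B. A \<le> B \<longrightarrow>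
     \<bar>integral {A..B} (\<lambda>t. (cmod (D N t))\<^sup>2) - (B - A) * (\<Sum>k=1..N. q k)\<bar> \<le> C * G (real N)"
proof -
  obtain C where C: "C > 0" "\<And>N. N \<ge> 1 \<Longrightarrow> h N \<le> C * (real N powr \<kappa> * (1 + ln (real N)) ^ l)"
    using h_bound by blast
  obtain C' where C': "C' > 0" "\<And>N. N \<ge> 1 \<Longrightarrow>
     (\<Sum>k=1..N. real k powr (-\<sigma>))\<^sup>2 + 4 * (\<Sum>k=1..N. real k powr (1 - 2 * \<sigma>)) * (\<Sum>k=1..N. real k powr (-1))
     \<le> C' * (real N powr (2 - 2 * \<sigma>) * (1 + ln (real N)) ^ p)"
    using off_diagonal_size[OF \<sigma>] unfolding p_def by blast
  have "\<bar>integral {A..B} (\<lambda>t. (cmod (D N t))\<^sup>2) - (B - A) * (\<Sum>k=1..N. q k)\<bar> \<le> 2 * C\<^sup>2 * C' * G (real N)"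
    if N: "N \<ge> 1" and AB: "A \<le> B" for N A B
  proof -
    have lnN: "ln (real N) \<ge> 0" using N by (intro ln_ge_zero) auto
    have "\<bar>integral {A..B} (\<lambda>t. (cmod (D N t))\<^sup>2) - (B - A) * (\<Sum>k=1..N. q k)\<bar>
        \<le> 2 * (\<Sum>j=1..N. \<Sum>k\<in>{1..N} - {j}. cmod (coef j) * cmod (coef k) / \<bar>ln (real k) - ln (real j)\<bar>)"
      unfolding D_def q_def by (rule dirichlet_polynomial_mean_value[OF AB])
    also have "\<dots> \<le> 2 * (\<Sum>j=1..N. \<Sum>k\<in>{1..N} - {j}. (h N)\<^sup>2 * (real j powr (-\<sigma>) * real k powr (-\<sigma>) / \<bar>ln (real k) - ln (real j)\<bar>))"
    proof (intro mult_left_mono sum_mono)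
      fix j k assume jk: "j \<in> {1..N}" "k \<in> {1..N} - {j}"
      have cb: "cmod (coef i) \<le> h N * real i powr (-\<sigma>)" if "i \<le> N" for i
        using coef_bound[of i] h_mono[OF that] by (meson mult_right_mono order_trans powr_ge_zero)
      have "cmod (coef j) * cmod (coef k) \<le> (h N * real j powr (-\<sigma>)) * (h N * real k powr (-\<sigma>))"
        using jk h_nonneg by (intro mult_mono cb) auto
      then have "cmod (coef j) * cmod (coef k) / \<bar>ln (real k) - ln (real j)\<bar> \<le> (h N * real j powr (-\<sigma>)) * (h N * real k powr (-\<sigma>)) / \<bar>ln (real k) - ln (real j)\<bar>"
        by (intro divide_right_mono) auto
      then show "cmod (coef j) * cmod (coef k) / \<bar>ln (real k) - ln (real j)\<bar> \<le> (h N)\<^sup>2 * (real j powr (-\<sigma>) * real k powr (-\<sigma>) / \<bar>ln (real k) - ln (real j)\<bar>)"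
        by (simp add: power2_eq_square mult_ac)
    qed auto
    also have "\<dots> = 2 * (h N)\<^sup>2 * (\<Sum>j=1..N. \<Sum>k\<in>{1..N} - {j}. real j powr (-\<sigma>) * real k powr (-\<sigma>) / \<bar>ln (real k) - ln (real j)\<bar>)"
      by (simp add: sum_distrib_left mult_ac)
    also have "\<dots> \<le> 2 * (h N)\<^sup>2 * (C' * (real N powr (2 - 2 * \<sigma>) * (1 + ln (real N)) ^ p))"
      by (intro mult_left_mono order_trans[OF off_diagonal_sum_le[OF \<sigma>(2)] C'(2)[OF N]]) auto
    also have "\<dots> \<le> 2 * (C * (real N powr \<kappa> * (1 + ln (real N)) ^ l))\<^sup>2 * (C' * (real N powr (2 - 2 * \<sigma>) * (1 + ln (real N)) ^ p))"
      using C(2)[OF N] C' h_nonneg lnN by (intro mult_right_mono mult_left_mono power_mono) auto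
    also have "\<dots> = 2 * C\<^sup>2 * C' * (real N powr (\<kappa> + \<kappa> + (2 - 2 * \<sigma>)) * (1 + ln (real N)) ^ (l + l + p))"
      unfolding powr_add power_add by (simp add: power2_eq_square mult_ac)
    also have "\<kappa> + \<kappa> + (2 - 2 * \<sigma>) = \<alpha>" by (simp add: \<alpha>_def)
    also have "l + l + p = b" by (simp add: b_def)
    finally show ?thesis by (simp only: G_def)
  qed
  moreover have "2 * C\<^sup>2 * C' > 0" using C C' by auto
  ultimately show ?thesis by blast
qed

text \<open>Completing the diagonal to \<open>S\<close> costs the interval length times the tail of
  the series. For length at most \<open>N\<close> this is
  \<open>N * N powr (2 * \<kappa> + 1 - 2 * \<sigma>)\<close>, up to logarithms again
  \<open>N powr \<alpha>\<close>.\<close>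

lemma D_mean_value:
  "\<exists>C>0. \<forall>N\<ge>1. \<forall>A B. A \<le> B \<and> B - A \<le> real N \<longrightarrow>
     \<bar>integral {A..B} (\<lambda>t. (cmod (D N t))\<^sup>2) - (B - A) * S\<bar> \<le> C * G (real N)"
proof -
  obtain C1 where C1: "C1 > 0" "\<And>N A B. N \<ge> 1 \<Longrightarrow> A \<le> B \<Longrightarrow>
     \<bar>integral {A..B} (\<lambda>t. (cmod (D N t))\<^sup>2) - (B - A) * (\<Sum>k=1..N. q k)\<bar> \<le> C1 * G (real N)"
    using D_mean_value_finite by blast
  obtain C2 where C2: "C2 > 0" "\<And>N. N \<ge> 1 \<Longrightarrow>
    (\<Sum>n. q (N + n)) \<le> C2 * (real N powr (2 * \<kappa> + 1 - 2 * \<sigma>) * (1 + ln (real N)) ^ (2 * l))"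
    using q_tail by blast
  have "\<bar>integral {A..B} (\<lambda>t. (cmod (D N t))\<^sup>2) - (B - A) * S\<bar> \<le> (C1 + C2) * G (real N)"
    if N: "N \<ge> 1" and AB: "A \<le> B" "B - A \<le> real N" for N A B
  proof -
    have lnN: "ln (real N) \<ge> 0" using N by (intro ln_ge_zero) auto
    have q0: "q 0 = 0" by (simp add: q_def coef_def psum_def)
    define R where "R = S - (\<Sum>k=1..N. q k)"
    have "S = (\<Sum>n. q (n + Suc N)) + (\<Sum>k<Suc N. q k)"
      unfolding S_def by (rule suminf_split_initial_segment[OF q_summable])
    also have "(\<Sum>k<Suc N. q k) = q 0 + (\<Sum>k=1..N. q k)"
      by (simp add: sum.atLeast1_atMost_eq sum.lessThan_Suc_shift del: sum.lessThan_Suc)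
    finally have R: "R = (\<Sum>n. q (n + Suc N))" unfolding R_def q0 by simp
    have smN: "summable (\<lambda>n. q (N + n))" using q_summable summable_iff_shift[of q N] by (simp add: add.commute)
    have sm: "summable (\<lambda>n. q (n + Suc N))" using q_summable summable_iff_shift[of q "Suc N"] by simp
    have R0: "R \<ge> 0" unfolding R by (intro suminf_nonneg sm q_nonneg)
    have "(\<Sum>n. q (N + n)) = q N + R"
      using suminf_split_head[OF smN] unfolding R by (simp add: add_ac)
    then have "R \<le> (\<Sum>n. q (N + n))" using q_nonneg[of N] by simp
    also have "\<dots> \<le> C2 * (real N powr (2 * \<kappa> + 1 - 2 * \<sigma>) * (1 + ln (real N)) ^ (2 * l))" by (rule C2(2)[OF N])
    also have "\<dots> \<le> C2 * (real N powr (2 * \<kappa> + 1 - 2 * \<sigma>) * (1 + ln (real N)) ^ b)"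
      using lnN C2 by (intro mult_left_mono power_increasing) (auto simp: b_def)
    finally have "(B - A) * R \<le> real N * (C2 * (real N powr (2 * \<kappa> + 1 - 2 * \<sigma>) * (1 + ln (real N)) ^ b))"
      using AB R0 by (intro mult_mono) auto
    also have "\<dots> = C2 * (real N powr (1 + (2 * \<kappa> + 1 - 2 * \<sigma>)) * (1 + ln (real N)) ^ b)"
      unfolding powr_add using N by simp
    also have "1 + (2 * \<kappa> + 1 - 2 * \<sigma>) = \<alpha>" by (simp add: \<alpha>_def)
    finally have "\<bar>(B - A) * R\<bar> \<le> C2 * G (real N)" using R0 AB by (simp add: G_def)
    moreover have "integral {A..B} (\<lambda>t. (cmod (D N t))\<^sup>2) - (B - A) * S = (integral {A..B} (\<lambda>t. (cmod (D N t))\<^sup>2) - (B - A) * (\<Sum>k=1..N. q k)) - (B - A) * R"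
      unfolding R_def by (simp add: algebra_simps)
    ultimately show ?thesis using C1(2)[OF N AB(1)] by (simp add: algebra_simps)
  qed
  moreover have "C1 + C2 > 0" using C1 C2 by simp
  ultimately show ?thesis by blast
qed

section \<open>Truncation on the vertical line\<close>

lemma dz_main_eq_D: "dz_main s0 N (Complex \<sigma> t) = D N t"
  unfolding dz_main_def D_def
proof (intro sum.cong refl)
  fix k assume "k \<in> {1..N}"
  then have k: "k > 0" by simp
  have "complex_of_nat k powr (- Complex \<sigma> t) = exp (- Complex \<sigma> t * of_real (ln (real k)))"
    using k by (simp add: powr_def Ln_of_nat)
  also have "- Complex \<sigma> t * of_real (ln (real k)) = of_real (- \<sigma> * ln (real k)) + \<i> * of_real (- (t * ln (real k)))"
    by (simp add: complex_eq_iff)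
  also have "exp \<dots> = of_real (exp (- \<sigma> * ln (real k))) * cis (- (t * ln (real k)))"
    unfolding exp_add cis_conv_exp by (simp only: exp_of_real)
  also have "exp (- \<sigma> * ln (real k)) = real k powr (- \<sigma>)"
    using k by (simp add: powr_def)
  finally show "psum s0 k * of_nat k powr (- Complex \<sigma> t) = coef k * cis (- (t * ln (real k)))"
    by (simp add: coef_def)
qed

lemma F_continuous: "continuous_on {2..} F"
proof -
  have "continuous_on {2..} (\<lambda>t. double_zeta (s0, Complex \<sigma> t))"
  proof (rule continuous_on_compose2[OF holomorphic_on_imp_continuous_on[OF double_zeta_slice_holomorphic[of s0]]])
    have "Complex \<sigma> = (\<lambda>t. of_real \<sigma> + \<i> * of_real t)" by (auto simp: complex_eq_iff)
    then show "continuous_on {2..} (Complex \<sigma>)" by (simp add: continuous_intros)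
    show "Complex \<sigma> ` {2..} \<subseteq> {s. Re s > 1/2 \<and> Re (s0 + s) > 3/2} - {1, 2 - s0}"
    proof (intro image_subsetI)
      fix t :: real assume t: "t \<in> {2..}"
      then have "Complex \<sigma> t \<noteq> 2 - s0" using regular[of t] by (auto simp: algebra_simps)
      moreover have "Complex \<sigma> t \<noteq> 1" using t by (auto simp: complex_eq_iff)
      ultimately show "Complex \<sigma> t \<in> {s. Re s > 1/2 \<and> Re (s0 + s) > 3/2} - {1, 2 - s0}"
        using \<sigma> s0_\<sigma> by simp
    qed
  qed
  then show ?thesis unfolding F_def[abs_def] by (intro continuous_intros)
qed

lemma F_integrable: "2 \<le> A \<Longrightarrow> F integrable_on {A..B}"
  by (rule integrable_continuous_interval, rule continuous_on_subset[OF F_continuous]) auto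

lemma F_nonneg: "F t \<ge> 0"
  unfolding F_def by simp

lemma D_integrable: "(\<lambda>t. (cmod (D N t))\<^sup>2) integrable_on {A..B}"
  unfolding D_def by (intro integrable_continuous_interval continuous_intros)

text \<open>Here \<open>cmod s0 \<le> A / 2 - 1\<close>, so both upper bounds on heights hold with
  \<open>4 A \<le> N / 4\<close>. Both distances to the poles are at least \<open>A / 2\<close>, and
  \<open>N \<le> 16 * A + 1 \<le> 17 * A\<close> makes this at least \<open>N / 34\<close>. The
  exponent \<open>\<epsilon>\<close> is exactly what lifts \<open>\<kappa> - \<sigma>\<close> to
  -1/2, so it absorbs the logarithm of \<open>h N\<close> for free.\<close>

lemma tail_square_bound:
  "\<exists>C>0. \<forall>A\<ge>2 + 2 * cmod s0. \<forall>t\<in>{A..2 * A}.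
     (cmod (dz_tail s0 (nat \<lceil>16 * A\<rceil>) (Complex \<sigma> t)))\<^sup>2 \<le> C / A"
proof -
  obtain C where C: "C > 0" "\<And>N. N \<ge> 1 \<Longrightarrow> h N \<le> C * (real N powr \<kappa> * (1 + ln (real N)) ^ l)"
    using h_bound by blast
  define \<epsilon> where "\<epsilon> = \<sigma> - \<kappa> - 1/2"
  have e: "\<epsilon> > 0" using exponents by (simp add: \<epsilon>_def)
  obtain C' where C': "C' > 0" "\<And>x. x \<ge> 1 \<Longrightarrow> (1 + ln x) ^ l \<le> C' * x powr \<epsilon>"
    using one_plus_ln_power_le[OF e, of l] by blast
  define M where "M = ((34 + 1) * (34 + 2) + 4) * (C * C')"
  have "(cmod (dz_tail s0 (nat \<lceil>16 * A\<rceil>) (Complex \<sigma> t)))\<^sup>2 \<le> M\<^sup>2 / A"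
    if A: "A \<ge> 2 + 2 * cmod s0" and t: "t \<in> {A..2 * A}" for A t
  proof -
    define N where "N = nat \<lceil>16 * A\<rceil>"
    define s where "s = Complex \<sigma> t"
    have n0: "cmod s0 \<ge> 0" by simp
    have A2: "A \<ge> 2" using A n0 by linarith
    have N: "real N \<ge> 16 * A" "real N \<le> 16 * A + 1" unfolding N_def using A2 by linarith+
    have N1: "real N \<ge> 32" using N A2 by linarith
    have ns: "cmod s \<le> 1 + 2 * A"
      using cmod_le[of s] \<sigma> t A2 by (simp add: s_def)
    have ns0: "cmod (s0 + s - 1) \<le> cmod s0 + cmod s + 1"
      using norm_triangle_ineq4[of "s0 + s" 1] norm_triangle_ineq[of s0 s] by simp
    have im1: "cmod (s - 1) \<ge> t" using abs_Im_le_cmod[of "s - 1"] t A2 by (simp add: s_def)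
    have "\<bar>Im s0 + t\<bar> \<le> cmod (s0 + s - 2)" using abs_Im_le_cmod[of "s0 + s - 2"] by (simp add: s_def)
    moreover have "\<bar>Im s0\<bar> \<le> cmod s0" by (rule abs_Im_le_cmod)
    ultimately have im2: "cmod (s0 + s - 2) \<ge> t - cmod s0" by linarith
    have "cmod (dz_tail s0 N s) \<le> ((34 + 1) * (34 + 2) + 4) * ((\<Sum>m=1..N. real m powr (- Re s0)) * real N powr (- Re s))"
    proof (rule dz_tail_bound)
      show "20 \<le> N" using N1 by linarith
      show "1/2 < Re s" "3/2 < Re (s0 + s)" "0 < Re s0" using \<sigma> s0_\<sigma> s0 by (auto simp: s_def)
      show "cmod s \<le> real N / 4" using ns N A2 by linarith
      show "cmod (s0 + s - 1) \<le> real N / 4" using ns0 ns N A n0 by linarith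
      have tA: "t \<ge> A" using t by simp
      show "real N / 34 \<le> cmod (s - 1)" using N tA im1 A2 by linarith
      show "real N / 34 \<le> cmod (s0 + s - 2)" using N tA im2 A n0 by linarith
    qed auto
    also have "\<dots> = ((34 + 1) * (34 + 2) + 4) * (h N * real N powr (- \<sigma>))" by (simp add: h_def s_def)
    also have "\<dots> \<le> ((34 + 1) * (34 + 2) + 4) * (C * (real N powr \<kappa> * (C' * real N powr \<epsilon>)) * real N powr (- \<sigma>))"
    proof (intro mult_left_mono mult_right_mono)
      have "h N \<le> C * (real N powr \<kappa> * (1 + ln (real N)) ^ l)" using N1 by (intro C(2)) linarith
      also have "\<dots> \<le> C * (real N powr \<kappa> * (C' * real N powr \<epsilon>))"
        using C N1 by (intro mult_left_mono C'(2)) auto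
      finally show "h N \<le> C * (real N powr \<kappa> * (C' * real N powr \<epsilon>))" .
    qed auto
    also have "\<dots> = M * real N powr (\<kappa> + \<epsilon> + - \<sigma>)"
      unfolding M_def powr_add by (simp add: mult_ac)
    also have "\<kappa> + \<epsilon> + - \<sigma> = - (1/2)" by (simp add: \<epsilon>_def)
    finally have "(cmod (dz_tail s0 N s))\<^sup>2 \<le> (M * real N powr (- (1/2)))\<^sup>2"
      by (intro power_mono) auto
    also have "\<dots> = M\<^sup>2 * real N powr (- (1/2) + - (1/2))"
      unfolding powr_add by (simp add: power2_eq_square mult_ac)
    also have "- (1/2) + - (1/2) = - (1::real)" by simp
    also have "M\<^sup>2 * real N powr - 1 = M\<^sup>2 / real N"
      unfolding powr_minus_divide using N1 by simp
    also have "\<dots> \<le> M\<^sup>2 / A"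
      using N A2 by (intro divide_left_mono mult_pos_pos) auto
    finally show ?thesis by (simp add: N_def s_def)
  qed
  moreover have "M\<^sup>2 > 0" using C C' by (simp add: M_def)
  ultimately show ?thesis by blast
qed

lemma short_interval:
  "\<exists>C>0. \<forall>A\<ge>2 + 2 * cmod s0. \<forall>B\<in>{A..2 * A}.
     \<bar>integral {A..B} F - (B - A) * S\<bar> \<le> C * (A powr (1/2) + G A)"
proof -
  obtain C1 where C1: "C1 > 0" "\<And>N A B. N \<ge> 1 \<Longrightarrow> A \<le> B \<Longrightarrow> B - A \<le> real N \<Longrightarrow>
     \<bar>integral {A..B} (\<lambda>t. (cmod (D N t))\<^sup>2) - (B - A) * S\<bar> \<le> C1 * G (real N)"
    using D_mean_value by blast
  obtain C2 where C2: "C2 > 0" "\<And>A t. A \<ge> 2 + 2 * cmod s0 \<Longrightarrow> t \<in> {A..2 * A} \<Longrightarrow>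
     (cmod (dz_tail s0 (nat \<lceil>16 * A\<rceil>) (Complex \<sigma> t)))\<^sup>2 \<le> C2 / A"
    using tail_square_bound by blast
  obtain C3 where C3: "C3 > 0" "\<And>x. x \<ge> 1 \<Longrightarrow> G x \<le> C3 * x"
    using G_le_linear by blast
  define C4 where "C4 = 17 powr \<alpha> * (1 + ln 17) ^ b"
  have S0: "S \<ge> 0" unfolding S_def by (intro suminf_nonneg q_summable q_nonneg)
  have C4: "C4 > 0" unfolding C4_def by (intro mult_pos_pos zero_less_power add_pos_pos) auto
  define C where "C = S + 17 * C1 * C3 + 2 * C2 + C1 * C4"
  have "\<bar>integral {A..B} F - (B - A) * S\<bar> \<le> C * (A powr (1/2) + G A)"
    if A: "A \<ge> 2 + 2 * cmod s0" and B: "B \<in> {A..2 * A}" for A B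
  proof -
    define N where "N = nat \<lceil>16 * A\<rceil>"
    \<comment> \<open>This weight balances both sides of the perturbation: \<open>u\<close> times
      the polynomial's mean square \<open>O(A)\<close>, and \<open>1 / u\<close> times the tail's
      \<open>O(1)\<close>, are both \<open>O(A powr (1/2))\<close>.\<close>
    define u where "u = A powr (- (1/2))"
    have n0: "cmod s0 \<ge> 0" by simp
    have A2: "A \<ge> 2" using A n0 by linarith
    have N: "real N \<ge> 16 * A" "real N \<le> 17 * A" unfolding N_def using A2 by linarith+
    have N1: "N \<ge> 1" "real N \<ge> 1" using N A2 by auto
    have u: "u > 0" "1 / u = A powr (1/2)" using A2 by (auto simp: u_def powr_minus_divide)
    have "A powr (1/2) = A powr (- (1/2) + 1)" by simp
    also have "\<dots> = u * A" unfolding powr_add u_def using A2 by simp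
    finally have uA: "u * A = A powr (1/2)" by simp
    have rt: "A powr (1/2) \<ge> 1" using A2 by (simp add: ge_one_powr_ge_zero)
    define I where "I = integral {A..B} (\<lambda>t. (cmod (D N t))\<^sup>2)"
    have I: "\<bar>I - (B - A) * S\<bar> \<le> C1 * G (real N)"
      unfolding I_def using B N A2 N1 by (intro C1(2)) auto
    define c where "c = (1 / u + 1) * (C2 / A)"
    have pt: "norm (F t - (cmod (D N t))\<^sup>2) \<le> u * (cmod (D N t))\<^sup>2 + c" if t: "t \<in> {A..B}" for t
    proof -
      have "Complex \<sigma> t \<noteq> 1" using t A2 by (auto simp: complex_eq_iff)
      then have "double_zeta (s0, Complex \<sigma> t) = dz_main s0 N (Complex \<sigma> t) + dz_tail s0 N (Complex \<sigma> t)"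
        using N1 \<sigma> s0_\<sigma> regular[of t] t A2 by (intro double_zeta_truncation) auto
      then have "F t = (cmod (D N t + dz_tail s0 N (Complex \<sigma> t)))\<^sup>2"
        unfolding F_def dz_main_eq_D by simp
      then have "norm (F t - (cmod (D N t))\<^sup>2) \<le> u * (cmod (D N t))\<^sup>2 + (1 / u + 1) * (cmod (dz_tail s0 N (Complex \<sigma> t)))\<^sup>2"
        using cmod_add_square_perturb[OF u(1), of "D N t" "dz_tail s0 N (Complex \<sigma> t)"] by simp
      also have "\<dots> \<le> u * (cmod (D N t))\<^sup>2 + c"
        unfolding c_def N_def using t B u(1) by (intro add_left_mono mult_left_mono C2(2) A) auto
      finally show ?thesis .
    qed
    have "integral {A..B} F - I = integral {A..B} (\<lambda>t. F t - (cmod (D N t))\<^sup>2)"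
      unfolding I_def using A2 by (intro Henstock_Kurzweil_Integration.integral_diff[symmetric] F_integrable D_integrable)
    also have "norm \<dots> \<le> integral {A..B} (\<lambda>t. u * (cmod (D N t))\<^sup>2 + c)"
    proof (rule integral_norm_bound_integral)
      show "(\<lambda>t. F t - (cmod (D N t))\<^sup>2) integrable_on {A..B}"
        using A2 by (intro integrable_diff F_integrable D_integrable)
      show "(\<lambda>t. u * (cmod (D N t))\<^sup>2 + c) integrable_on {A..B}"
        by (intro integrable_add integrable_on_mult_right[OF D_integrable] integrable_const_ivl)
    qed (rule pt)
    also have "\<dots> = u * I + c * (B - A)"
      using B unfolding I_def
      by (subst Henstock_Kurzweil_Integration.integral_add[OF integrable_on_mult_right[OF D_integrable]]) auto
    finally have d: "\<bar>integral {A..B} F - I\<bar> \<le> u * I + c * (B - A)" by simp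
    have "I \<le> (B - A) * S + C1 * G (real N)" using I by linarith
    also have "\<dots> \<le> A * S + C1 * (C3 * (17 * A))"
    proof (rule add_mono)
      show "(B - A) * S \<le> A * S" using B S0 by (intro mult_right_mono) auto
      have "G (real N) \<le> C3 * real N" by (rule C3(2)[OF N1(2)])
      also have "\<dots> \<le> C3 * (17 * A)" using N C3 by (intro mult_left_mono) auto
      finally show "C1 * G (real N) \<le> C1 * (C3 * (17 * A))" using C1 by (intro mult_left_mono) auto
    qed
    finally have "u * I \<le> u * (A * S + C1 * (C3 * (17 * A)))" using u by (intro mult_left_mono) auto
    also have "\<dots> = (u * A) * (S + 17 * C1 * C3)" by (simp add: algebra_simps)
    finally have uI: "u * I \<le> (S + 17 * C1 * C3) * A powr (1/2)" unfolding uA by (simp add: mult.commute)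
    have "c * (B - A) \<le> c * A" using B C2 u A2 unfolding c_def by (intro mult_left_mono) auto
    also have "\<dots> = (A powr (1/2) + 1) * C2" using A2 by (simp add: c_def u(2))
    also have "\<dots> \<le> (2 * A powr (1/2)) * C2" using rt C2 by (intro mult_right_mono) auto
    finally have cB: "c * (B - A) \<le> 2 * C2 * A powr (1/2)" by (simp only: mult_ac)
    have "G (real N) \<le> G (17 * A)" using N N1 by (intro G_mono) auto
    also have "\<dots> \<le> C4 * G A" unfolding C4_def using A2 by (intro G_scale) auto
    finally have GN: "C1 * G (real N) \<le> C1 * (C4 * G A)" using C1 by (intro mult_left_mono) auto
    have GA: "G A \<ge> 0" using A2 by (intro G_nonneg) auto
    have "\<bar>integral {A..B} F - (B - A) * S\<bar> \<le> (S + 17 * C1 * C3 + 2 * C2) * A powr (1/2) + C1 * C4 * G A"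
      using d uI cB I GN by (simp add: algebra_simps)
    also have "\<dots> \<le> C * A powr (1/2) + C * G A"
    proof (intro add_mono mult_right_mono)
      have "0 < C1 * C3" "0 < C1 * C4" using C1(1) C3(1) C4 by auto
      then show "S + 17 * C1 * C3 + 2 * C2 \<le> C" "C1 * C4 \<le> C"
        using S0 C2(1) by (auto simp: C_def)
    qed (use GA in auto)
    finally show ?thesis by (simp add: algebra_simps)
  qed
  moreover have "C > 0" unfolding C_def using S0 C1 C2 C3 C4 by (simp add: add_nonneg_pos add_pos_pos)
  ultimately show ?thesis by blast
qed

text \<open>If \<open>\<alpha> < 1/2\<close> then \<open>G\<close> is absorbed by the square root. In either case the error is a square
  root times a nondecreasing function, so the dyadic error terms form a geometric series.\<close>

definition g :: "real \<Rightarrow> real" where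
  "g x = (if \<alpha> < 1/2 then 1 else 1 + x powr (\<alpha> - 1/2) * (1 + ln x) ^ b)"

lemma g_mono: "1 \<le> x \<Longrightarrow> x \<le> y \<Longrightarrow> g x \<le> g y"
  unfolding g_def by (auto intro!: mult_mono powr_mono2 power_mono simp: ln_ge_zero)

lemma g_ge_1: "1 \<le> x \<Longrightarrow> g x \<ge> 1"
  unfolding g_def by (auto simp: ln_ge_zero)

lemma G_le_g: "\<exists>C>0. \<forall>x\<ge>1. x powr (1/2) + G x \<le> C * (x powr (1/2) * g x)"
proof (cases "\<alpha> < 1/2")
  case True
  obtain C where C: "C > 0" "\<And>x. x \<ge> 1 \<Longrightarrow> (1 + ln x) ^ b \<le> C * x powr (1/2 - \<alpha>)"
    using one_plus_ln_power_le[of "1/2 - \<alpha>" b] True by auto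
  have "x powr (1/2) + G x \<le> (1 + C) * (x powr (1/2) * g x)" if "x \<ge> 1" for x
  proof -
    have "G x \<le> x powr \<alpha> * (C * x powr (1/2 - \<alpha>))"
      unfolding G_def by (intro mult_left_mono C(2) that) auto
    also have "\<dots> = C * x powr (\<alpha> + (1/2 - \<alpha>))" unfolding powr_add by simp
    finally show ?thesis using True by (simp add: g_def algebra_simps)
  qed
  then show ?thesis using C(1) by (intro exI[of _ "1 + C"]) auto
next
  case False
  have "x powr (1/2) + G x = x powr (1/2) * g x" for x
  proof -
    have "x powr \<alpha> = x powr (1/2 + (\<alpha> - 1/2))" by simp
    also have "\<dots> = x powr (1/2) * x powr (\<alpha> - 1/2)" by (rule powr_add)
    finally show ?thesis using False by (simp add: G_def g_def algebra_simps)
  qed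
  then show ?thesis by (intro exI[of _ 1]) auto
qed

lemma long_interval: "\<exists>C>0. \<forall>T\<ge>2. \<bar>integral {2..T} F - S * T\<bar> \<le> C * (T powr (1/2) * g T)"
proof -
  define A0 where "A0 = 2 + 2 * cmod s0"
  have A0: "A0 \<ge> 2" unfolding A0_def by simp
  obtain C1 where C1: "C1 > 0" "\<And>A B. A \<ge> A0 \<Longrightarrow> B \<in> {A..2 * A} \<Longrightarrow>
     \<bar>integral {A..B} F - (B - A) * S\<bar> \<le> C1 * (A powr (1/2) + G A)"
    using short_interval unfolding A0_def by blast
  obtain C2 where C2: "C2 > 0" "\<And>x. x \<ge> 1 \<Longrightarrow> x powr (1/2) + G x \<le> C2 * (x powr (1/2) * g x)"
    using G_le_g by blast
  have S0: "S \<ge> 0" unfolding S_def by (intro suminf_nonneg q_summable q_nonneg)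
  have I0: "integral {2..2 * A0} F \<ge> 0" by (intro integral_nonneg F_integrable F_nonneg) auto
  \<comment> \<open>The last two summands cover \<open>T \<le> 2 * A0\<close>. The first makes the
    induction close: it gives \<open>K + C1 * C2 \<le> 4 / 3 * K\<close>, and doubling the argument
    multiplies its square root by \<open>2 powr (1/2)\<close>, which is at least 4/3.\<close>
  define K where "K = 3 * (C1 * C2) + integral {2..2 * A0} F + S * (2 * A0)"
  have K: "K \<ge> 3 * (C1 * C2)" "K > 0"
    unfolding K_def using mult_pos_pos[OF C1(1) C2(1)] I0 mult_nonneg_nonneg[OF S0, of "2 * A0"] A0 by linarith+
  have "\<bar>integral {2..T} F - S * T\<bar> \<le> K * (T powr (1/2) * g T)" if "T \<ge> 2" "T \<le> 2 * A0 * 2 ^ n" for n T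
    using that
  proof (induction n arbitrary: T)
    case 0
    have "integral {2..T} F \<le> integral {2..2 * A0} F"
      using 0 F_nonneg by (intro integral_subset_le F_integrable) auto
    moreover have "integral {2..T} F \<ge> 0" by (intro integral_nonneg F_integrable F_nonneg) auto
    moreover have "0 \<le> S * T" "S * T \<le> S * (2 * A0)" using 0 S0 by (auto intro: mult_left_mono)
    moreover have "C1 * C2 > 0" using C1 C2 by simp
    ultimately have "\<bar>integral {2..T} F - S * T\<bar> \<le> K" using I0 unfolding K_def by linarith
    also have "\<dots> \<le> K * (T powr (1/2) * g T)"
    proof -
      have "1 * 1 \<le> T powr (1/2) * g T"
        using 0 g_ge_1[of T] by (intro mult_mono) (auto simp: ge_one_powr_ge_zero)
      then show ?thesis using K by simp
    qed
    finally show ?case .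
  next
    case (Suc n)
    show ?case
    proof (cases "T \<le> 2 * A0 * 2 ^ n")
      case True
      then show ?thesis using Suc by simp
    next
      case False
      \<comment> \<open>Halving reaches the range of the induction hypothesis, while
        \<open>T > 2 * A0\<close> keeps \<open>A\<close> large enough for the short-interval
        estimate on \<open>[A, 2 A]\<close>.\<close>
      define A where "A = T / 2"
      have "1 \<le> (2::real) ^ n" by simp
      then have "2 * A0 * 1 \<le> 2 * A0 * 2 ^ n" using A0 by (intro mult_left_mono) auto
      then have "T \<ge> 2 * A0" using False by linarith
      then have A: "A \<ge> A0" "A \<ge> 2" "T = 2 * A" "A \<le> 2 * A0 * 2 ^ n" using A0 Suc.prems by (auto simp: A_def)
      define e where "e = A powr (1/2) * g A"
      have "\<bar>integral {2..A} F - S * A\<bar> \<le> K * e" unfolding e_def using A by (intro Suc.IH)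
      moreover have "\<bar>integral {A..T} F - (T - A) * S\<bar> \<le> C1 * (A powr (1/2) + G A)"
        using A by (intro C1(2)) auto
      moreover have "C1 * (A powr (1/2) + G A) \<le> C1 * (C2 * e)"
        unfolding e_def using A C1 by (intro mult_left_mono C2(2)) auto
      moreover have "integral {2..T} F = integral {2..A} F + integral {A..T} F"
        using A by (intro Henstock_Kurzweil_Integration.integral_combine[symmetric] F_integrable) auto
      moreover have "S * T = S * A + (T - A) * S" by (simp add: algebra_simps)
      ultimately have "\<bar>integral {2..T} F - S * T\<bar> \<le> K * e + C1 * (C2 * e)" by linarith
      also have "\<dots> = (K + C1 * C2) * e" by (simp add: algebra_simps)
      also have "\<dots> \<le> (4 / 3 * K) * e"
        unfolding e_def using K A g_ge_1[of A] by (intro mult_right_mono mult_nonneg_nonneg) auto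
      also have "e \<le> A powr (1/2) * g T" unfolding e_def using A by (intro mult_left_mono g_mono) auto
      also have "(4 / 3 * K) * (A powr (1/2) * g T) = K * (((4 / 3) * A powr (1/2)) * g T)" by simp
      also have "\<dots> \<le> K * (T powr (1/2) * g T)"
      proof (intro mult_left_mono mult_right_mono)
        have "4 / 3 \<le> (2::real) powr (1/2)"
          unfolding powr_half_sqrt[of 2, simplified] by (rule real_le_rsqrt) (simp add: power2_eq_square)
        then have "4 / 3 * A powr (1/2) \<le> 2 powr (1/2) * A powr (1/2)" by (intro mult_right_mono) auto
        also have "\<dots> = T powr (1/2)" unfolding A(3) using A by (simp add: powr_mult)
        finally show "4 / 3 * A powr (1/2) \<le> T powr (1/2)" .
      qed (use K g_ge_1[of T] A in auto)
      finally show ?thesis using K by (simp add: mult_left_mono)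
    qed
  qed
  moreover have "\<exists>n. T \<le> 2 * A0 * 2 ^ n" for T :: real
  proof -
    obtain n where "T < 2 ^ n" using real_arch_pow[of 2 T] by auto
    also have "(2::real) ^ n \<le> 2 * A0 * 2 ^ n" using A0 by simp
    finally show ?thesis using less_imp_le by blast
  qed
  ultimately show ?thesis using K(2) by blast
qed

lemma double_zeta_sq_eq: "double_zeta_sq s0 (of_real (2 * \<sigma>)) = of_real S"
proof -
  \<comment> \<open>The sum over \<open>m < k\<close> is empty for \<open>k = 0\<close> and
    \<open>k = 1\<close>; this accounts for the shift \<open>k = j + 2\<close> in
    \<open>double_zeta_sq\<close>.\<close>
  have q01: "q 0 = 0" "q 1 = 0" by (simp_all add: q_def coef_def psum_def)
  have "S = (\<Sum>j. q (j + 2)) + (\<Sum>k<2. q k)"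
    unfolding S_def by (rule suminf_split_initial_segment[OF q_summable])
  then have S: "S = (\<Sum>j. q (j + 2))" using q01 by (simp add: numeral_2_eq_2)
  have "(let k = j + 2 in of_real ((cmod (\<Sum>m=1..k-1. 1 / of_nat m powr s0))\<^sup>2) / of_nat k powr of_real (2 * \<sigma>)) = complex_of_real (q (j + 2))" for j
  proof -
    define k where "k = j + 2"
    have k: "k > 0" by (simp add: k_def)
    have "{1..k-1} = {1..<k}" using k by auto
    then have 1: "(\<Sum>m=1..k-1. 1 / of_nat m powr s0) = psum s0 k"
      unfolding psum_def by (simp add: powr_minus_divide)
    have "complex_of_nat k powr of_real (2 * \<sigma>) = of_real (real k powr (2 * \<sigma>))"
      using powr_of_real[of "real k" "2 * \<sigma>"] by simp
    moreover have "q k = (cmod (psum s0 k))\<^sup>2 / real k powr (2 * \<sigma>)"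
    proof -
      have "(real k powr (- \<sigma>))\<^sup>2 = real k powr (- \<sigma> + - \<sigma>)" unfolding powr_add by (simp add: power2_eq_square)
      also have "- \<sigma> + - \<sigma> = - (2 * \<sigma>)" by simp
      finally have "(real k powr (- \<sigma>))\<^sup>2 = 1 / real k powr (2 * \<sigma>)" by (simp only: powr_minus_divide)
      moreover have "cmod (of_real (real k powr (- \<sigma>))) = real k powr (- \<sigma>)"
        by (simp only: norm_of_real abs_of_nonneg powr_ge_zero)
      ultimately show ?thesis unfolding q_def coef_def norm_mult power_mult_distrib by simp
    qed
    ultimately show ?thesis unfolding k_def[symmetric] Let_def 1 by simp
  qed
  then have "double_zeta_sq s0 (of_real (2 * \<sigma>)) = (\<Sum>j. complex_of_real (q (j + 2)))"
    unfolding double_zeta_sq_def by presburger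
  also have "\<dots> = of_real S"
    unfolding S using summable_ignore_initial_segment[OF q_summable, of 2] by (rule suminf_of_real[symmetric])
  finally show ?thesis .
qed

text \<open>Only one of the two summands is ever used, with the zero function in the other. If
  \<open>\<alpha> < 1/2\<close>, then \<open>g\<close> is 1 and the square root dominates. Otherwise
  the square root is below \<open>T powr \<alpha>\<close>, and
  \<open>1 + ln T \<le> 2 * ln T\<close> for \<open>T \<ge> exp 1\<close> costs the factor
  \<open>2 ^ b\<close>.\<close>

lemma error_bigo:
  assumes "\<And>T. T \<ge> 2 \<Longrightarrow> R T = integral {2..T} F - S * T"
  shows "\<alpha> < 1/2 \<Longrightarrow> R \<in> O(\<lambda>T. T powr (1/2))"
    and "R \<in> O(\<lambda>T. T powr \<alpha> * (ln T) ^ b) + O(\<lambda>T. T powr (1/2))"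
proof -
  obtain C where C: "C > 0" "\<And>T. T \<ge> 2 \<Longrightarrow> \<bar>integral {2..T} F - S * T\<bar> \<le> C * (T powr (1/2) * g T)"
    using long_interval by blast
  have RC: "norm (R T) \<le> C * (T powr (1/2) * g T)" if "T \<ge> 2" for T
    using C(2)[OF that] assms[OF that] by simp
  have small: "R \<in> O(\<lambda>T. T powr (1/2))" if "\<alpha> < 1/2"
  proof (rule bigoI[of _ C])
    show "\<forall>\<^sub>F T in at_top. norm (R T) \<le> C * norm (T powr (1/2))"
      using eventually_ge_at_top[of "2::real"] by eventually_elim (use RC that in \<open>simp add: g_def\<close>)
  qed
  then show "\<alpha> < 1/2 \<Longrightarrow> R \<in> O(\<lambda>T. T powr (1/2))" .
  have zero: "(\<lambda>_. 0) \<in> O(f)" for f :: "real \<Rightarrow> real" by simp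
  show "R \<in> O(\<lambda>T. T powr \<alpha> * (ln T) ^ b) + O(\<lambda>T. T powr (1/2))"
  proof (cases "\<alpha> < 1/2")
    case True
    have "R = (\<lambda>_. 0) + R" by (simp add: fun_eq_iff)
    then show ?thesis using set_plus_intro[OF zero small[OF True]] by metis
  next
    case False
    have "R \<in> O(\<lambda>T. T powr \<alpha> * (ln T) ^ b)"
    proof (rule bigoI[of _ "C * (1 + 2 ^ b)"])
      show "\<forall>\<^sub>F T in at_top. norm (R T) \<le> C * (1 + 2 ^ b) * norm (T powr \<alpha> * (ln T) ^ b)"
        using eventually_ge_at_top[of "exp 1 + 2"]
      proof eventually_elim
        case (elim T)
        have T: "T \<ge> 2" "T \<ge> exp 1" using elim exp_ge_zero[of "1::real"] by linarith+
        then have ln1: "ln T \<ge> 1" by (simp add: ln_ge_iff)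
        have "T powr (1/2) * g T = T powr (1/2) + T powr (1/2 + (\<alpha> - 1/2)) * (1 + ln T) ^ b"
          unfolding powr_add using False by (simp add: g_def algebra_simps)
        also have "\<dots> \<le> T powr \<alpha> * (ln T) ^ b + T powr \<alpha> * (2 * ln T) ^ b"
        proof (rule add_mono)
          have "T powr (1/2) * 1 \<le> T powr \<alpha> * (ln T) ^ b"
            using False T ln1 by (intro mult_mono powr_mono one_le_power) auto
          then show "T powr (1/2) \<le> T powr \<alpha> * (ln T) ^ b" by simp
          show "T powr (1/2 + (\<alpha> - 1/2)) * (1 + ln T) ^ b \<le> T powr \<alpha> * (2 * ln T) ^ b"
          proof -
            have "(1 + ln T) ^ b \<le> (2 * ln T) ^ b" using ln1 by (intro power_mono) auto
            then have "T powr \<alpha> * (1 + ln T) ^ b \<le> T powr \<alpha> * (2 * ln T) ^ b" by (rule mult_left_mono) simp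
            then show ?thesis by simp
          qed
        qed
        also have "\<dots> = (1 + 2 ^ b) * (T powr \<alpha> * (ln T) ^ b)" by (simp add: algebra_simps)
        finally have "C * (T powr (1/2) * g T) \<le> C * ((1 + 2 ^ b) * (T powr \<alpha> * (ln T) ^ b))"
          using C(1) by (intro mult_left_mono) auto
        then show ?case using RC[OF T(1)] ln1 by (simp add: mult_ac)
      qed
    qed
    moreover have "R = R + (\<lambda>_. 0)" by (simp add: fun_eq_iff)
    ultimately show ?thesis using set_plus_intro[OF _ zero] by metis
  qed
qed

end

theorem theorem1p3:
  fixes s0 :: complex and \<sigma> :: real
  assumes "1/2 < Re s0" and "Re s0 < 3/2"
    and "1/2 < \<sigma>" and "\<sigma> \<le> 1"
    and "3/2 < Re s0 + \<sigma>" and "Re s0 + \<sigma> \<le> 2"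
    and "\<And>t. t \<ge> 2 \<Longrightarrow> s0 + Complex \<sigma> t \<noteq> 2"
  shows "\<exists>R :: real \<Rightarrow> real.
    (\<forall>T\<ge>2. complex_of_real (integral {2..T} (\<lambda>t. (cmod (double_zeta (s0, Complex \<sigma> t)))\<^sup>2))
        = double_zeta_sq s0 (of_real (2 * \<sigma>)) * of_real T + of_real (R T)) \<and>
    (Re s0 < 1 \<and> \<sigma> < 1 \<longrightarrow>
       R \<in> O(\<lambda>T. T powr (4 - 2 * Re s0 - 2 * \<sigma>) * ln T) + O(\<lambda>T. T powr (1/2))) \<and>
    (Re s0 < 1 \<and> \<sigma> = 1 \<longrightarrow>
       R \<in> O(\<lambda>T. T powr (2 - 2 * Re s0) * (ln T)\<^sup>2) + O(\<lambda>T. T powr (1/2))) \<and>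
    (Re s0 = 1 \<and> \<sigma> < 1 \<longrightarrow>
       R \<in> O(\<lambda>T. T powr (2 - 2 * \<sigma>) * (ln T) ^ 3) + O(\<lambda>T. T powr (1/2))) \<and>
    (Re s0 = 1 \<and> \<sigma> = 1 \<longrightarrow>
       R \<in> O(\<lambda>T. T powr (1/2))) \<and>
    (1 < Re s0 \<and> \<sigma> < 1 \<longrightarrow>
       R \<in> O(\<lambda>T. T powr (2 - 2 * \<sigma>) * ln T) + O(\<lambda>T. T powr (1/2)))"
proof -
  interpret mean_square s0 \<sigma>
    by unfold_locales (use assms in auto)
  define R where "R = (\<lambda>T. integral {2..T} F - S * T)"
  have R: "\<alpha> < 1/2 \<Longrightarrow> R \<in> O(\<lambda>T. T powr (1/2))"
    "R \<in> O(\<lambda>T. T powr \<alpha> * (ln T) ^ b) + O(\<lambda>T. T powr (1/2))"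
    by (rule error_bigo; simp add: R_def)+
  note params = \<alpha>_def b_def \<kappa>_def l_def p_def
  show ?thesis
  proof (intro exI[of _ R] conjI allI impI)
    fix T :: real assume "T \<ge> 2"
    show "complex_of_real (integral {2..T} (\<lambda>t. (cmod (double_zeta (s0, Complex \<sigma> t)))\<^sup>2))
        = double_zeta_sq s0 (of_real (2 * \<sigma>)) * of_real T + of_real (R T)"
      unfolding double_zeta_sq_eq R_def F_def[abs_def] by simp
  next
    assume "Re s0 < 1 \<and> \<sigma> < 1"
    then have "\<alpha> = 4 - 2 * Re s0 - 2 * \<sigma>" "b = 1" unfolding params by auto
    then show "R \<in> O(\<lambda>T. T powr (4 - 2 * Re s0 - 2 * \<sigma>) * ln T) + O(\<lambda>T. T powr (1/2))"
      using R(2) by simp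
  next
    assume "Re s0 < 1 \<and> \<sigma> = 1"
    then have "\<alpha> = 2 - 2 * Re s0" "b = 2" unfolding params by auto
    then show "R \<in> O(\<lambda>T. T powr (2 - 2 * Re s0) * (ln T)\<^sup>2) + O(\<lambda>T. T powr (1/2))"
      using R(2) by simp
  next
    assume "Re s0 = 1 \<and> \<sigma> < 1"
    then have "\<alpha> = 2 - 2 * \<sigma>" "b = 3" unfolding params by auto
    then show "R \<in> O(\<lambda>T. T powr (2 - 2 * \<sigma>) * (ln T) ^ 3) + O(\<lambda>T. T powr (1/2))"
      using R(2) by simp
  next
    \<comment> \<open>Here \<open>b = 4\<close>, but the power has exponent
      \<open>\<alpha> = 0\<close>, so the logarithms disappear in the square root.\<close>
    assume "Re s0 = 1 \<and> \<sigma> = 1"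
    then have "\<alpha> = 0" unfolding params by auto
    then show "R \<in> O(\<lambda>T. T powr (1/2))" using R(1) by simp
  next
    assume "1 < Re s0 \<and> \<sigma> < 1"
    then have "\<alpha> = 2 - 2 * \<sigma>" "b = 1" unfolding params by auto
    then show "R \<in> O(\<lambda>T. T powr (2 - 2 * \<sigma>) * ln T) + O(\<lambda>T. T powr (1/2))"
      using R(2) by simp
  qed
qed

end
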